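(* For every $\epsilon>0$ there is an algorithm for the ordered $k$-median problem that runs in time $\operatorname{poly}\bigl((n/\epsilon)^{1/\epsilon}\bigr)$ and returns a feasible solution whose cost is at most $\bigl(18+O(\epsilon)\bigr)\cdot \mathrm{opt}$, where $\mathrm{opt}$ is the optimal cost and $O(\epsilon)$ hides an absolute constant factor.
   Context: Ordered $k$-median problem: we are given a finite metric space $(\mathcal D,\{c_{ij}\}_{i,j\in\mathcal D})$ with $n=|\mathcal D|>k$ points (called clients), an integer $k\ge 0$, and weights $w_1\ge w_2\ge\dots\ge w_n\ge 0$. For a vector $v\in\mathbb R^{\mathcal D}$, $v^{\downarrow}$ denotes $v$ with coordinates sorted in non-increasing order. A solution chooses a set $F\subseteq\mathcal D$ of $k$ centers and assigns each client $j$ to a center $i(j)\in F$; its assignment-cost vector is $\vec c=(c_{i(j)j})_{j\in\mathcal D}$ and its cost is $\mathrm{cost}(w;\vec c)=\sum_{j=1}^n w_j\vec c^{\downarrow}_j$. The goal is to minimize this cost.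
   Formalization: The running time is polynomial in max(n, (n/ε)^{1/ε}), which equals (n/ε)^{1/ε} for ε ≤ 1, since for large ε the stated bound is too small even to write the output; for k = 0, where no feasible solution exists, only the time bound is claimed. *)

theory Defs
  imports
    "HOL-Analysis.Abstract_Metric_Spaces"
    "HOL-Computational_Algebra.Polynomial"
begin

section \<open>The ordered k-median problem\<close>

text \<open>
  The clients are numbered \<open>0, \<dots>, n - 1\<close>, and the weight \<open>w\<^sub>j\<close> of the usual 1-based
  notation is \<open>w (j - 1)\<close>.  The axioms of \<^locale>\<open>Metric_space\<close> require symmetry and
  nonnegativity of \<open>c\<close> also outside the carrier; this loses no generality, since values
  outside the carrier are neither part of an algorithm's input nor of the cost.
\<close>

definition okm_instance :: "nat \<Rightarrow> nat \<Rightarrow> (nat \<Rightarrow> nat \<Rightarrow> real) \<Rightarrow> (nat \<Rightarrow> real) \<Rightarrow> bool" where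
  "okm_instance n k c w \<longleftrightarrow>
     Metric_space {..<n} c \<and> k < n \<and>
     (\<forall>i<n. \<forall>j<n. i \<le> j \<longrightarrow> w j \<le> w i) \<and> (\<forall>j<n. 0 \<le> w j)"

definition sorted_desc :: "nat \<Rightarrow> (nat \<Rightarrow> real) \<Rightarrow> real list" where
  "sorted_desc n v = rev (sort (map v [0..<n]))"

definition ordered_cost :: "nat \<Rightarrow> (nat \<Rightarrow> real) \<Rightarrow> (nat \<Rightarrow> real) \<Rightarrow> real" where
  "ordered_cost n w v = (\<Sum>j<n. w j * sorted_desc n v ! j)"

definition okm_feasible :: "nat \<Rightarrow> nat \<Rightarrow> nat set \<Rightarrow> (nat \<Rightarrow> nat) \<Rightarrow> bool" where
  "okm_feasible n k F \<sigma> \<longleftrightarrow> F \<subseteq> {..<n} \<and> card F = k \<and> (\<forall>j<n. \<sigma> j \<in> F)"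

definition okm_cost ::
    "nat \<Rightarrow> (nat \<Rightarrow> nat \<Rightarrow> real) \<Rightarrow> (nat \<Rightarrow> real) \<Rightarrow> (nat \<Rightarrow> nat) \<Rightarrow> real" where
  "okm_cost n c w \<sigma> = ordered_cost n w (\<lambda>j. c (\<sigma> j) j)"

text \<open>
  Only meaningful if a feasible solution exists, that is, if \<open>k \<ge> 1\<close>; the infimum is then a
  minimum, as only finitely many values occur.
\<close>

definition okm_opt ::
    "nat \<Rightarrow> nat \<Rightarrow> (nat \<Rightarrow> nat \<Rightarrow> real) \<Rightarrow> (nat \<Rightarrow> real) \<Rightarrow> real" where
  "okm_opt n k c w = Inf {okm_cost n c w \<sigma> | F \<sigma>. okm_feasible n k F \<sigma>}"


section \<open>Model of computation\<close>

text \<open>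
  A real RAM in structured form: finitely many natural-number registers and arrays (used for
  counters and for indirect addressing) and finitely many real registers and arrays are
  accessible to a program.  Every instruction and every evaluation of a test costs one time
  unit.  There is no conversion between reals and naturals (in particular no floor function),
  and natural numbers can only be added, subtracted and compared, so that the usual ways of
  packing large computations into single unit-cost operations are not available.
  Constants in programs are natural or rational numbers.
\<close>

record state =
  nreg :: "nat \<Rightarrow> nat"
  rreg :: "nat \<Rightarrow> real"
  narr :: "nat \<Rightarrow> nat \<Rightarrow> nat"
  rarr :: "nat \<Rightarrow> nat \<Rightarrow> real"

datatype nop = NAdd | NSub

datatype rop = RAdd | RSub | RMul | RDiv

text \<open>
  Arguments of instructions are names of registers and arrays, with the destination first.
  In \<open>NLoad x a i\<close>, \<open>NStore a i x\<close> and their real counterparts, \<open>i\<close> is the natural-number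
  register that holds the index into the array \<open>a\<close>.
\<close>

datatype instr =
    NConst nat nat
  | NOp nop nat nat nat
  | NLoad nat nat nat
  | NStore nat nat nat
  | RConst nat rat
  | ROp rop nat nat nat
  | RLoad nat nat nat
  | RStore nat nat nat

datatype test = NLess nat nat | RLess nat nat

datatype com =
    Instr instr
  | Seq com com
  | Cond test com com
  | While test com

fun nop_sem :: "nop \<Rightarrow> nat \<Rightarrow> nat \<Rightarrow> nat" where
  "nop_sem NAdd x y = x + y"
| "nop_sem NSub x y = x - y"

fun rop_sem :: "rop \<Rightarrow> real \<Rightarrow> real \<Rightarrow> real" where
  "rop_sem RAdd x y = x + y"
| "rop_sem RSub x y = x - y"
| "rop_sem RMul x y = x * y"
| "rop_sem RDiv x y = x / y"

fun step :: "instr \<Rightarrow> state \<Rightarrow> state" where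
  "step (NConst x m) s = s\<lparr>nreg := (nreg s)(x := m)\<rparr>"
| "step (NOp f x y z) s = s\<lparr>nreg := (nreg s)(x := nop_sem f (nreg s y) (nreg s z))\<rparr>"
| "step (NLoad x a i) s = s\<lparr>nreg := (nreg s)(x := narr s a (nreg s i))\<rparr>"
| "step (NStore a i x) s =
     s\<lparr>narr := (narr s)(a := (narr s a)(nreg s i := nreg s x))\<rparr>"
| "step (RConst x q) s = s\<lparr>rreg := (rreg s)(x := of_rat q)\<rparr>"
| "step (ROp f x y z) s = s\<lparr>rreg := (rreg s)(x := rop_sem f (rreg s y) (rreg s z))\<rparr>"
| "step (RLoad x a i) s = s\<lparr>rreg := (rreg s)(x := rarr s a (nreg s i))\<rparr>"
| "step (RStore a i x) s =
     s\<lparr>rarr := (rarr s)(a := (rarr s a)(nreg s i := rreg s x))\<rparr>"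

fun holds :: "test \<Rightarrow> state \<Rightarrow> bool" where
  "holds (NLess x y) s \<longleftrightarrow> nreg s x < nreg s y"
| "holds (RLess x y) s \<longleftrightarrow> rreg s x < rreg s y"

text \<open>\<open>exec P s t s'\<close>: started in \<open>s\<close>, program \<open>P\<close> halts after exactly \<open>t\<close> time units in \<open>s'\<close>.\<close>

inductive exec :: "com \<Rightarrow> state \<Rightarrow> nat \<Rightarrow> state \<Rightarrow> bool" where
  Instr: "exec (Instr i) s 1 (step i s)"
| Seq: "exec P s t s' \<Longrightarrow> exec Q s' u s'' \<Longrightarrow> exec (Seq P Q) s (t + u) s''"
| CondTrue: "holds b s \<Longrightarrow> exec P s t s' \<Longrightarrow> exec (Cond b P Q) s (1 + t) s'"
| CondFalse: "\<not> holds b s \<Longrightarrow> exec Q s t s' \<Longrightarrow> exec (Cond b P Q) s (1 + t) s'"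
| WhileFalse: "\<not> holds b s \<Longrightarrow> exec (While b P) s 1 s"
| WhileTrue: "holds b s \<Longrightarrow> exec P s t s' \<Longrightarrow> exec (While b P) s' u s'' \<Longrightarrow>
    exec (While b P) s (1 + t + u) s''"

inductive_cases exec_InstrE: "exec (Instr i) s t s'"
inductive_cases exec_SeqE: "exec (Seq P Q) s t s'"
inductive_cases exec_CondE: "exec (Cond b P Q) s t s'"
inductive_cases exec_WhileE: "exec (While b P) s t s'"

text \<open>Hence ``some run of \<open>P\<close> from \<open>s\<close>'' is the same as ``the run of \<open>P\<close> from \<open>s\<close>''.\<close>

lemma exec_deterministic:
  "exec P s t s' \<Longrightarrow> exec P s u s'' \<Longrightarrow> u = t \<and> s'' = s'"
proof (induction arbitrary: u s'' rule: exec.induct)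
  case (Instr i s)
  from Instr.prems show ?case by (rule exec_InstrE) simp
next
  case (Seq P s t s' Q v r)
  from Seq.prems show ?case by (rule exec_SeqE) (metis Seq.IH)
next
  case (CondTrue b s P t s' Q)
  from CondTrue.prems show ?case by (rule exec_CondE) (metis plus_1_eq_Suc CondTrue.IH CondTrue.hyps(1))+
next
  case (CondFalse b s Q t s' P)
  from CondFalse.prems show ?case by (rule exec_CondE) (metis plus_1_eq_Suc CondFalse.IH CondFalse.hyps(1))+
next
  case (WhileFalse b s P)
  from WhileFalse.prems show ?case by (rule exec_WhileE) (metis One_nat_def WhileFalse.hyps)+
next
  case (WhileTrue b s P t s' v r)
  from WhileTrue.prems show ?case
    by (rule exec_WhileE) (metis plus_1_eq_Suc add_Suc WhileTrue.IH WhileTrue.hyps(1))+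
qed


section \<open>Input and output\<close>

text \<open>
  Input: \<open>n\<close> and \<open>k\<close> in the natural-number registers 0 and 1, the distance matrix in row-major
  order in real array 0, the weights in real array 1, and zeros everywhere else.
  Output: the \<open>k\<close> centers in the first \<open>k\<close> cells of natural-number array 0, and the center of
  client \<open>j\<close> in cell \<open>j\<close> of natural-number array 1.
\<close>

definition okm_input ::
    "nat \<Rightarrow> nat \<Rightarrow> (nat \<Rightarrow> nat \<Rightarrow> real) \<Rightarrow> (nat \<Rightarrow> real) \<Rightarrow> state" where
  "okm_input n k c w =
     \<lparr>nreg = (\<lambda>_. 0)(0 := n, 1 := k),
      rreg = (\<lambda>_. 0),
      narr = (\<lambda>_ _. 0),
      rarr = (\<lambda>_ _. 0)
        (0 := (\<lambda>m. if m < n * n then c (m div n) (m mod n) else 0),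
         1 := (\<lambda>m. if m < n then w m else 0))\<rparr>"

definition output_centers :: "nat \<Rightarrow> state \<Rightarrow> nat set" where
  "output_centers k s = narr s 0 ` {..<k}"

definition output_assignment :: "state \<Rightarrow> nat \<Rightarrow> nat" where
  "output_assignment s = narr s 1"

text \<open>
  An instance with \<open>k = 0\<close> has no feasible solution; there only termination within the time
  bound \<open>T n\<close> is required.
\<close>

definition okm_approx_algorithm :: "com \<Rightarrow> (nat \<Rightarrow> real) \<Rightarrow> real \<Rightarrow> bool" where
  "okm_approx_algorithm P T \<rho> \<longleftrightarrow>
     (\<forall>n k c w. okm_instance n k c w \<longrightarrow>
        (\<exists>t s. exec P (okm_input n k c w) t s \<and> real t \<le> T n \<and>
           ((\<exists>F \<sigma>. okm_feasible n k F \<sigma>) \<longrightarrow>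
              okm_feasible n k (output_centers k s) (output_assignment s) \<and>
              okm_cost n c w (output_assignment s) \<le> \<rho> * okm_opt n k c w)))"

text \<open>
  The quantity in which running times are polynomial.  For \<open>\<epsilon> \<le> 1\<close> and \<open>n \<ge> 1\<close> the maximum
  equals \<open>(n / \<epsilon>) powr (1 / \<epsilon>)\<close>.  For large \<open>\<epsilon>\<close> the latter is smaller than \<open>n\<close>, and indeed
  bounded uniformly if \<open>\<epsilon> \<ge> n\<close>, so that time polynomial in \<open>n\<close> has to be granted separately.
\<close>

definition time_scale :: "real \<Rightarrow> nat \<Rightarrow> real" where
  "time_scale \<epsilon> n = max (real n) ((real n / \<epsilon>) powr (1 / \<epsilon>))"

end

theory Submission
  imports Defs
begin

text \<open>
  The ratio 18 is reached by one program that does not depend on \<open>\<epsilon>\<close>.  It only uses loops with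
  \<open>n\<close> rounds, nested to a constant depth, and therefore runs in polynomial time.

  Summation by parts writes the ordered cost as a nonnegative combination of the sums of the
  \<open>l + 1\<close> largest entries, and such a sum is at most \<open>(l + 1) \<rho> + \<Sum>\<^sub>j max 0 (v\<^sub>j - \<rho>)\<close> for every
  threshold \<open>\<rho>\<close>, with equality if \<open>\<rho>\<close> is the \<open>(l + 1)\<close>-st largest entry.  The thresholds of an
  optimal solution are guessed up to a factor \<open>5/4\<close>, at positions that grow by a factor \<open>3/2\<close>; a
  monotone sequence of \<open>O(log n)\<close> levels at \<open>O(log n)\<close> positions is a bit string of length
  \<open>O(log n)\<close>, so there are polynomially many guesses.  For fixed thresholds a \<open>k\<close>-median problem
  remains whose connection costs obey the triangle inequality up to adding up the multiples of the
  thresholds.  It is solved by primal-dual facility location with Lagrange multiplier \<open>lam\<close>, run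
  in discrete steps \<open>u\<close>, for all multiples \<open>lam\<close> of \<open>u\<close> up to the first with at most \<open>k\<close>
  centers, followed by rounding the last two solutions to \<open>k\<close> centers.  Both solutions
  reach a client within 3 hops at 3 times the optimal connection cost; the rounding combines 3 such
  paths and loses a factor 2, so the thresholds are multiplied by 9 and the connection cost by 6.  The total is \<open>9 \<cdot> 3/2 \<cdot> 5/4 = 16.875\<close> plus rounding errors.
\<close>

section \<open>A language of bounded loops\<close>

text \<open>The machine neither rounds nor converts between naturals and reals, and wrong guesses
  must not cost more time than right ones. Fixed loop counts settle both: the continuous growth of
  the duals becomes \<open>n ^ 11\<close> equal steps, scaled by a guess M of the largest cost,
  which is one of the n^2 distances. With V = \<open>w 0\<close> * M, a lower bound on the cost of
  the solution compared with, the step is \<open>u\<close> = V / n^8. The optimal connection costs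
  add up to at most n V, so multipliers up to about n^3 V are enough, and these are
  \<open>n ^ 11\<close> steps. Thresholds are resolved down to M / n^6. For n \<ge> 2 all these
  errors add up to at most 9/16 V, which fits between 16.875 and 18; hence the ratio does not depend
  on \<epsilon>. A right guess is never recognised. Every candidate set is valued by
  \<open>proxy_cost\<close>, which bounds the true cost from above under arbitrary thresholds, and
  the best one is kept. Soundness is therefore an invariant that mentions no guess, and the ratio
  only needs one good candidate to turn up somewhere in the run.\<close>

abbreviation setn :: "nat \<Rightarrow> nat \<Rightarrow> state \<Rightarrow> state" where
  "setn x m s \<equiv> s\<lparr>nreg := (nreg s)(x := m)\<rparr>"

text \<open>
  All loops and all sums run over \<open>{..<n}\<close> for the input size \<open>n\<close>, which is kept in register 0
  throughout.  Natural numbers also serve as truth values: positive means true.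
\<close>

datatype nexp =
    NVar nat
  | NNum nat
  | NGet nat nexp
  | NBin nop nexp nexp
  | NSum nat nexp
  | NLt nexp nexp
  | RLt rexp rexp
and rexp =
    RVar nat
  | RNum rat
  | RGet nat nexp
  | RBin rop rexp rexp
  | RSum nat rexp
  | RIf nexp rexp rexp

datatype stm =
    NSet nat nexp
  | RSet nat rexp
  | NPut nat nexp nexp
  | RPut nat nexp rexp
  | Sq stm stm (infixr ";;" 60)
  | Branch nexp stm stm
  | For nat stm
  | Loop stm

primrec nval :: "nexp \<Rightarrow> state \<Rightarrow> nat" and rval :: "rexp \<Rightarrow> state \<Rightarrow> real" where
  "nval (NVar x) s = nreg s x"
| "nval (NNum m) s = m"
| "nval (NGet a e) s = narr s a (nval e s)"
| "nval (NBin f e g) s = nop_sem f (nval e s) (nval g s)"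
| "nval (NSum x e) s = (\<Sum>m<nreg s 0. nval e (setn x m s))"
| "nval (NLt e g) s = of_bool (nval e s < nval g s)"
| "nval (RLt e g) s = of_bool (rval e s < rval g s)"
| "rval (RVar x) s = rreg s x"
| "rval (RNum q) s = of_rat q"
| "rval (RGet a e) s = rarr s a (nval e s)"
| "rval (RBin f e g) s = rop_sem f (rval e s) (rval g s)"
| "rval (RSum x e) s = (\<Sum>m<nreg s 0. rval e (setn x m s))"
| "rval (RIf b e g) s = (if 0 < nval b s then rval e s else rval g s)"

primrec sem :: "stm \<Rightarrow> state \<Rightarrow> state" where
  "sem (NSet x e) s = setn x (nval e s) s"
| "sem (RSet x e) s = s\<lparr>rreg := (rreg s)(x := rval e s)\<rparr>"
| "sem (NPut a e g) s = s\<lparr>narr := (narr s)(a := (narr s a)(nval e s := nval g s))\<rparr>"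
| "sem (RPut a e g) s = s\<lparr>rarr := (rarr s)(a := (rarr s a)(nval e s := rval g s))\<rparr>"
| "sem (p ;; q) s = sem q (sem p s)"
| "sem (Branch b p q) s = (if 0 < nval b s then sem p s else sem q s)"
| "sem (For x p) s = fold (\<lambda>m s. sem p (setn x m s)) [0..<nreg s 0] s"
| "sem (Loop p) s = (sem p ^^ nreg s 0) s"

section \<open>Compilation to the machine\<close>

text \<open>
  Registers below \<open>tmp 0\<close> belong to the source program, those from \<open>tmp d\<close> on are scratch space
  at nesting depth \<open>d\<close>.
\<close>

abbreviation tmp :: "nat \<Rightarrow> nat" where "tmp d \<equiv> 40 + d"

text \<open>Register 0 is excluded as a target because it holds the number of rounds of every loop
  and sum.\<close>

primrec nwf :: "nexp \<Rightarrow> bool" and rwf :: "rexp \<Rightarrow> bool" where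
  "nwf (NVar x) \<longleftrightarrow> x < 40"
| "nwf (NNum m) \<longleftrightarrow> True"
| "nwf (NGet a e) \<longleftrightarrow> nwf e"
| "nwf (NBin f e g) \<longleftrightarrow> nwf e \<and> nwf g"
| "nwf (NSum x e) \<longleftrightarrow> 0 < x \<and> x < 40 \<and> nwf e"
| "nwf (NLt e g) \<longleftrightarrow> nwf e \<and> nwf g"
| "nwf (RLt e g) \<longleftrightarrow> rwf e \<and> rwf g"
| "rwf (RVar x) \<longleftrightarrow> x < 40"
| "rwf (RNum q) \<longleftrightarrow> True"
| "rwf (RGet a e) \<longleftrightarrow> nwf e"
| "rwf (RBin f e g) \<longleftrightarrow> rwf e \<and> rwf g"
| "rwf (RSum x e) \<longleftrightarrow> 0 < x \<and> x < 40 \<and> rwf e"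
| "rwf (RIf b e g) \<longleftrightarrow> nwf b \<and> rwf e \<and> rwf g"

primrec swf :: "stm \<Rightarrow> bool" where
  "swf (NSet x e) \<longleftrightarrow> 0 < x \<and> x < 40 \<and> nwf e"
| "swf (RSet x e) \<longleftrightarrow> x < 40 \<and> rwf e"
| "swf (NPut a e g) \<longleftrightarrow> nwf e \<and> nwf g"
| "swf (RPut a e g) \<longleftrightarrow> nwf e \<and> rwf g"
| "swf (p ;; q) \<longleftrightarrow> swf p \<and> swf q"
| "swf (Branch b p q) \<longleftrightarrow> nwf b \<and> swf p \<and> swf q"
| "swf (For x p) \<longleftrightarrow> 0 < x \<and> x < 40 \<and> swf p"
| "swf (Loop p) \<longleftrightarrow> swf p"

abbreviation nmove :: "nat \<Rightarrow> nat \<Rightarrow> nat \<Rightarrow> com" where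
  "nmove z x y \<equiv> Seq (Instr (NConst z 0)) (Instr (NOp NAdd x y z))"

abbreviation nincr :: "nat \<Rightarrow> nat \<Rightarrow> com" where
  "nincr z x \<equiv> Seq (Instr (NConst z 1)) (Instr (NOp NAdd x x z))"

text \<open>The value ends up in \<open>tmp d\<close>, natural or real. A sum saves its bound
  variable in \<open>tmp (d + 2)\<close> and restores it, so that evaluation leaves the source
  registers as they were.\<close>

primrec ncomp :: "nexp \<Rightarrow> nat \<Rightarrow> com" and rcomp :: "rexp \<Rightarrow> nat \<Rightarrow> com" where
  "ncomp (NVar x) d = nmove (tmp d) (tmp d) x"
| "ncomp (NNum m) d = Instr (NConst (tmp d) m)"
| "ncomp (NGet a e) d = Seq (ncomp e d) (Instr (NLoad (tmp d) a (tmp d)))"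
| "ncomp (NBin f e g) d =
     Seq (ncomp e d) (Seq (ncomp g (Suc d)) (Instr (NOp f (tmp d) (tmp d) (tmp (Suc d)))))"
| "ncomp (NSum x e) d =
     Seq (Seq (Instr (NConst (tmp d) 0))
           (Seq (Instr (NConst (tmp (d + 1)) 0)) (nmove (tmp (d + 2)) (tmp (d + 2)) x)))
      (Seq (While (NLess (tmp (d + 1)) 0)
             (Seq (nmove (tmp (d + 3)) x (tmp (d + 1)))
               (Seq (ncomp e (d + 3))
                 (Seq (Instr (NOp NAdd (tmp d) (tmp d) (tmp (d + 3))))
                   (nincr (tmp (d + 3)) (tmp (d + 1)))))))
        (nmove (tmp (d + 3)) x (tmp (d + 2))))"
| "ncomp (NLt e g) d =
     Seq (ncomp e d) (Seq (ncomp g (Suc d))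
       (Cond (NLess (tmp d) (tmp (Suc d))) (Instr (NConst (tmp d) 1)) (Instr (NConst (tmp d) 0))))"
| "ncomp (RLt e g) d =
     Seq (rcomp e d) (Seq (rcomp g (Suc d))
       (Cond (RLess (tmp d) (tmp (Suc d))) (Instr (NConst (tmp d) 1)) (Instr (NConst (tmp d) 0))))"
| "rcomp (RVar x) d = Seq (Instr (RConst (tmp d) 0)) (Instr (ROp RAdd (tmp d) x (tmp d)))"
| "rcomp (RNum q) d = Instr (RConst (tmp d) q)"
| "rcomp (RGet a e) d = Seq (ncomp e d) (Instr (RLoad (tmp d) a (tmp d)))"
| "rcomp (RBin f e g) d =
     Seq (rcomp e d) (Seq (rcomp g (Suc d)) (Instr (ROp f (tmp d) (tmp d) (tmp (Suc d)))))"
| "rcomp (RSum x e) d =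
     Seq (Seq (Instr (RConst (tmp d) 0))
           (Seq (Instr (NConst (tmp (d + 1)) 0)) (nmove (tmp (d + 2)) (tmp (d + 2)) x)))
      (Seq (While (NLess (tmp (d + 1)) 0)
             (Seq (nmove (tmp (d + 3)) x (tmp (d + 1)))
               (Seq (rcomp e (d + 3))
                 (Seq (Instr (ROp RAdd (tmp d) (tmp d) (tmp (d + 3))))
                   (nincr (tmp (d + 3)) (tmp (d + 1)))))))
        (nmove (tmp (d + 3)) x (tmp (d + 2))))"
| "rcomp (RIf b e g) d =
     Seq (ncomp b d) (Seq (Instr (NConst (tmp (Suc d)) 0))
       (Cond (NLess (tmp (Suc d)) (tmp d)) (rcomp e d) (rcomp g d)))"

primrec scomp :: "stm \<Rightarrow> nat \<Rightarrow> com" where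
  "scomp (NSet x e) d = Seq (ncomp e d) (nmove (tmp (Suc d)) x (tmp d))"
| "scomp (RSet x e) d =
     Seq (rcomp e d) (Seq (Instr (RConst (tmp (Suc d)) 0)) (Instr (ROp RAdd x (tmp d) (tmp (Suc d)))))"
| "scomp (NPut a e g) d =
     Seq (ncomp e d) (Seq (ncomp g (Suc d)) (Instr (NStore a (tmp d) (tmp (Suc d)))))"
| "scomp (RPut a e g) d =
     Seq (ncomp e d) (Seq (rcomp g (Suc d)) (Instr (RStore a (tmp d) (tmp (Suc d)))))"
| "scomp (p ;; q) d = Seq (scomp p d) (scomp q d)"
| "scomp (Branch b p q) d =
     Seq (ncomp b d) (Seq (Instr (NConst (tmp (Suc d)) 0))
       (Cond (NLess (tmp (Suc d)) (tmp d)) (scomp p d) (scomp q d)))"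
| "scomp (For x p) d =
     Seq (Instr (NConst (tmp d) 0))
       (While (NLess (tmp d) 0)
         (Seq (nmove (tmp (Suc d)) x (tmp d))
           (Seq (scomp p (Suc d)) (nincr (tmp (Suc d)) (tmp d)))))"
| "scomp (Loop p) d =
     Seq (Instr (NConst (tmp d) 0))
       (While (NLess (tmp d) 0)
         (Seq (scomp p (Suc d)) (nincr (tmp (Suc d)) (tmp d))))"

text \<open>Both branches of a conditional are charged: a sum instead of a maximum keeps the bounds
  within sums and products of constants and n.\<close>

primrec ntime :: "nexp \<Rightarrow> nat \<Rightarrow> nat" and rtime :: "rexp \<Rightarrow> nat \<Rightarrow> nat" where
  "ntime (NVar x) n = 2"
| "ntime (NNum m) n = 1"
| "ntime (NGet a e) n = ntime e n + 1"
| "ntime (NBin f e g) n = ntime e n + (ntime g n + 1)"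
| "ntime (NSum x e) n = 4 + ((n * ((2 + (ntime e n + 3)) + 1) + 1) + 2)"
| "ntime (NLt e g) n = ntime e n + (ntime g n + 2)"
| "ntime (RLt e g) n = rtime e n + (rtime g n + 2)"
| "rtime (RVar x) n = 2"
| "rtime (RNum q) n = 1"
| "rtime (RGet a e) n = ntime e n + 1"
| "rtime (RBin f e g) n = rtime e n + (rtime g n + 1)"
| "rtime (RSum x e) n = 4 + ((n * ((2 + (rtime e n + 3)) + 1) + 1) + 2)"
| "rtime (RIf b e g) n = ntime b n + (1 + (1 + (rtime e n + rtime g n)))"

primrec stime :: "stm \<Rightarrow> nat \<Rightarrow> nat" where
  "stime (NSet x e) n = ntime e n + 2"
| "stime (RSet x e) n = rtime e n + 2"
| "stime (NPut a e g) n = ntime e n + (ntime g n + 1)"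
| "stime (RPut a e g) n = ntime e n + (rtime g n + 1)"
| "stime (p ;; q) n = stime p n + stime q n"
| "stime (Branch b p q) n = ntime b n + (1 + (1 + (stime p n + stime q n)))"
| "stime (For x p) n = 1 + (n * ((2 + (stime p n + 2)) + 1) + 1)"
| "stime (Loop p) n = 1 + (n * ((stime p n + 2) + 1) + 1)"

section \<open>Time-bounded execution of machine programs\<close>

definition runs :: "com \<Rightarrow> state \<Rightarrow> nat \<Rightarrow> (state \<Rightarrow> bool) \<Rightarrow> bool" where
  "runs c s T Q \<longleftrightarrow> (\<exists>t s'. exec c s t s' \<and> t \<le> T \<and> Q s')"

lemma runs_mono: "runs c s T Q \<Longrightarrow> T \<le> T' \<Longrightarrow> (\<And>s'. Q s' \<Longrightarrow> Q' s') \<Longrightarrow> runs c s T' Q'"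
  unfolding runs_def by (meson le_trans)

lemma runs_Instr: "Q (step i s) \<Longrightarrow> runs (Instr i) s 1 Q"
  unfolding runs_def using exec.Instr by blast

lemma runs_Seq: "runs c s T (\<lambda>s'. runs c' s' T' Q) \<Longrightarrow> runs (Seq c c') s (T + T') Q"
  unfolding runs_def by (meson add_mono exec.Seq)

lemma runs_Cond:
  assumes "holds b s \<Longrightarrow> runs c s T Q" "\<not> holds b s \<Longrightarrow> runs c' s T' Q"
  shows "runs (Cond b c c') s (1 + (T + T')) Q"
proof (cases "holds b s")
  case True
  then obtain t s' where "exec c s t s'" "t \<le> T" "Q s'" using assms unfolding runs_def by blast
  moreover have "exec (Cond b c c') s (1 + t) s'" using calculation True exec.CondTrue by blast
  ultimately show ?thesis unfolding runs_def by (intro exI[of _ "1 + t"] exI[of _ s']) simp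
next
  case False
  then obtain t s' where "exec c' s t s'" "t \<le> T'" "Q s'" using assms unfolding runs_def by blast
  moreover have "exec (Cond b c c') s (1 + t) s'" using calculation False exec.CondFalse by blast
  ultimately show ?thesis unfolding runs_def by (intro exI[of _ "1 + t"] exI[of _ s']) simp
qed

lemma runs_test:
  assumes "Q (setn x (of_bool (holds b s)) s)"
  shows "runs (Cond b (Instr (NConst x 1)) (Instr (NConst x 0))) s 2 Q"
proof (cases "holds b s")
  case True
  then show ?thesis using assms exec.CondTrue[OF True exec.Instr[of "NConst x 1" s]]
    by (force simp: runs_def numeral_2_eq_2)
next
  case False
  then show ?thesis using assms exec.CondFalse[OF False exec.Instr[of "NConst x 0" s]]
    by (force simp: runs_def numeral_2_eq_2)
qed

text \<open>Every compiled loop is counted, so an invariant indexed by the number of finished rounds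
  yields termination and the time bound together. Each round pays for one test, and one more test
  fails at the end.\<close>

lemma runs_While:
  assumes "\<And>m s. m < N \<Longrightarrow> I m s \<Longrightarrow> holds b s \<and> runs c s T (I (Suc m))"
    and "\<And>s. I N s \<Longrightarrow> \<not> holds b s" and "I 0 s"
  shows "runs (While b c) s (N * (T + 1) + 1) (I N)"
proof -
  have "I m s \<Longrightarrow> m + k = N \<Longrightarrow> runs (While b c) s (k * (T + 1) + 1) (I N)" for k m s
  proof (induction k arbitrary: m s)
    case 0
    then show ?case unfolding runs_def using assms(2) exec.WhileFalse[of b s c] by force
  next
    case (Suc k)
    then have "holds b s" "runs c s T (I (Suc m))" using assms(1)[of m s] by auto
    then obtain t s' where 1: "exec c s t s'" "t \<le> T" "I (Suc m) s'" unfolding runs_def by blast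
    then obtain u s'' where 2: "exec (While b c) s' u s''" "u \<le> k * (T + 1) + 1" "I N s''"
      using Suc.IH[of "Suc m" s'] Suc.prems unfolding runs_def by auto
    have "exec (While b c) s (1 + t + u) s''" using 1 2 \<open>holds b s\<close> exec.WhileTrue by blast
    then show ?case using 1 2 unfolding runs_def
      by (intro exI[of _ "1 + t + u"] exI[of _ s'']) auto
  qed
  then show ?thesis using assms(3) by (metis add_0)
qed

section \<open>Compiled code against the source semantics\<close>

definition keep :: "nat \<Rightarrow> state \<Rightarrow> state \<Rightarrow> bool" where
  "keep d s s' \<longleftrightarrow> (\<forall>x < tmp d. nreg s' x = nreg s x) \<and> (\<forall>x < tmp d. rreg s' x = rreg s x)
     \<and> narr s' = narr s \<and> rarr s' = rarr s"

lemma keep_refl: "keep d s s"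
  by (simp add: keep_def)

lemma val_cong:
  shows "nwf e \<Longrightarrow> keep 0 s s' \<Longrightarrow> nval e s' = nval e s"
    and "rwf g \<Longrightarrow> keep 0 s s' \<Longrightarrow> rval g s' = rval g s"
proof (induction e and g arbitrary: s s' and s s')
  case (NSum x e)
  have "nval e (setn x m s') = nval e (setn x m s)" for m
    using NSum.prems by (intro NSum.IH) (auto simp: keep_def)
  then show ?case using NSum.prems by (simp add: keep_def)
next
  case (RSum x e)
  have "rval e (setn x m s') = rval e (setn x m s)" for m
    using RSum.prems by (intro RSum.IH) (auto simp: keep_def)
  then show ?case using RSum.prems by (simp add: keep_def)
next
  case (RIf b e g)
  then have "nval b s' = nval b s" "rval e s' = rval e s" "rval g s' = rval g s" by auto
  then show ?case by simp
qed (simp_all add: keep_def, metis+)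

abbreviation evaln :: "nexp \<Rightarrow> nat \<Rightarrow> state \<Rightarrow> state \<Rightarrow> bool" where
  "evaln e d s s' \<equiv> nreg s' (tmp d) = nval e s \<and> keep d s s'"

abbreviation evalr :: "rexp \<Rightarrow> nat \<Rightarrow> state \<Rightarrow> state \<Rightarrow> bool" where
  "evalr e d s s' \<equiv> rreg s' (tmp d) = rval e s \<and> keep d s s'"

lemma keep_less: "keep d s s' \<Longrightarrow> d' \<le> d \<Longrightarrow> keep d' s s'"
  by (auto simp: keep_def)

text \<open>While a sum is evaluated its bound variable is overwritten, so \<open>keep\<close> fails
  for it; the original value sits in \<open>tmp (d + 2)\<close> instead.\<close>

definition sum_inv :: "nat \<Rightarrow> nat \<Rightarrow> state \<Rightarrow> nat \<Rightarrow> state \<Rightarrow> bool" where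
  "sum_inv d x s m s' \<longleftrightarrow> nreg s' (tmp (d + 1)) = m \<and> nreg s' (tmp (d + 2)) = nreg s x
    \<and> (\<forall>y < tmp d. y \<noteq> x \<longrightarrow> nreg s' y = nreg s y)
    \<and> (\<forall>y < tmp d. rreg s' y = rreg s y) \<and> narr s' = narr s \<and> rarr s' = rarr s"

lemma exp_runs:
  shows "nwf e \<Longrightarrow> runs (ncomp e d) s (ntime e (nreg s 0)) (evaln e d s)"
    and "rwf g \<Longrightarrow> runs (rcomp g d) s (rtime g (nreg s 0)) (evalr g d s)"
proof (induction e and g arbitrary: s d and s d)
  case (NVar x)
  have "runs (ncomp (NVar x) d) s (1 + 1) (evaln (NVar x) d s)"
    unfolding ncomp.simps using NVar by (intro runs_Seq runs_Instr) (auto simp: keep_def)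
  then show ?case by (simp add: numeral_2_eq_2)
next
  case (NNum m)
  then show ?case by (auto intro!: runs_Instr[simplified] simp: keep_def)
next
  case (NGet a e)
  show ?case unfolding ncomp.simps ntime.simps
    apply (rule runs_Seq, rule runs_mono[OF NGet.IH order_refl])
    using NGet.prems by (auto intro!: runs_Instr[simplified] simp: keep_def)
next
  case (NBin f e g)
  show ?case unfolding ncomp.simps ntime.simps
  proof (rule runs_Seq, rule runs_mono[OF NBin.IH(1) order_refl])
    fix s1 assume 1: "evaln e d s s1"
    have g: "nval g s1 = nval g s"
      using 1 NBin.prems by (intro val_cong(1)) (auto intro: keep_less)
    have n: "nreg s1 0 = nreg s 0" using 1 by (auto simp: keep_def)
    show "runs (Seq (ncomp g (Suc d)) (Instr (NOp f (tmp d) (tmp d) (tmp (Suc d))))) s1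
      (ntime g (nreg s 0) + 1) (evaln (NBin f e g) d s)"
      apply (rule runs_Seq, rule runs_mono[OF NBin.IH(2)])
      using NBin.prems 1 g n by (auto intro!: runs_Instr[simplified] simp: keep_def)
  qed (use NBin.prems in auto)
next
  case (NLt e g)
  show ?case unfolding ncomp.simps ntime.simps
  proof (rule runs_Seq, rule runs_mono[OF NLt.IH(1) order_refl])
    fix s1 assume 1: "evaln e d s s1"
    have g: "nval g s1 = nval g s"
      using 1 NLt.prems by (intro val_cong(1)) (auto intro: keep_less)
    have n: "nreg s1 0 = nreg s 0" using 1 by (auto simp: keep_def)
    show "runs (Seq (ncomp g (Suc d)) (Cond (NLess (tmp d) (tmp (Suc d))) (Instr (NConst (tmp d) 1))
        (Instr (NConst (tmp d) 0)))) s1 (ntime g (nreg s 0) + 2) (evaln (NLt e g) d s)"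
    proof (rule runs_Seq, rule runs_mono[OF NLt.IH(2)])
      fix s2 assume 2: "evaln g (Suc d) s1 s2"
      show "runs (Cond (NLess (tmp d) (tmp (Suc d))) (Instr (NConst (tmp d) 1))
        (Instr (NConst (tmp d) 0))) s2 2 (evaln (NLt e g) d s)"
        by (rule runs_test) (use 1 2 g in \<open>auto simp: keep_def\<close>)
    qed (use NLt.prems n in auto)
  qed (use NLt.prems in auto)
next
  case (RLt e g)
  show ?case unfolding ncomp.simps ntime.simps
  proof (rule runs_Seq, rule runs_mono[OF RLt.IH(1) order_refl])
    fix s1 assume 1: "evalr e d s s1"
    have g: "rval g s1 = rval g s"
      using 1 RLt.prems by (intro val_cong(2)) (auto intro: keep_less)
    have n: "nreg s1 0 = nreg s 0" using 1 by (auto simp: keep_def)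
    show "runs (Seq (rcomp g (Suc d)) (Cond (RLess (tmp d) (tmp (Suc d))) (Instr (NConst (tmp d) 1))
        (Instr (NConst (tmp d) 0)))) s1 (rtime g (nreg s 0) + 2) (evaln (RLt e g) d s)"
    proof (rule runs_Seq, rule runs_mono[OF RLt.IH(2)])
      fix s2 assume 2: "evalr g (Suc d) s1 s2"
      show "runs (Cond (RLess (tmp d) (tmp (Suc d))) (Instr (NConst (tmp d) 1))
        (Instr (NConst (tmp d) 0))) s2 2 (evaln (RLt e g) d s)"
        by (rule runs_test) (use 1 2 g in \<open>auto simp: keep_def\<close>)
    qed (use RLt.prems n in auto)
  qed (use RLt.prems in auto)
next
  case (NSum x e)
  define n where "n = nreg s 0"
  define I where "I = (\<lambda>m s'. nreg s' (tmp d) = (\<Sum>i<m. nval e (setn x i s)) \<and> sum_inv d x s m s')"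
  have x: "0 < x" "x < 40" "nwf e" using NSum.prems by auto
  have I0: "I m s' \<Longrightarrow> nreg s' 0 = n" for m s' using x by (simp add: I_def sum_inv_def n_def)
  let ?body = "Seq (nmove (tmp (d + 3)) x (tmp (d + 1)))
               (Seq (ncomp e (d + 3))
                 (Seq (Instr (NOp NAdd (tmp d) (tmp d) (tmp (d + 3))))
                   (nincr (tmp (d + 3)) (tmp (d + 1)))))"
  have body: "runs ?body s1 (2 + (ntime e n + 3)) (I (Suc m))" if "I m s1" for m s1
  proof -
    have "runs ?body s1 ((1 + 1) + (ntime e n + (1 + (1 + 1)))) (I (Suc m))"
    proof (intro runs_Seq runs_Instr, rule runs_mono[OF NSum.IH[OF x(3)]])
      let ?s2 = "step (NOp NAdd x (tmp (d + 1)) (tmp (d + 3))) (step (NConst (tmp (d + 3)) 0) s1)"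
      show "ntime e (nreg ?s2 0) \<le> ntime e n" using I0[OF that] x by simp
      have v: "nval e ?s2 = nval e (setn x m s)"
        using that x by (intro val_cong(1)) (auto simp: keep_def I_def sum_inv_def)
      fix s3 assume 3: "evaln e (d + 3) ?s2 s3"
      have k: "nreg s3 y = nreg ?s2 y" "rreg s3 y = rreg ?s2 y" if "y < tmp d + 3" for y
        using 3 that by (auto simp: keep_def)
      show "runs (Seq (Instr (NOp NAdd (tmp d) (tmp d) (tmp (d + 3)))) (nincr (tmp (d + 3)) (tmp (d + 1)))) s3
        (1 + (1 + 1)) (I (Suc m))"
        using that x 3 v
        by (intro runs_Seq runs_Instr) (auto simp: I_def sum_inv_def k keep_def)
    qed
    then show ?thesis by (simp add: eval_nat_numeral)
  qed
  have while: "runs (While (NLess (tmp (d + 1)) 0) ?body) s1 (n * ((2 + (ntime e n + 3)) + 1) + 1) (I n)"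
    if "I 0 s1" for s1
    by (rule runs_While) (use I0 body that in \<open>auto simp: I_def sum_inv_def\<close>)
  have "runs (ncomp (NSum x e) d) s ((1 + (1 + (1 + 1))) + ((n * ((2 + (ntime e n + 3)) + 1) + 1) + (1 + 1)))
    (evaln (NSum x e) d s)"
    unfolding ncomp.simps
  proof (intro runs_Seq runs_Instr, rule runs_mono[OF while order_refl], goal_cases)
    case 1
    show ?case using x by (auto simp: I_def sum_inv_def)
  next
    case (2 s')
    then show ?case using x
      by (intro runs_Seq runs_Instr) (auto simp: I_def sum_inv_def keep_def n_def)
  qed
  then show ?case by (simp add: n_def eval_nat_numeral)
next
  case (RVar x)
  have "runs (rcomp (RVar x) d) s (1 + 1) (evalr (RVar x) d s)"
    unfolding rcomp.simps using RVar by (intro runs_Seq runs_Instr) (auto simp: keep_def)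
  then show ?case by (simp add: numeral_2_eq_2)
next
  case (RNum m)
  then show ?case by (auto intro!: runs_Instr[simplified] simp: keep_def)
next
  case (RGet a e)
  show ?case unfolding rcomp.simps rtime.simps
    apply (rule runs_Seq, rule runs_mono[OF RGet.IH order_refl])
    using RGet.prems by (auto intro!: runs_Instr[simplified] simp: keep_def)
next
  case (RBin f e g)
  show ?case unfolding rcomp.simps rtime.simps
  proof (rule runs_Seq, rule runs_mono[OF RBin.IH(1) order_refl])
    fix s1 assume 1: "evalr e d s s1"
    have g: "rval g s1 = rval g s"
      using 1 RBin.prems by (intro val_cong(2)) (auto intro: keep_less)
    have n: "nreg s1 0 = nreg s 0" using 1 by (auto simp: keep_def)
    show "runs (Seq (rcomp g (Suc d)) (Instr (ROp f (tmp d) (tmp d) (tmp (Suc d))))) s1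
      (rtime g (nreg s 0) + 1) (evalr (RBin f e g) d s)"
      apply (rule runs_Seq, rule runs_mono[OF RBin.IH(2)])
      using RBin.prems 1 g n by (auto intro!: runs_Instr[simplified] simp: keep_def)
  qed (use RBin.prems in auto)
next
  case (RSum x e)
  define n where "n = nreg s 0"
  define I where "I = (\<lambda>m s'. rreg s' (tmp d) = (\<Sum>i<m. rval e (setn x i s)) \<and> sum_inv d x s m s')"
  have x: "0 < x" "x < 40" "rwf e" using RSum.prems by auto
  have I0: "I m s' \<Longrightarrow> nreg s' 0 = n" for m s' using x by (simp add: I_def sum_inv_def n_def)
  let ?body = "Seq (nmove (tmp (d + 3)) x (tmp (d + 1)))
               (Seq (rcomp e (d + 3))
                 (Seq (Instr (ROp RAdd (tmp d) (tmp d) (tmp (d + 3))))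
                   (nincr (tmp (d + 3)) (tmp (d + 1)))))"
  have body: "runs ?body s1 (2 + (rtime e n + 3)) (I (Suc m))" if "I m s1" for m s1
  proof -
    have "runs ?body s1 ((1 + 1) + (rtime e n + (1 + (1 + 1)))) (I (Suc m))"
    proof (intro runs_Seq runs_Instr, rule runs_mono[OF RSum.IH[OF x(3)]])
      let ?s2 = "step (NOp NAdd x (tmp (d + 1)) (tmp (d + 3))) (step (NConst (tmp (d + 3)) 0) s1)"
      show "rtime e (nreg ?s2 0) \<le> rtime e n" using I0[OF that] x by simp
      have v: "rval e ?s2 = rval e (setn x m s)"
        using that x by (intro val_cong(2)) (auto simp: keep_def I_def sum_inv_def)
      fix s3 assume 3: "evalr e (d + 3) ?s2 s3"
      have k: "nreg s3 y = nreg ?s2 y" "rreg s3 y = rreg ?s2 y" if "y < tmp d + 3" for y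
        using 3 that by (auto simp: keep_def)
      show "runs (Seq (Instr (ROp RAdd (tmp d) (tmp d) (tmp (d + 3)))) (nincr (tmp (d + 3)) (tmp (d + 1)))) s3
        (1 + (1 + 1)) (I (Suc m))"
        using that x 3 v
        by (intro runs_Seq runs_Instr) (auto simp: I_def sum_inv_def k keep_def)
    qed
    then show ?thesis by (simp add: eval_nat_numeral)
  qed
  have while: "runs (While (NLess (tmp (d + 1)) 0) ?body) s1 (n * ((2 + (rtime e n + 3)) + 1) + 1) (I n)"
    if "I 0 s1" for s1
    by (rule runs_While) (use I0 body that in \<open>auto simp: I_def sum_inv_def\<close>)
  have "runs (rcomp (RSum x e) d) s ((1 + (1 + (1 + 1))) + ((n * ((2 + (rtime e n + 3)) + 1) + 1) + (1 + 1)))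
    (evalr (RSum x e) d s)"
    unfolding rcomp.simps
  proof (intro runs_Seq runs_Instr, rule runs_mono[OF while order_refl], goal_cases)
    case 1
    show ?case using x by (auto simp: I_def sum_inv_def)
  next
    case (2 s')
    then show ?case using x
      by (intro runs_Seq runs_Instr) (auto simp: I_def sum_inv_def keep_def n_def)
  qed
  then show ?case by (simp add: n_def eval_nat_numeral)
next
  case (RIf b e g)
  show ?case unfolding rcomp.simps rtime.simps
  proof (rule runs_Seq, rule runs_mono[OF RIf.IH(1) order_refl], goal_cases)
    case (2 s1)
    let ?s2 = "step (NConst (tmp (Suc d)) 0) s1"
    have n: "nreg ?s2 0 = nreg s 0" using 2 by (auto simp: keep_def)
    have v: "rval e ?s2 = rval e s" "rval g ?s2 = rval g s"
      using 2 RIf.prems by (auto intro!: val_cong(2) simp: keep_def)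
    show ?case
    proof (intro runs_Seq runs_Instr runs_Cond)
      assume h: "holds (NLess (tmp (Suc d)) (tmp d)) ?s2"
      show "runs (rcomp e d) ?s2 (rtime e (nreg s 0)) (evalr (RIf b e g) d s)"
        by (rule runs_mono[OF RIf.IH(2)]) (use 2 h v n RIf.prems in \<open>auto simp: keep_def\<close>)
    next
      assume h: "\<not> holds (NLess (tmp (Suc d)) (tmp d)) ?s2"
      show "runs (rcomp g d) ?s2 (rtime g (nreg s 0)) (evalr (RIf b e g) d s)"
        by (rule runs_mono[OF RIf.IH(3)]) (use 2 h v n RIf.prems in \<open>auto simp: keep_def\<close>)
    qed
  qed (use RIf.prems in auto)
qed

text \<open>Besides agreeing with the source state, the machine must preserve the counters of the
  enclosing loops. These are natural scratch registers below \<open>tmp d\<close>; real scratch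
  registers are never live across statements.\<close>

definition simul :: "nat \<Rightarrow> state \<Rightarrow> state \<Rightarrow> state \<Rightarrow> bool" where
  "simul d s s0 s' \<longleftrightarrow> keep 0 s s' \<and> (\<forall>x < tmp d. 40 \<le> x \<longrightarrow> nreg s' x = nreg s0 x)"

lemma sem_n: "swf p \<Longrightarrow> nreg (sem p s) 0 = nreg s 0"
proof (induction p arbitrary: s)
  case (For x p)
  have "nreg (fold (\<lambda>m s. sem p (setn x m s)) xs s) 0 = nreg s 0" for xs s
    using For by (induction xs arbitrary: s) auto
  then show ?case by simp
next
  case (Loop p)
  have "nreg ((sem p ^^ m) s) 0 = nreg s 0" for m
    using Loop by (induction m) auto
  then show ?case by simp
qed auto

lemma evaln_comp:
  assumes "nwf e" "simul d s s0 s'" "d \<le> d'" "T = ntime e (nreg s 0)"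
    and "\<And>s1. nreg s1 (tmp d') = nval e s \<Longrightarrow> keep d' s' s1 \<Longrightarrow> Q s1"
  shows "runs (ncomp e d') s' T Q"
proof (rule runs_mono[OF exp_runs(1)])
  have "keep 0 s s'" using assms by (simp add: simul_def)
  then show "ntime e (nreg s' 0) \<le> T" using assms by (simp add: keep_def)
  have "nval e s' = nval e s" using \<open>keep 0 s s'\<close> assms by (intro val_cong(1)) auto
  then show "\<And>s1. evaln e d' s' s1 \<Longrightarrow> Q s1" using assms by auto
qed (use assms in auto)

lemma evalr_comp:
  assumes "rwf e" "simul d s s0 s'" "d \<le> d'" "T = rtime e (nreg s 0)"
    and "\<And>s1. rreg s1 (tmp d') = rval e s \<Longrightarrow> keep d' s' s1 \<Longrightarrow> Q s1"
  shows "runs (rcomp e d') s' T Q"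
proof (rule runs_mono[OF exp_runs(2)])
  have "keep 0 s s'" using assms by (simp add: simul_def)
  then show "rtime e (nreg s' 0) \<le> T" using assms by (simp add: keep_def)
  have "rval e s' = rval e s" using \<open>keep 0 s s'\<close> assms by (intro val_cong(2)) auto
  then show "\<And>s1. evalr e d' s' s1 \<Longrightarrow> Q s1" using assms by auto
qed (use assms in auto)

lemma simul_keep: "simul d s s0 s' \<Longrightarrow> keep d s' s1 \<Longrightarrow> simul d s s0 s1"
  by (auto simp: simul_def keep_def)

lemma scomp_runs:
  assumes "swf p" "keep 0 s s'"
  shows "runs (scomp p d) s' (stime p (nreg s 0)) (simul d (sem p s) s')"
  using assms
proof (induction p arbitrary: s s' d)
  case (NSet x e)
  have s: "simul d s s' s'" using NSet.prems by (simp add: simul_def)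
  have "runs (scomp (NSet x e) d) s' (ntime e (nreg s 0) + (1 + 1)) (simul d (sem (NSet x e) s) s')"
    unfolding scomp.simps
  proof (rule runs_Seq, rule evaln_comp[OF _ s order_refl refl], goal_cases)
    case (2 s1)
    then show ?case using NSet.prems by (intro runs_Seq runs_Instr) (auto simp: simul_def keep_def)
  qed (use NSet.prems in auto)
  then show ?case by (simp add: numeral_2_eq_2)
next
  case (RSet x e)
  have s: "simul d s s' s'" using RSet.prems by (simp add: simul_def)
  have "runs (scomp (RSet x e) d) s' (rtime e (nreg s 0) + (1 + 1)) (simul d (sem (RSet x e) s) s')"
    unfolding scomp.simps
  proof (rule runs_Seq, rule evalr_comp[OF _ s order_refl refl], goal_cases)
    case (2 s1)
    then show ?case using RSet.prems by (intro runs_Seq runs_Instr) (auto simp: simul_def keep_def)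
  qed (use RSet.prems in auto)
  then show ?case by (simp add: numeral_2_eq_2)
next
  case (NPut a e g)
  have s: "simul d s s' s'" using NPut.prems by (simp add: simul_def)
  show ?case unfolding scomp.simps stime.simps
  proof (rule runs_Seq, rule evaln_comp[OF _ s order_refl refl], goal_cases)
    case (2 s1)
    then have s1: "simul d s s' s1" using s simul_keep by blast
    show ?case
      by (rule runs_Seq, rule evaln_comp[OF _ s1])
        (use NPut.prems 2 in \<open>auto intro!: runs_Instr[simplified] simp: simul_def keep_def\<close>)
  qed (use NPut.prems in auto)
next
  case (RPut a e g)
  have s: "simul d s s' s'" using RPut.prems by (simp add: simul_def)
  show ?case unfolding scomp.simps stime.simps
  proof (rule runs_Seq, rule evaln_comp[OF _ s order_refl refl], goal_cases)
    case (2 s1)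
    then have s1: "simul d s s' s1" using s simul_keep by blast
    show ?case
      by (rule runs_Seq, rule evalr_comp[OF _ s1])
        (use RPut.prems 2 in \<open>auto intro!: runs_Instr[simplified] simp: simul_def keep_def\<close>)
  qed (use RPut.prems in auto)
next
  case (Sq p q)
  show ?case unfolding scomp.simps stime.simps
  proof (rule runs_Seq, rule runs_mono[OF Sq.IH(1) order_refl], goal_cases)
    case (3 s1)
    have "runs (scomp q d) s1 (stime q (nreg (sem p s) 0)) (simul d (sem q (sem p s)) s1)"
      using 3 Sq.prems by (intro Sq.IH(2)) (auto simp: simul_def)
    then show ?case
      by (rule runs_mono) (use Sq.prems 3 in \<open>auto simp: simul_def sem_n\<close>)
  qed (use Sq.prems in auto)
next
  case (Branch b p q)
  have s: "simul d s s' s'" using Branch.prems by (simp add: simul_def)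
  show ?case unfolding scomp.simps stime.simps
  proof (rule runs_Seq, rule evaln_comp[OF _ s order_refl refl], goal_cases)
    case (2 s1)
    let ?s2 = "step (NConst (tmp (Suc d)) 0) s1"
    have k: "keep 0 s ?s2" using 2 Branch.prems by (auto simp: keep_def)
    show ?case
    proof (intro runs_Seq runs_Instr runs_Cond)
      assume h: "holds (NLess (tmp (Suc d)) (tmp d)) ?s2"
      show "runs (scomp p d) ?s2 (stime p (nreg s 0)) (simul d (sem (Branch b p q) s) s')"
        by (rule runs_mono[OF Branch.IH(1)[OF _ k] order_refl])
          (use 2 h Branch.prems in \<open>auto simp: simul_def keep_def\<close>)
    next
      assume h: "\<not> holds (NLess (tmp (Suc d)) (tmp d)) ?s2"
      show "runs (scomp q d) ?s2 (stime q (nreg s 0)) (simul d (sem (Branch b p q) s) s')"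
        by (rule runs_mono[OF Branch.IH(2)[OF _ k] order_refl])
          (use 2 h Branch.prems in \<open>auto simp: simul_def keep_def\<close>)
    qed
  qed (use Branch.prems in auto)
next
  case (For x p)
  define n where "n = nreg s 0"
  \<comment> \<open>The source state after m rounds, with which the machine is compared. The hidden
    counter \<open>tmp d\<close> controls the loop, so the body may overwrite
    \<open>x\<close>.\<close>
  define st where "st = (\<lambda>m. fold (\<lambda>m s. sem p (setn x m s)) [0..<m] s)"
  have st_n: "nreg (st m) 0 = n" for m
    using For.prems by (induction m) (auto simp: st_def n_def sem_n)
  define I where "I = (\<lambda>m s1. simul d (st m) s' s1 \<and> nreg s1 (tmp d) = m)"
  have I0: "nreg s1 0 = n" if "I m s1" for m s1
    using that st_n[of m] by (auto simp: I_def simul_def keep_def)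
  let ?body = "Seq (nmove (tmp (Suc d)) x (tmp d)) (Seq (scomp p (Suc d)) (nincr (tmp (Suc d)) (tmp d)))"
  have body: "runs ?body s1 (2 + (stime p n + 2)) (I (Suc m))" if "I m s1" for m s1
  proof -
    have "runs ?body s1 ((1 + 1) + (stime p n + (1 + 1))) (I (Suc m))"
    proof (intro runs_Seq runs_Instr, rule runs_mono[OF For.IH[where s="setn x m (st m)"]])
      let ?s2 = "step (NOp NAdd x (tmp d) (tmp (Suc d))) (step (NConst (tmp (Suc d)) 0) s1)"
      show "swf p" using For.prems by simp
      show "keep 0 (setn x m (st m)) ?s2" using that For.prems by (auto simp: I_def simul_def keep_def)
      show "stime p (nreg (setn x m (st m)) 0) \<le> stime p n" using st_n For.prems by simp
      fix s3 assume "simul (Suc d) (sem p (setn x m (st m))) ?s2 s3"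
      then show "runs (nincr (tmp (Suc d)) (tmp d)) s3 (1 + 1) (I (Suc m))"
        using that For.prems
        by (intro runs_Seq runs_Instr) (auto simp: I_def simul_def keep_def st_def)
    qed
    then show ?thesis by (simp add: eval_nat_numeral)
  qed
  have "runs (While (NLess (tmp d) 0) ?body) s1 (n * ((2 + (stime p n + 2)) + 1) + 1) (I n)"
    if "I 0 s1" for s1
    by (rule runs_While) (use I0 body that in \<open>auto simp: I_def\<close>)
  then have "runs (scomp (For x p) d) s' (1 + (n * ((2 + (stime p n + 2)) + 1) + 1)) (I n)"
    unfolding scomp.simps using For.prems
    by (intro runs_Seq runs_Instr) (auto simp: I_def simul_def keep_def st_def)
  then show ?case
    by (rule runs_mono) (auto simp: I_def st_def n_def)
next
  case (Loop p)
  define n where "n = nreg s 0"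
  define st where "st = (\<lambda>m. (sem p ^^ m) s)"
  have st_n: "nreg (st m) 0 = n" for m
    using Loop.prems by (induction m) (auto simp: st_def n_def sem_n)
  define I where "I = (\<lambda>m s1. simul d (st m) s' s1 \<and> nreg s1 (tmp d) = m)"
  have I0: "nreg s1 0 = n" if "I m s1" for m s1
    using that st_n[of m] by (auto simp: I_def simul_def keep_def)
  let ?body = "Seq (scomp p (Suc d)) (nincr (tmp (Suc d)) (tmp d))"
  have body: "runs ?body s1 (stime p n + 2) (I (Suc m))" if "I m s1" for m s1
  proof -
    have "runs ?body s1 (stime p n + (1 + 1)) (I (Suc m))"
    proof (intro runs_Seq runs_Instr, rule runs_mono[OF Loop.IH[where s="st m"]])
      show "swf p" using Loop.prems by simp
      show "keep 0 (st m) s1" using that Loop.prems by (auto simp: I_def simul_def keep_def)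
      show "stime p (nreg (st m) 0) \<le> stime p n" using st_n by simp
      fix s3 assume "simul (Suc d) (sem p (st m)) s1 s3"
      then show "runs (nincr (tmp (Suc d)) (tmp d)) s3 (1 + 1) (I (Suc m))"
        using that Loop.prems
        by (intro runs_Seq runs_Instr) (auto simp: I_def simul_def keep_def st_def)
    qed
    then show ?thesis by (simp add: eval_nat_numeral)
  qed
  have "runs (While (NLess (tmp d) 0) ?body) s1 (n * ((stime p n + 2) + 1) + 1) (I n)"
    if "I 0 s1" for s1
    by (rule runs_While) (use I0 body that in \<open>auto simp: I_def\<close>)
  then have "runs (scomp (Loop p) d) s' (1 + (n * ((stime p n + 2) + 1) + 1)) (I n)"
    unfolding scomp.simps using Loop.prems
    by (intro runs_Seq runs_Instr) (auto simp: I_def simul_def keep_def st_def)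
  then show ?case
    by (rule runs_mono) (auto simp: I_def st_def n_def)
qed

theorem compile_correct:
  assumes "swf p"
  shows "\<exists>t s'. exec (scomp p 0) s t s' \<and> t \<le> stime p (nreg s 0) \<and> narr s' = narr (sem p s)"
  using scomp_runs[OF assms keep_refl, of 0 s] by (force simp: runs_def simul_def keep_def)

text \<open>Nonnegative coefficients make the polynomial monotone on nonnegative arguments, so that
  n can finally be replaced by the larger \<open>time_scale\<close>.\<close>

definition poly_bounded :: "(nat \<Rightarrow> nat) \<Rightarrow> bool" where
  "poly_bounded f \<longleftrightarrow> (\<exists>p::real poly. (\<forall>i. 0 \<le> coeff p i) \<and> (\<forall>n. real (f n) \<le> poly p (real n)))"

lemma poly_bounded_const: "poly_bounded (\<lambda>n. c)"
  unfolding poly_bounded_def by (rule exI[of _ "[:real c:]"]) (simp add: coeff_pCons split: nat.split)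

lemma poly_bounded_id: "poly_bounded (\<lambda>n. n)"
  unfolding poly_bounded_def by (rule exI[of _ "[:0, 1:]"]) (simp add: coeff_pCons split: nat.split)

lemma poly_bounded_add:
  assumes "poly_bounded f" "poly_bounded g"
  shows "poly_bounded (\<lambda>n. f n + g n)"
proof -
  obtain p q :: "real poly" where "\<forall>i. 0 \<le> coeff p i" "\<forall>n. real (f n) \<le> poly p (real n)"
    "\<forall>i. 0 \<le> coeff q i" "\<forall>n. real (g n) \<le> poly q (real n)"
    using assms unfolding poly_bounded_def by blast
  then show ?thesis unfolding poly_bounded_def
    by (intro exI[of _ "p + q"]) (auto intro: add_mono)
qed

lemma poly_bounded_mult:
  assumes "poly_bounded f" "poly_bounded g"
  shows "poly_bounded (\<lambda>n. f n * g n)"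
proof -
  obtain p q :: "real poly" where *: "\<forall>i. 0 \<le> coeff p i" "\<forall>n. real (f n) \<le> poly p (real n)"
    "\<forall>i. 0 \<le> coeff q i" "\<forall>n. real (g n) \<le> poly q (real n)"
    using assms unfolding poly_bounded_def by blast
  have "0 \<le> coeff (p * q) i" for i
    using * by (auto simp: coeff_mult intro!: sum_nonneg)
  moreover have "real (f n) * real (g n) \<le> poly p (real n) * poly q (real n)" for n
    using * by (intro mult_mono) (auto intro: order_trans[OF of_nat_0_le_iff])
  ultimately show ?thesis unfolding poly_bounded_def
    by (intro exI[of _ "p * q"]) auto
qed

lemma poly_bounded_exp: "poly_bounded (ntime e)" "poly_bounded (rtime g)"
  by (induction e and g)
    (simp_all add: poly_bounded_const poly_bounded_id poly_bounded_add poly_bounded_mult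
      del: add_2_eq_Suc add_2_eq_Suc' One_nat_def)

lemma poly_bounded_stime: "poly_bounded (stime p)"
  by (induction p)
    (simp_all add: poly_bounded_exp poly_bounded_const poly_bounded_id poly_bounded_add poly_bounded_mult
      del: add_2_eq_Suc add_2_eq_Suc' One_nat_def)

section \<open>Ordered costs and thresholds\<close>

type_synonym vec = "nat \<Rightarrow> real"
type_synonym mat = "nat \<Rightarrow> nat \<Rightarrow> real"

definition gap :: "nat \<Rightarrow> vec \<Rightarrow> nat \<Rightarrow> real" where
  "gap n w l = w l - (if Suc l < n then w (Suc l) else 0)"

text \<open>
  The factor \<open>t\<close> counts the hops of a path in a triangle inequality: every hop uses up one
  multiple of the thresholds, see \<open>thr_cost_add\<close>.
\<close>

definition thr_cost :: "nat \<Rightarrow> vec \<Rightarrow> vec \<Rightarrow> real \<Rightarrow> real \<Rightarrow> real" where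
  "thr_cost n w \<rho> t d = (\<Sum>l<n. gap n w l * max 0 (d - t * \<rho> l))"

definition proxy_cost :: "nat \<Rightarrow> vec \<Rightarrow> vec \<Rightarrow> vec \<Rightarrow> real" where
  "proxy_cost n w \<tau> v = (\<Sum>l<n. gap n w l * (real (Suc l) * \<tau> l + (\<Sum>j<n. max 0 (v j - \<tau> l))))"

lemma gap_nonneg:
  assumes "okm_instance n k c w" "l < n"
  shows "0 \<le> gap n w l"
  using assms by (auto simp: okm_instance_def gap_def)

lemma sum_gap: "0 < n \<Longrightarrow> (\<Sum>l<n. gap n w l) = w 0"
proof -
  assume n: "0 < n"
  have "(\<Sum>l<m. gap n w l) = w 0 - (if m < n then w m else 0)" if "m \<le> n" for m
    using that n by (induction m) (auto simp: gap_def)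
  then show ?thesis using n by simp
qed

text \<open>Summation by parts for \<open>w\<close> extended by zero from index n on; the last case
  of \<open>gap\<close> is this extension.\<close>

lemma abel_sum: "(\<Sum>y<n. w y * s y) = (\<Sum>l<n. gap n w l * (\<Sum>y\<le>l. s y))"
proof -
  have *: "(\<Sum>y<m. w y * s y) = (\<Sum>l<m. (w l - w (Suc l)) * (\<Sum>y\<le>l. s y)) + w m * (\<Sum>y<m. s y)"
    for m and w :: "nat \<Rightarrow> real"
    by (induction m) (auto simp: algebra_simps lessThan_Suc_atMost[symmetric])
  let ?w = "\<lambda>l. if l < n then w l else 0"
  have "(\<Sum>y<n. w y * s y) = (\<Sum>y<n. ?w y * s y)" by simp
  also have "\<dots> = (\<Sum>l<n. gap n w l * (\<Sum>y\<le>l. s y))"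
    using *[where m=n and w="?w"] by (auto simp: gap_def intro!: sum.cong)
  finally show ?thesis .
qed

lemma length_sorted_desc [simp]: "length (sorted_desc n v) = n"
  by (simp add: sorted_desc_def)

lemma sum_sorted_desc:
  fixes f :: "real \<Rightarrow> real"
  shows "(\<Sum>y<n. f (sorted_desc n v ! y)) = (\<Sum>j<n. f (v j))"
proof -
  have "(\<Sum>y<n. f (sorted_desc n v ! y)) = sum_list (map f (sorted_desc n v))"
    by (simp add: sum_list_sum_nth atLeast0LessThan)
  also have "\<dots> = sum_mset (image_mset f (mset (sorted_desc n v)))"
    by (metis mset_map sum_mset_sum_list)
  also have "mset (sorted_desc n v) = mset (map v [0..<n])"
    by (simp add: sorted_desc_def)
  also have "sum_mset (image_mset f (mset (map v [0..<n]))) = sum_list (map f (map v [0..<n]))"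
    by (metis mset_map sum_mset_sum_list)
  also have "\<dots> = (\<Sum>j<n. f (v j))"
    by (simp add: sum_list_sum_nth atLeast0LessThan)
  finally show ?thesis .
qed

lemma sorted_desc_antimono: "i \<le> j \<Longrightarrow> j < n \<Longrightarrow> sorted_desc n v ! j \<le> sorted_desc n v ! i"
  unfolding sorted_desc_def by (simp add: rev_nth sorted_nth_mono)

lemma set_sorted_desc: "set (sorted_desc n v) = v ` {..<n}"
  by (auto simp: sorted_desc_def)

lemma sorted_desc_nonneg:
  assumes "\<And>j. j < n \<Longrightarrow> 0 \<le> v j" "y < n"
  shows "0 \<le> sorted_desc n v ! y"
proof -
  have "sorted_desc n v ! y \<in> v ` {..<n}" using assms set_sorted_desc by (metis length_sorted_desc nth_mem)
  then show ?thesis using assms by auto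
qed

text \<open>An entry x is at most \<tau> + max 0 (x - \<tau>), and extending the excess from the top
  l + 1 entries to all of them only adds nonnegative terms. As this holds for every \<tau>, even a
  wrong guess certifies an upper bound.\<close>

lemma ordered_cost_le_proxy:
  assumes "okm_instance n k c w"
  shows "ordered_cost n w v \<le> proxy_cost n w \<tau> v"
  unfolding ordered_cost_def proxy_cost_def abel_sum[where w=w]
proof (intro sum_mono mult_left_mono gap_nonneg[OF assms])
  fix l assume l: "l \<in> {..<n}"
  let ?s = "\<lambda>y. sorted_desc n v ! y"
  have "(\<Sum>y\<le>l. ?s y) \<le> (\<Sum>y\<le>l. \<tau> l + max 0 (?s y - \<tau> l))"
    by (intro sum_mono) auto
  also have "\<dots> = real (Suc l) * \<tau> l + (\<Sum>y\<le>l. max 0 (?s y - \<tau> l))"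
    by (simp add: sum.distrib)
  also have "(\<Sum>y\<le>l. max 0 (?s y - \<tau> l)) \<le> (\<Sum>y<n. max 0 (?s y - \<tau> l))"
    using l by (intro sum_mono2) auto
  also have "\<dots> = (\<Sum>j<n. max 0 (v j - \<tau> l))" by (rule sum_sorted_desc)
  finally show "(\<Sum>y\<le>l. ?s y) \<le> real (Suc l) * \<tau> l + (\<Sum>j<n. max 0 (v j - \<tau> l))" by simp
qed auto

text \<open>For fixed thresholds the first sum is a constant and the second one splits over the
  clients: what remains is a k-median problem.\<close>

lemma proxy_cost_alt:
  "proxy_cost n w (\<lambda>l. t * \<rho> l) v =
     (\<Sum>l<n. gap n w l * (t * (real (Suc l) * \<rho> l))) + (\<Sum>j<n. thr_cost n w \<rho> t (v j))"
proof -
  have "(\<Sum>j<n. thr_cost n w \<rho> t (v j)) = (\<Sum>l<n. \<Sum>j<n. gap n w l * max 0 (v j - t * \<rho> l))"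
    unfolding thr_cost_def by (rule sum.swap)
  then show ?thesis
    by (simp add: proxy_cost_def sum.distrib[symmetric] sum_distrib_left algebra_simps)
qed

text \<open>
  The guessed thresholds approximate the entries of the sorted optimal cost vector at the block
  starts \<open>p\<close>; a block reaches from \<open>p\<close> to about \<open>3 p / 2\<close>.
\<close>

definition good_guess :: "real \<Rightarrow> vec \<Rightarrow> vec \<Rightarrow> nat \<Rightarrow> bool" where
  "good_guess \<kappa> s \<rho> l \<longleftrightarrow>
     (\<exists>p\<le>l. 2 * (l + 1) \<le> 3 * (p + 1) \<and> s p \<le> \<rho> l \<and> \<rho> l \<le> 5/4 * s p + \<kappa>)"

text \<open>Let A = (p + 1) s_p for the block start p and let Z be the sum of the top p + 1 entries,
  so A \<le> Z. Block length and level accuracy give (l + 1) \<rho> \<le> 3/2 * 5/4 * A plus an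
  error, while \<rho> \<ge> s_p bounds the excess by Z - A. Now 135/8 * A + 6 * (Z - A) \<le> 135/8
  * Z because 6 < 135/8: the factor 6 on connection costs is absorbed by the factor on the
  thresholds.\<close>

lemma good_guess_top:
  assumes v: "\<And>j. j < n \<Longrightarrow> 0 \<le> v j" and l: "l < n" and \<kappa>: "0 \<le> \<kappa>"
    and good: "good_guess \<kappa> (\<lambda>y. sorted_desc n v ! y) \<rho> l"
  shows "9 * (real (Suc l) * \<rho> l) + 6 * (\<Sum>j<n. max 0 (v j - \<rho> l))
    \<le> 135/8 * (\<Sum>y\<le>l. sorted_desc n v ! y) + 9 * real n * \<kappa>"
proof -
  let ?s = "\<lambda>y. sorted_desc n v ! y"
  obtain p where p: "p \<le> l" "2 * (l + 1) \<le> 3 * (p + 1)" "?s p \<le> \<rho> l" "\<rho> l \<le> 5/4 * ?s p + \<kappa>"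
    using good unfolding good_guess_def by auto
  have s0: "0 \<le> ?s y" if "y < n" for y using sorted_desc_nonneg[OF v that] by simp
  have lp: "real (Suc l) \<le> 3/2 * real (Suc p)" using of_nat_mono[OF p(2), where 'a=real] by simp
  have "real (Suc l) * \<rho> l \<le> real (Suc l) * (5/4 * ?s p + \<kappa>)"
    using p by (intro mult_left_mono) auto
  also have "\<dots> = real (Suc l) * (5/4 * ?s p) + real (Suc l) * \<kappa>" by (simp add: algebra_simps)
  also have "\<dots> \<le> 3/2 * real (Suc p) * (5/4 * ?s p) + real n * \<kappa>"
    using lp s0[of p] p l \<kappa> by (intro add_mono mult_right_mono) auto
  also have "3/2 * real (Suc p) * (5/4 * ?s p) = 15/8 * (real (Suc p) * ?s p)"
    by (simp add: algebra_simps)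
  finally have 1: "real (Suc l) * \<rho> l \<le> 15/8 * (real (Suc p) * ?s p) + real n * \<kappa>" .
  have "(\<Sum>j<n. max 0 (v j - \<rho> l)) = (\<Sum>y<n. max 0 (?s y - \<rho> l))"
    by (rule sum_sorted_desc[symmetric])
  also have "\<dots> = (\<Sum>y\<le>p. max 0 (?s y - \<rho> l))"
  proof (rule sum.mono_neutral_right)
    show "\<forall>i\<in>{..<n} - {..p}. max 0 (?s i - \<rho> l) = 0"
    proof
      fix i assume "i \<in> {..<n} - {..p}"
      then have "?s i \<le> ?s p" by (intro sorted_desc_antimono) auto
      then show "max 0 (?s i - \<rho> l) = 0" using p by linarith
    qed
  qed (use p l in auto)
  also have "\<dots> \<le> (\<Sum>y\<le>p. ?s y - ?s p)"
    using sorted_desc_antimono[of _ p n v] p l by (intro sum_mono) auto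
  also have "\<dots> = (\<Sum>y\<le>p. ?s y) - real (Suc p) * ?s p"
    by (simp add: sum_subtractf)
  finally have 2: "(\<Sum>j<n. max 0 (v j - \<rho> l)) \<le> (\<Sum>y\<le>p. ?s y) - real (Suc p) * ?s p" .
  have "(\<Sum>y\<le>p. ?s p) \<le> (\<Sum>y\<le>p. ?s y)"
    using sorted_desc_antimono[of _ p n v] p l by (intro sum_mono) auto
  then have 3: "real (Suc p) * ?s p \<le> (\<Sum>y\<le>p. ?s y)" by simp
  have 4: "(\<Sum>y\<le>p. ?s y) \<le> (\<Sum>y\<le>l. ?s y)"
    using p l s0 by (intro sum_mono2) auto
  show ?thesis using 1 2 3 4 by linarith
qed

lemma thr_cost_mono:
  assumes "okm_instance n k c w" "d \<le> d'"
  shows "thr_cost n w \<rho> t d \<le> thr_cost n w \<rho> t d'"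
  unfolding thr_cost_def using assms
  by (intro sum_mono mult_left_mono gap_nonneg[OF assms(1)]) auto

lemma thr_cost_nonneg:
  assumes "okm_instance n k c w"
  shows "0 \<le> thr_cost n w \<rho> t d"
  unfolding thr_cost_def using gap_nonneg[OF assms] by (intro sum_nonneg mult_nonneg_nonneg) auto

lemma thr_cost_add:
  assumes "okm_instance n k c w"
  shows "thr_cost n w \<rho> (t + t') (d + d') \<le> thr_cost n w \<rho> t d + thr_cost n w \<rho> t' d'"
  unfolding thr_cost_def sum.distrib[symmetric] distrib_left[symmetric]
  by (intro sum_mono mult_left_mono gap_nonneg[OF assms]) (auto simp: algebra_simps)

lemma thr_cost_antimono:
  assumes "okm_instance n k c w" "\<And>l. l < n \<Longrightarrow> 0 \<le> \<rho> l" "t \<le> t'"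
  shows "thr_cost n w \<rho> t' d \<le> thr_cost n w \<rho> t d"
  unfolding thr_cost_def
proof (intro sum_mono mult_left_mono gap_nonneg[OF assms(1)])
  fix l assume "l \<in> {..<n}"
  then have "t * \<rho> l \<le> t' * \<rho> l" using assms by (intro mult_right_mono) auto
  then show "max 0 (d - t' * \<rho> l) \<le> max 0 (d - t * \<rho> l)" by auto
qed auto

section \<open>The primal-dual algorithm\<close>

definition opened :: "nat \<Rightarrow> mat \<Rightarrow> real \<Rightarrow> vec \<Rightarrow> nat \<Rightarrow> bool" where
  "opened n h lam \<alpha> i \<longleftrightarrow> lam \<le> (\<Sum>j<n. max 0 (\<alpha> j - h i j))"

definition frozen :: "nat \<Rightarrow> mat \<Rightarrow> real \<Rightarrow> vec \<Rightarrow> nat \<Rightarrow> bool" where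
  "frozen n h lam \<alpha> j \<longleftrightarrow> (\<exists>i<n. opened n h lam \<alpha> i \<and> h i j \<le> \<alpha> j)"

definition raise :: "nat \<Rightarrow> mat \<Rightarrow> real \<Rightarrow> real \<Rightarrow> vec \<Rightarrow> nat \<Rightarrow> real" where
  "raise n h lam u \<alpha> = (\<lambda>j. if frozen n h lam \<alpha> j then \<alpha> j else \<alpha> j + u)"

definition dual :: "nat \<Rightarrow> mat \<Rightarrow> real \<Rightarrow> real \<Rightarrow> nat \<Rightarrow> nat \<Rightarrow> real" where
  "dual n h lam u \<tau> = (raise n h lam u ^^ \<tau>) (\<lambda>_. 0)"

text \<open>
  Contributions are measured by \<open>\<alpha> j - u\<close>: the last raise may overshoot the edge cost by less
  than \<open>u\<close>, and lowering all duals by \<open>u\<close> makes them feasible.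
\<close>

definition conflict :: "nat \<Rightarrow> mat \<Rightarrow> real \<Rightarrow> vec \<Rightarrow> nat \<Rightarrow> nat \<Rightarrow> bool" where
  "conflict n h u \<alpha> i i' \<longleftrightarrow> (\<exists>j<n. h i j < \<alpha> j - u \<and> h i' j < \<alpha> j - u)"

text \<open>A maximal independent set of the conflict graph on the opened facilities. It is a
  relation, so the analysis does not depend on how such a set is found.\<close>

definition selection :: "nat \<Rightarrow> mat \<Rightarrow> real \<Rightarrow> real \<Rightarrow> vec \<Rightarrow> nat set \<Rightarrow> bool" where
  "selection n h lam u \<alpha> S \<longleftrightarrow>
     S \<subseteq> {i. i < n \<and> opened n h lam \<alpha> i} \<and>
     (\<forall>i\<in>S. \<forall>i'\<in>S. i \<noteq> i' \<longrightarrow> \<not> conflict n h u \<alpha> i i') \<and>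
     (\<forall>i<n. opened n h lam \<alpha> i \<longrightarrow> i \<in> S \<or> (\<exists>i'\<in>S. conflict n h u \<alpha> i i'))"

lemma raise_ge: "0 \<le> u \<Longrightarrow> \<alpha> j \<le> raise n h lam u \<alpha> j"
  by (simp add: raise_def)

lemma opened_mono:
  assumes "opened n h lam \<alpha> i" "\<And>j. \<alpha> j \<le> \<alpha>' j"
  shows "opened n h lam \<alpha>' i"
proof -
  have "(\<Sum>j<n. max 0 (\<alpha> j - h i j)) \<le> (\<Sum>j<n. max 0 (\<alpha>' j - h i j))"
    using assms(2) by (intro sum_mono max.mono) (auto simp: algebra_simps)
  then show ?thesis using assms(1) by (simp add: opened_def)
qed

lemma frozen_raise:
  assumes "0 \<le> u" "frozen n h lam \<alpha> j"
  shows "frozen n h lam (raise n h lam u \<alpha>) j"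
proof -
  have "raise n h lam u \<alpha> j = \<alpha> j" using assms by (simp add: raise_def)
  then show ?thesis
    using assms opened_mono[where \<alpha>="\<alpha>" and \<alpha>'="raise n h lam u \<alpha>"] raise_ge[OF assms(1)]
    unfolding frozen_def by metis
qed

text \<open>\<open>\<theta> i\<close> is the time at which facility \<open>i\<close> is opened.\<close>

definition dual_inv :: "nat \<Rightarrow> mat \<Rightarrow> real \<Rightarrow> real \<Rightarrow> nat \<Rightarrow> vec \<Rightarrow> vec \<Rightarrow> bool" where
  "dual_inv n h lam u \<tau> \<alpha> \<theta> \<longleftrightarrow>
     (\<forall>i<n. (\<Sum>j<n. max 0 (\<alpha> j - u - h i j)) \<le> lam) \<and>
     (\<forall>j. \<alpha> j \<le> real \<tau> * u \<and> (\<not> frozen n h lam \<alpha> j \<longrightarrow> \<alpha> j = real \<tau> * u)) \<and>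
     (\<forall>i<n. opened n h lam \<alpha> i \<longrightarrow>
        \<theta> i \<le> real \<tau> * u \<and> (\<forall>j. h i j \<le> \<alpha> j - u \<longrightarrow> \<alpha> j \<le> \<theta> i)) \<and>
     (\<forall>j. frozen n h lam \<alpha> j \<longrightarrow>
        (\<exists>i<n. opened n h lam \<alpha> i \<and> h i j \<le> \<alpha> j \<and> \<theta> i \<le> \<alpha> j))"

lemma dual_inv_0:
  assumes "0 \<le> lam" "0 \<le> u" "\<And>i j. 0 \<le> h i j"
  shows "dual_inv n h lam u 0 (\<lambda>_. 0) (\<lambda>_. 0)"
proof -
  have "(\<Sum>j<n. max 0 (0 - u - h i j)) = 0" for i
  proof (intro sum.neutral ballI)
    fix j show "max 0 (0 - u - h i j) = 0" using assms(2) assms(3)[of i j] by (simp add: max_def)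
  qed
  then show ?thesis using assms unfolding dual_inv_def frozen_def by auto
qed

text \<open>A client that is not frozen has its dual below its cost to every opened facility, so
  after the raise, measured by \<open>\<alpha> j - u\<close>, it still contributes nothing there:
  contributions to opened facilities stop growing. An unopened facility has received less than
  \<open>lam\<close>, and the new duals lowered by \<open>u\<close> do not exceed the old
  ones.\<close>

lemma dual_inv_step:
  assumes inv: "dual_inv n h lam u \<tau> \<alpha> \<theta>" and u: "0 \<le> u"
  shows "\<exists>\<theta>'. dual_inv n h lam u (Suc \<tau>) (raise n h lam u \<alpha>) \<theta>'"
proof -
  define \<alpha>' where "\<alpha>' = raise n h lam u \<alpha>"
  let ?x' = "\<lambda>i j. max 0 (\<alpha>' j - u - h i j)" and ?t = "real (Suc \<tau>) * u"
  \<comment> \<open>Facilities opened by this raise get the time \<open>?t\<close>, which no dual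
    exceeds; newly frozen clients have dual exactly \<open>?t\<close>. Both timing conditions
    follow.\<close>
  define \<theta>' where "\<theta>' = (\<lambda>i. if opened n h lam \<alpha> i then \<theta> i else ?t)"
  let ?fr = "frozen n h lam \<alpha>" and ?op = "opened n h lam \<alpha>"
  have ge: "\<alpha> j \<le> \<alpha>' j" for j using raise_ge[OF u] by (simp add: \<alpha>'_def)
  have fr: "?fr j \<Longrightarrow> \<alpha>' j = \<alpha> j" and nfr: "\<not> ?fr j \<Longrightarrow> \<alpha>' j = \<alpha> j + u" for j
    by (auto simp: \<alpha>'_def raise_def)
  have I2: "\<alpha> j \<le> real \<tau> * u" "\<not> ?fr j \<Longrightarrow> \<alpha> j = real \<tau> * u" for j
    using inv by (auto simp: dual_inv_def)
  have op': "?op i \<Longrightarrow> opened n h lam \<alpha>' i" for i using opened_mono ge by blast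
  have le': "\<alpha>' j \<le> ?t" for j
    using I2(1)[of j] u fr[of j] nfr[of j] by (cases "?fr j") (auto simp: algebra_simps)
  have fr': "?fr j \<Longrightarrow> frozen n h lam \<alpha>' j" for j
    using frozen_raise[OF u] by (simp add: \<alpha>'_def)
  have late: "\<alpha>' j - u < h i j" if "?op i" "i < n" "\<not> ?fr j" for i j
    using that nfr[of j] unfolding frozen_def by force
  have "(\<Sum>j<n. ?x' i j) \<le> lam" if i: "i < n" for i
  proof (cases "?op i")
    case True
    have "(\<Sum>j<n. ?x' i j) \<le> (\<Sum>j<n. max 0 (\<alpha> j - u - h i j))"
    proof (rule sum_mono)
      fix j show "?x' i j \<le> max 0 (\<alpha> j - u - h i j)"
        using late[OF True i, of j] fr[of j] by (cases "?fr j") auto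
    qed
    then show ?thesis using inv i unfolding dual_inv_def by force
  next
    case False
    have "(\<Sum>j<n. ?x' i j) \<le> (\<Sum>j<n. max 0 (\<alpha> j - h i j))"
    proof (rule sum_mono)
      fix j show "?x' i j \<le> max 0 (\<alpha> j - h i j)"
        using u fr[of j] nfr[of j] by (cases "?fr j") auto
    qed
    then show ?thesis using False by (simp add: opened_def)
  qed
  moreover have "\<alpha>' j = ?t" if "\<not> frozen n h lam \<alpha>' j" for j
    using that fr' I2(2)[of j] nfr[of j] by (auto simp: algebra_simps)
  moreover have "\<theta>' i \<le> ?t" if "i < n" for i
  proof -
    have "?op i \<Longrightarrow> \<theta> i \<le> real \<tau> * u" using inv that by (auto simp: dual_inv_def)
    then show ?thesis using u by (auto simp: \<theta>'_def algebra_simps)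
  qed
  moreover have "\<alpha>' j \<le> \<theta>' i" if "i < n" "h i j \<le> \<alpha>' j - u" for i j
  proof (cases "?op i")
    case True
    then have "?fr j" using late that by force
    then show ?thesis using inv that True fr by (auto simp: \<theta>'_def dual_inv_def)
  qed (use le' in \<open>simp add: \<theta>'_def\<close>)
  moreover have "\<exists>i<n. opened n h lam \<alpha>' i \<and> h i j \<le> \<alpha>' j \<and> \<theta>' i \<le> \<alpha>' j"
    if "frozen n h lam \<alpha>' j" for j
  proof (cases "?fr j")
    case True
    then obtain i where "i < n" "?op i" "h i j \<le> \<alpha> j" "\<theta> i \<le> \<alpha> j"
      using inv unfolding dual_inv_def by blast
    then show ?thesis using op' fr[OF True] by (auto simp: \<theta>'_def)
  next
    case False
    then have "\<alpha>' j = ?t" using I2(2)[of j] nfr[of j] by (auto simp: algebra_simps)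
    then show ?thesis using that calculation(3) unfolding frozen_def by auto
  qed
  ultimately show ?thesis unfolding dual_inv_def \<alpha>'_def[symmetric] using le' by blast
qed

lemma dual_inv_dual:
  assumes "0 \<le> lam" "0 \<le> u" "\<And>i j. 0 \<le> h i j"
  shows "\<exists>\<theta>. dual_inv n h lam u \<tau> (dual n h lam u \<tau>) \<theta>"
proof (induction \<tau>)
  case 0
  then show ?case using dual_inv_0[where n=n and h=h, OF assms] by (auto simp: dual_def)
next
  case (Suc \<tau>)
  then show ?case using dual_inv_step[OF _ assms(2)] by (force simp: dual_def)
qed

text \<open>A client still rising after \<open>\<tau>\<close> rounds has dual
  \<open>\<tau> * u\<close>, at least \<open>lam\<close>, and pays alone for the facility at its own
  location, where its cost is zero. That facility would freeze it.\<close>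

lemma dual_frozen:
  assumes "0 \<le> lam" "0 \<le> u" "\<And>i j. 0 \<le> h i j" "\<And>j. j < n \<Longrightarrow> h j j = 0" "lam \<le> real \<tau> * u" "j < n"
  shows "frozen n h lam (dual n h lam u \<tau>) j"
proof (rule ccontr)
  let ?\<alpha> = "dual n h lam u \<tau>"
  assume nf: "\<not> frozen n h lam ?\<alpha> j"
  obtain \<theta> where "dual_inv n h lam u \<tau> ?\<alpha> \<theta>"
    using dual_inv_dual[where h=h, OF assms(1-3)] by blast
  then have a: "?\<alpha> j = real \<tau> * u" using nf by (auto simp: dual_inv_def)
  have "?\<alpha> j \<le> max 0 (?\<alpha> j - h j j)" using assms(4,6) by simp
  also have "\<dots> \<le> (\<Sum>j'<n. max 0 (?\<alpha> j' - h j j'))"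
    using assms(6) by (intro member_le_sum[where f="\<lambda>j'. max 0 (?\<alpha> j' - h j j')"]) auto
  finally have "opened n h lam ?\<alpha> j" using a assms(5) by (simp add: opened_def)
  then have "frozen n h lam ?\<alpha> j"
    using assms a unfolding frozen_def by (metis mult_nonneg_nonneg of_nat_0_le_iff)
  then show False using nf by simp
qed

lemma selection_nonempty:
  assumes "0 \<le> lam" "0 \<le> u" "\<And>i j. 0 \<le> h i j" "\<And>j. j < n \<Longrightarrow> h j j = 0" "lam \<le> real \<tau> * u" "0 < n"
    and "selection n h lam u (dual n h lam u \<tau>) S"
  shows "S \<noteq> {}"
  using dual_frozen[where h=h and lam=lam and u=u and \<tau>=\<tau>, OF assms(1-6)] assms(7) unfolding frozen_def selection_def by blast

text \<open>
  The Jain--Vazirani analysis.  That the opening cost enters with the same factor 3 on both sides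
  makes the bound useful for too few as well as for too many centers.
\<close>

lemma lagrangian_bound:
  assumes lam: "0 \<le> lam" "0 \<le> u" and h: "\<And>i j. 0 \<le> h i j" "\<And>j. j < n \<Longrightarrow> h j j = 0"
    and T: "lam \<le> real \<tau> * u"
    and S: "selection n h lam u (dual n h lam u \<tau>) S"
    and D: "\<And>i j. i \<in> S \<Longrightarrow> j < n \<Longrightarrow> D j \<le> h i j"
      "\<And>i i' j j'. i \<in> S \<Longrightarrow> i' < n \<Longrightarrow> j < n \<Longrightarrow> j' < n \<Longrightarrow> D j \<le> h i j' + h i' j' + h i' j"
    and F: "F \<subseteq> {..<n}" "\<And>j. j < n \<Longrightarrow> \<sigma> j \<in> F"
  shows "(\<Sum>j<n. D j) + 3 * lam * card S \<le> 3 * ((\<Sum>j<n. h (\<sigma> j) j) + lam * card F) + 6 * (real n)\<^sup>2 * u"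
proof -
  define \<alpha> where "\<alpha> = dual n h lam u \<tau>"
  let ?x = "\<lambda>i j. max 0 (\<alpha> j - u - h i j)"
  obtain \<theta> where inv: "dual_inv n h lam u \<tau> \<alpha> \<theta>"
    using dual_inv_dual[where h=h, OF lam h(1)] \<alpha>_def by blast
  have feas: "(\<Sum>j<n. ?x i j) \<le> lam" if "i < n" for i
    using inv that by (auto simp: dual_inv_def)
  have finF: "finite F" using F finite_subset by blast
  have Sn: "S \<subseteq> {..<n}" using S by (auto simp: selection_def)
  then have finS: "finite S" using finite_subset by blast
  \<comment> \<open>Weak duality: the lowered dual of a client is covered by its connection cost and
    its contribution to \<sigma> j, and no facility receives more than \<open>lam\<close>.\<close>
  have "(\<Sum>j<n. \<alpha> j - u) \<le> (\<Sum>j<n. h (\<sigma> j) j + (\<Sum>i\<in>F. ?x i j))"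
  proof (rule sum_mono)
    fix j assume "j \<in> {..<n}"
    then have "?x (\<sigma> j) j \<le> (\<Sum>i\<in>F. ?x i j)"
      using F finF by (intro member_le_sum[where f="\<lambda>i. ?x i j"]) auto
    then show "\<alpha> j - u \<le> h (\<sigma> j) j + (\<Sum>i\<in>F. ?x i j)" by linarith
  qed
  also have "\<dots> = (\<Sum>j<n. h (\<sigma> j) j) + (\<Sum>i\<in>F. \<Sum>j<n. ?x i j)"
    by (simp add: sum.distrib sum.swap[of _ "{..<n}" F])
  also have "(\<Sum>i\<in>F. \<Sum>j<n. ?x i j) \<le> (\<Sum>i\<in>F. lam)"
    using feas F by (intro sum_mono) auto
  finally have weak: "(\<Sum>j<n. \<alpha> j) \<le> (\<Sum>j<n. h (\<sigma> j) j) + lam * card F + real n * u"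
    by (simp add: sum_subtractf algebra_simps)
  have full: "lam - real n * u \<le> (\<Sum>j<n. ?x i j)" if "i \<in> S" for i
  proof -
    have "lam \<le> (\<Sum>j<n. max 0 (\<alpha> j - h i j))"
      using S that by (auto simp: selection_def opened_def \<alpha>_def)
    also have "\<dots> \<le> (\<Sum>j<n. ?x i j + u)"
      using lam by (intro sum_mono) auto
    finally show ?thesis by (simp add: sum.distrib algebra_simps)
  qed
  \<comment> \<open>By independence a client contributes to at most one selected facility. If it
    does, its dual pays for the direct connection and for three times the contribution; otherwise
    the whole of it is left for a route of three hops.\<close>
  have client: "D j + 3 * (\<Sum>i\<in>S. ?x i j) \<le> 3 * \<alpha> j" if j: "j < n" for j
  proof (cases "\<exists>i\<in>S. h i j < \<alpha> j - u")
    case True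
    then obtain i where i: "i \<in> S" "h i j < \<alpha> j - u" by blast
    have "(\<Sum>i'\<in>S. ?x i' j) = (\<Sum>i'\<in>{i}. ?x i' j)"
    proof (rule sum.mono_neutral_right)
      have "?x i' j = 0" if "i' \<in> S" "i' \<noteq> i" for i'
      proof -
        have "\<not> h i' j < \<alpha> j - u"
          using S i that j unfolding selection_def conflict_def \<alpha>_def[symmetric] by blast
        then show ?thesis by linarith
      qed
      then show "\<forall>i'\<in>S - {i}. ?x i' j = 0" by blast
    qed (use i finS in auto)
    then show ?thesis using i D(1)[OF i(1) j] h(1)[of i j] lam by simp
  next
    case False
    then have "(\<Sum>i\<in>S. ?x i j) = 0" by (intro sum.neutral) force
    moreover have "D j \<le> 3 * \<alpha> j"
    proof -
      have "frozen n h lam \<alpha> j"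
        using dual_frozen[where h=h, OF lam h T j] by (simp add: \<alpha>_def)
      then obtain i where i: "i < n" "opened n h lam \<alpha> i" "h i j \<le> \<alpha> j" "\<theta> i \<le> \<alpha> j"
        using inv unfolding dual_inv_def by blast
      show ?thesis
      proof (cases "i \<in> S")
        case True
        then show ?thesis using D(1)[OF True j] i h(1)[of i j] by linarith
      next
        case False
        then obtain i' j' where c: "i' \<in> S" "j' < n" "h i j' < \<alpha> j' - u" "h i' j' < \<alpha> j' - u"
          using S i unfolding selection_def conflict_def \<alpha>_def[symmetric] by blast
        \<comment> \<open>The client j' that causes the conflict stopped rising by the time
          \<open>i\<close> opened, and j froze no earlier than that, so every hop costs at most
          \<open>\<alpha> j\<close>.\<close>
        then have "\<alpha> j' \<le> \<theta> i" using inv i unfolding dual_inv_def by (meson less_imp_le)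
        then show ?thesis using D(2)[OF c(1) i(1) j c(2)] c i lam by linarith
      qed
    qed
    ultimately show ?thesis by simp
  qed
  have "(\<Sum>j<n. D j) + 3 * (\<Sum>i\<in>S. \<Sum>j<n. ?x i j)
      = (\<Sum>j<n. D j + 3 * (\<Sum>i\<in>S. ?x i j))"
    by (simp add: sum.distrib sum_distrib_left sum.swap[of _ "{..<n}" S])
  also have "\<dots> \<le> (\<Sum>j<n. 3 * \<alpha> j)" using client by (intro sum_mono) auto
  finally have 1: "(\<Sum>j<n. D j) + 3 * (\<Sum>i\<in>S. \<Sum>j<n. ?x i j) \<le> 3 * (\<Sum>j<n. \<alpha> j)"
    by (simp add: sum_distrib_left)
  have "(\<Sum>i\<in>S. lam - real n * u) \<le> (\<Sum>i\<in>S. \<Sum>j<n. ?x i j)"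
    using full by (intro sum_mono) auto
  then have 2: "lam * card S - card S * (real n * u) \<le> (\<Sum>i\<in>S. \<Sum>j<n. ?x i j)"
    by (simp add: algebra_simps)
  \<comment> \<open>The error: 3 n u from lowering the duals, and 3 n u for each of at most n
    selected facilities, which may be underpaid by n u. Each part is at most 3 n^2 u.\<close>
  have "card S \<le> n" using Sn by (metis card_lessThan card_mono finite_lessThan)
  then have 3: "card S * (real n * u) \<le> n * (real n * u)" using lam by (intro mult_right_mono) auto
  have 4: "real n * u \<le> n * (real n * u)"
    using lam mult_right_mono[of 1 "real n" "real n * u"] by (cases "n = 0") auto
  have 5: "(real n)\<^sup>2 * u = n * (real n * u)" by (simp add: power2_eq_square)
  show ?thesis using 1 2 3 4 weak unfolding mult.assoc 5 by (simp add: algebra_simps)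
qed

text \<open>At multiplier 0 feasibility forbids positive contributions, so there are no conflicts,
  while every facility is opened. This is the end of the search where more than k centers are
  selected.\<close>

lemma selection_zero:
  assumes "0 \<le> u" "\<And>i j. 0 \<le> h i j" "\<And>j. j < n \<Longrightarrow> h j j = 0"
    and "selection n h 0 u (dual n h 0 u \<tau>) S"
  shows "S = {..<n}"
proof -
  let ?\<alpha> = "dual n h 0 u \<tau>"
  obtain \<theta> where inv: "dual_inv n h 0 u \<tau> ?\<alpha> \<theta>"
    using dual_inv_dual[where h=h, OF order_refl assms(1,2)] by blast
  have z: "max 0 (?\<alpha> j - u - h i j) = 0" if "i < n" "j < n" for i j
  proof -
    have "(\<Sum>j<n. max 0 (?\<alpha> j - u - h i j)) \<le> 0" using inv that unfolding dual_inv_def by blast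
    moreover have "max 0 (?\<alpha> j - u - h i j) \<le> (\<Sum>j<n. max 0 (?\<alpha> j - u - h i j))"
      using that by (intro member_le_sum[where f="\<lambda>j. max 0 (?\<alpha> j - u - h i j)"]) auto
    ultimately show ?thesis by simp
  qed
  have "\<not> conflict n h u ?\<alpha> i i'" if "i < n" for i i'
    using z that unfolding conflict_def by (force simp: max_def split: if_splits)
  moreover have "opened n h 0 ?\<alpha> i" for i by (auto simp: opened_def intro!: sum_nonneg)
  ultimately show ?thesis using assms(4) unfolding selection_def by auto
qed

section \<open>Rounding two solutions to \<open>k\<close> centers\<close>

definition nearest :: "nat \<Rightarrow> mat \<Rightarrow> nat set \<Rightarrow> (nat \<Rightarrow> nat) \<Rightarrow> bool" where
  "nearest n c W g \<longleftrightarrow> (\<forall>j<n. g j \<in> W \<and> (\<forall>i\<in>W. c (g j) j \<le> c i j))"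

definition rank :: "nat set \<Rightarrow> nat \<Rightarrow> nat" where
  "rank X y = card {z \<in> X. z < y}"

text \<open>Reduction modulo \<open>N\<close> for arguments below 2 N, which is as far as a rank
  plus an offset below \<open>N\<close> can reach.\<close>

definition shift :: "nat \<Rightarrow> nat \<Rightarrow> nat" where
  "shift N v = (if v < N then v else v - N)"

text \<open>
  Averaging over the cyclic offset \<open>r\<close> replaces the random choice of the unmatched centers that are
  deleted.
\<close>

definition window :: "nat \<Rightarrow> nat set \<Rightarrow> nat set \<Rightarrow> (nat \<Rightarrow> nat) \<Rightarrow> nat \<Rightarrow> nat set" where
  "window k F1 F2 \<pi> r =
     (let X = F2 - \<pi> ` F1 in F2 - {y \<in> X. shift (card X) (rank X y + r) < card F2 - k})"

lemma rank_bij: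
  assumes "finite X"
  shows "bij_betw (rank X) X {..<card X}"
proof -
  have less: "rank X y < rank X y'" if "y \<in> X" "y < y'" for y y'
    unfolding rank_def using that assms by (intro psubset_card_mono) auto
  have "inj_on (rank X) X"
    using less by (metis (no_types, lifting) inj_onI less_irrefl linorder_neqE_nat)
  moreover have "rank X y < card X" if "y \<in> X" for y
    unfolding rank_def using that assms by (intro psubset_card_mono) auto
  then have "rank X ` X \<subseteq> {..<card X}" by auto
  ultimately show ?thesis
    unfolding bij_betw_def by (metis card_image card_lessThan card_subset_eq finite_lessThan)
qed

lemma shift_bij:
  assumes "x < N"
  shows "bij_betw (\<lambda>r. shift N (r + x)) {..<N} {..<N}"
proof -
  have "inj_on (\<lambda>r. shift N (r + x)) {..<N}"
    using assms by (auto simp: inj_on_def shift_def split: if_splits)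
  moreover have "(\<lambda>r. shift N (r + x)) ` {..<N} \<subseteq> {..<N}"
    using assms by (auto simp: shift_def)
  ultimately show ?thesis
    unfolding bij_betw_def by (metis card_image card_lessThan card_subset_eq finite_lessThan)
qed

lemma card_bij_less:
  assumes "bij_betw f A {..<N}" "q \<le> (N::nat)"
  shows "card {a \<in> A. f a < q} = q"
proof -
  have "f ` {a \<in> A. f a < q} = {..<q}"
  proof
    show "{..<q} \<subseteq> f ` {a \<in> A. f a < q}"
    proof
      fix x assume "x \<in> {..<q}"
      then have "x \<in> f ` A" using assms by (auto simp: bij_betw_def)
      then show "x \<in> f ` {a \<in> A. f a < q}" using \<open>x \<in> {..<q}\<close> by auto
    qed
  qed auto
  moreover have "inj_on f {a \<in> A. f a < q}"
    using assms by (auto simp: bij_betw_def intro: inj_on_subset)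
  ultimately show ?thesis by (metis card_image card_lessThan)
qed

text \<open>With a = |F2| - k, b = k - |F1| and D = a + b, hypothesis \<open>B\<close> says that the
  combination with weights a / D and b / D costs at most B. If the small solution costs more than 2
  B, its weight is below 1/2, so C2 \<le> 2 (b / D) C2. Averaged over the offsets, a client loses
  its center with frequency at most q / N \<le> a / D and then pays twice its cost in the small
  solution on top. The average is at most 2 (a C1 + b C2) / D \<le> 2 B.\<close>

lemma bipoint_rounding:
  fixes C1 C2 B :: real
  assumes inst: "okm_instance n k c w" and \<rho>: "\<And>l. l < n \<Longrightarrow> 0 \<le> \<rho> l"
    and F: "F1 \<subseteq> {..<n}" "F2 \<subseteq> {..<n}" "F1 \<noteq> {}" "card F1 \<le> k" "k < card F2"
    and g: "\<And>j. j < n \<Longrightarrow> g1 j \<in> F1" "\<And>j. j < n \<Longrightarrow> g2 j \<in> F2" and \<pi>: "nearest n c F2 \<pi>"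
    and C1: "C1 = (\<Sum>j<n. thr_cost n w \<rho> 3 (c (g1 j) j))"
    and C2: "C2 = (\<Sum>j<n. thr_cost n w \<rho> 3 (c (g2 j) j))"
    and B: "(real (card F2) - k) * C1 + (real k - card F1) * C2 \<le> (real (card F2) - card F1) * B"
  shows "C1 \<le> 2 * B \<or> (\<exists>r<n. window k F1 F2 \<pi> r \<noteq> {} \<and> card (window k F1 F2 \<pi> r) \<le> k \<and>
    (\<forall>g. nearest n c (window k F1 F2 \<pi> r) g \<longrightarrow> (\<Sum>j<n. thr_cost n w \<rho> 9 (c (g j) j)) \<le> 2 * B))"
proof (rule disjCI)
  let ?H = "thr_cost n w \<rho>"
  interpret Metric_space "{..<n}" c using inst by (simp add: okm_instance_def)
  define X where "X = F2 - \<pi> ` F1"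
  define N where "N = card X"
  define q where "q = card F2 - k"
  define del where "del = (\<lambda>r. {y \<in> X. shift N (rank X y + r) < q})"
  have W: "window k F1 F2 \<pi> r = F2 - del r" for r
    by (simp add: window_def X_def N_def q_def del_def Let_def)
  have fin: "finite F1" "finite F2" using F finite_subset by blast+
  then have finX: "finite X" by (simp add: X_def)
  have \<pi>F: "\<pi> ` F1 \<subseteq> F2" using \<pi> F by (auto simp: nearest_def)
  have "N = card F2 - card (\<pi> ` F1)"
    unfolding N_def X_def using fin \<pi>F by (intro card_Diff_subset) auto
  moreover have "card (\<pi> ` F1) \<le> card F1" using fin card_image_le by blast
  \<comment> \<open>At most |F1| centers are matched. Hence the unmatched ones suffice for the q =
    |F2| - k deletions, as |F1| \<le> k, and N is at least the weight denominator |F2| -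
    |F1|.\<close>
  ultimately have N1: "card F2 \<le> N + card F1" and N2: "q \<le> N" "0 < N" "0 < q"
    using F(4,5) by (auto simp: q_def)
  have "N \<le> n" unfolding N_def X_def using F(2)
    by (metis Diff_subset card_lessThan card_mono finite_lessThan order_trans)
  have rk: "rank X y < N" if "y \<in> X" for y
    using rank_bij[OF finX] that by (auto simp: bij_betw_def N_def)
  have cardW: "card (window k F1 F2 \<pi> r) = k" if "r < N" for r
  proof -
    have "bij_betw ((\<lambda>x. shift N (x + r)) \<circ> rank X) X {..<N}"
      using rank_bij[OF finX] shift_bij[OF that] by (auto intro: bij_betw_trans simp: N_def)
    then have "card (del r) = q" using card_bij_less[OF _ N2(1)] by (force simp: del_def)
    moreover have "del r \<subseteq> F2" by (auto simp: del_def X_def)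
    ultimately show ?thesis unfolding W using fin F(5)
      by (simp add: card_Diff_subset finite_subset q_def)
  qed
  have Wne: "\<pi> ` F1 \<subseteq> window k F1 F2 \<pi> r" for r
    using \<pi>F by (auto simp: W del_def X_def)
  have count: "(\<Sum>r<N. of_bool (y \<in> del r)) \<le> real q" for y
  proof (cases "y \<in> X")
    case True
    have "(\<Sum>r<N. of_bool (y \<in> del r)) = real (card {r \<in> {..<N}. shift N (r + rank X y) < q})"
      using True by (simp add: del_def add.commute Collect_conj_eq lessThan_def)
    also have "\<dots> = q" using card_bij_less[OF shift_bij[OF rk[OF True]] N2(1)] by simp
    finally show ?thesis by simp
  qed (simp add: del_def)
  let ?t1 = "\<lambda>j. ?H 3 (c (g1 j) j)" and ?t2 = "\<lambda>j. ?H 3 (c (g2 j) j)"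
  have t0: "0 \<le> ?H t d" for t d using thr_cost_nonneg[OF inst] .
  have client: "?H 9 (c (g j) j) \<le> ?t2 j + 2 * of_bool (g2 j \<in> del r) * ?t1 j"
    if near: "nearest n c (window k F1 F2 \<pi> r) g" and j: "j < n" for r g j
  proof (cases "g2 j \<in> del r")
    case False
    then have "g2 j \<in> window k F1 F2 \<pi> r" using g(2)[OF j] by (simp add: W)
    then have "c (g j) j \<le> c (g2 j) j" using near j by (auto simp: nearest_def)
    then have "?H 9 (c (g j) j) \<le> ?H 9 (c (g2 j) j)"
      using thr_cost_mono[OF inst] by blast
    also have "\<dots> \<le> ?t2 j" using thr_cost_antimono[OF inst \<rho>] by simp
    finally show ?thesis using False by simp
  next
    case True
    \<comment> \<open>The partner \<pi> ?x is never deleted and is no farther from ?x than ?y is.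
      Going over ?x costs c ?y j plus twice c ?x j: three solution edges with 3 multiples of the
      thresholds each, hence 9.\<close>
    let ?x = "g1 j" and ?y = "g2 j"
    have m: "?x < n" "?y < n" "\<pi> ?x < n" "\<pi> ?x \<in> window k F1 F2 \<pi> r"
      using g[OF j] F(1,2) \<pi>F Wne by blast+
    have "c (g j) j \<le> c (\<pi> ?x) j" using near j m by (auto simp: nearest_def)
    also have "\<dots> \<le> c (\<pi> ?x) ?x + c ?x j" using m j triangle by auto
    also have "c (\<pi> ?x) ?x \<le> c ?y ?x" using \<pi> m g[OF j] by (auto simp: nearest_def)
    also have "c ?y ?x \<le> c ?y j + c j ?x" using m j triangle by auto
    finally have "c (g j) j \<le> c ?y j + (c ?x j + c ?x j)" by (simp add: commute)
    then have "?H 9 (c (g j) j) \<le> ?H (3 + (3 + 3)) (c ?y j + (c ?x j + c ?x j))"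
      using thr_cost_mono[OF inst] by simp
    also have "\<dots> \<le> ?t2 j + ?H (3 + 3) (c ?x j + c ?x j)"
      by (rule thr_cost_add[OF inst])
    also have "\<dots> \<le> ?t2 j + (?t1 j + ?t1 j)" by (intro add_left_mono thr_cost_add[OF inst])
    finally show ?thesis using True by simp
  qed
  assume nex: "\<not> (\<exists>r<n. window k F1 F2 \<pi> r \<noteq> {} \<and> card (window k F1 F2 \<pi> r) \<le> k \<and>
    (\<forall>g. nearest n c (window k F1 F2 \<pi> r) g \<longrightarrow> (\<Sum>j<n. ?H 9 (c (g j) j)) \<le> 2 * B))"
  have big: "2 * B < (\<Sum>j<n. ?t2 j + 2 * of_bool (g2 j \<in> del r) * ?t1 j)" if r: "r < N" for r
  proof -
    have "window k F1 F2 \<pi> r \<noteq> {}" using Wne F(3) by blast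
    moreover have "r < n" using r \<open>N \<le> n\<close> by simp
    ultimately have "\<not> (\<forall>g. nearest n c (window k F1 F2 \<pi> r) g \<longrightarrow>
        (\<Sum>j<n. ?H 9 (c (g j) j)) \<le> 2 * B)"
      using nex eq_refl[OF cardW[OF r]] by blast
    then obtain g where gg: "nearest n c (window k F1 F2 \<pi> r) g"
      "2 * B < (\<Sum>j<n. ?H 9 (c (g j) j))"
      unfolding not_all not_imp not_le by blast
    then have "(\<Sum>j<n. ?H 9 (c (g j) j)) \<le> (\<Sum>j<n. ?t2 j + 2 * of_bool (g2 j \<in> del r) * ?t1 j)"
      using client by (intro sum_mono) auto
    then show ?thesis using gg by linarith
  qed
  have "real N * (2 * B) = (\<Sum>r<N. 2 * B)" by simp
  also have "\<dots> < (\<Sum>r<N. \<Sum>j<n. ?t2 j + 2 * of_bool (g2 j \<in> del r) * ?t1 j)"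
    using big N2(2) by (intro sum_strict_mono) auto
  also have "\<dots> = (\<Sum>j<n. \<Sum>r<N. ?t2 j + 2 * of_bool (g2 j \<in> del r) * ?t1 j)" by (rule sum.swap)
  also have "\<dots> = (\<Sum>j<n. real N * ?t2 j + 2 * (\<Sum>r<N. of_bool (g2 j \<in> del r)) * ?t1 j)"
    by (rule sum.cong[OF refl]) (simp only: sum.distrib sum_distrib_left sum_distrib_right, simp)
  also have "\<dots> \<le> (\<Sum>j<n. real N * ?t2 j + 2 * real q * ?t1 j)"
    using count t0 by (intro sum_mono add_mono mult_right_mono mult_left_mono) auto
  also have "\<dots> = real N * C2 + 2 * real q * C1"
    by (simp add: C1 C2 sum.distrib sum_distrib_left)
  finally have avg: "real N * (2 * B - C2) < 2 * real q * C1" by (simp add: algebra_simps)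
  have C0: "0 \<le> C1" "0 \<le> C2" using t0 by (auto simp: C1 C2 intro: sum_nonneg)
  define D where "D = real (card F2) - card F1"
  define a where "a = real (card F2) - k"
  define b where "b = real k - card F1"
  have ab: "D = a + b" "0 < a" "0 \<le> b" "real q = a" "D \<le> real N"
    using F(4,5) N1 by (auto simp: D_def a_def b_def q_def of_nat_diff)
  have B': "a * C1 + b * C2 \<le> D * B" using B by (simp add: D_def a_def b_def)
  show "C1 \<le> 2 * B"
  proof (rule ccontr)
    assume n: "\<not> C1 \<le> 2 * B"
    have "0 \<le> a * C1" "0 \<le> b * C2" using ab C0 by auto
    then have aD: "a * C1 \<le> D * B" "0 \<le> D * B" using B' by linarith+
    then have "0 \<le> B" using ab by (simp add: zero_le_mult_iff)
    \<comment> \<open>Otherwise \<open>aD\<close> alone would give C1 \<le> 2 B.\<close>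
    have "2 * a < D"
    proof (rule ccontr)
      assume "\<not> 2 * a < D"
      then have "D * B \<le> 2 * a * B" using \<open>0 \<le> B\<close> by (intro mult_right_mono) auto
      then have "a * C1 \<le> a * (2 * B)" using aD by simp
      then show False using n ab by simp
    qed
    then have "D * C2 \<le> (2 * b) * C2" using ab C0 by (intro mult_right_mono) auto
    then have D: "2 * a * C1 \<le> D * (2 * B - C2)" using B' by (simp add: algebra_simps)
    then have "0 \<le> D * (2 * B - C2)" using \<open>0 \<le> a * C1\<close> by linarith
    then have "0 \<le> 2 * B - C2" using ab by (simp add: zero_le_mult_iff)
    then have "D * (2 * B - C2) \<le> real N * (2 * B - C2)" using ab by (intro mult_right_mono) auto
    then show False using D avg ab by simp
  qed
qed

section \<open>A good set of centers for a good guess\<close>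

text \<open>All nearest assignments are covered, so the way in which the program breaks ties does
  not matter.\<close>

definition good_set :: "nat \<Rightarrow> nat \<Rightarrow> mat \<Rightarrow> vec \<Rightarrow> vec \<Rightarrow> real \<Rightarrow> nat set \<Rightarrow> bool" where
  "good_set n k c w \<rho> B W \<longleftrightarrow> W \<noteq> {} \<and> card W \<le> k \<and>
     (\<forall>g. nearest n c W g \<longrightarrow> proxy_cost n w (\<lambda>l. 9 * \<rho> l) (\<lambda>j. c (g j) j) \<le> B)"

abbreviation edge_cost :: "nat \<Rightarrow> mat \<Rightarrow> vec \<Rightarrow> vec \<Rightarrow> nat \<Rightarrow> nat \<Rightarrow> real" where
  "edge_cost n c w \<rho> \<equiv> \<lambda>i j. thr_cost n w \<rho> 1 (c i j)"

text \<open>The error budget. Since the largest entry carries weight \<open>w 0\<close>, V is at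
  most the ordered cost. For n \<ge> 2 the threshold cutoff costs 9 V / n^5 \<le> 9/32 V and the
  step 18 V / n^6 \<le> 18/64 V; together with 135/8 this is 17.4375.\<close>

lemma proxy_from_thr:
  assumes inst: "okm_instance n k c w" and v: "\<And>j. j < n \<Longrightarrow> 0 \<le> v j" and n: "2 \<le> n"
    and good: "\<And>l. l < n \<Longrightarrow> good_guess (M / real n ^ 6) (\<lambda>y. sorted_desc n v ! y) \<rho> l"
    and M: "M = sorted_desc n v ! 0" and u: "u = w 0 * M / real n ^ 8"
    and thr: "(\<Sum>j<n. thr_cost n w \<rho> 9 (v' j)) \<le>
      6 * (\<Sum>j<n. thr_cost n w \<rho> 1 (v j)) + 18 * (real n)\<^sup>2 * u"
  shows "proxy_cost n w (\<lambda>l. 9 * \<rho> l) v' \<le> 18 * ordered_cost n w v"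
proof -
  let ?s = "\<lambda>y. sorted_desc n v ! y"
  define V where "V = w 0 * M"
  have M0: "0 \<le> M" using sorted_desc_nonneg[of n v 0] v n M by simp
  have w0: "0 \<le> w 0" using inst n by (auto simp: okm_instance_def)
  have V0: "0 \<le> V" using M0 w0 by (simp add: V_def)
  have "w 0 * ?s 0 \<le> (\<Sum>j<n. w j * ?s j)"
    using n inst sorted_desc_nonneg[of n v] v
    by (intro member_le_sum[where f="\<lambda>j. w j * ?s j"]) (auto simp: okm_instance_def)
  then have V1: "V \<le> ordered_cost n w v" by (simp add: V_def M ordered_cost_def)
  have "proxy_cost n w (\<lambda>l. 9 * \<rho> l) v' \<le> (\<Sum>l<n. gap n w l * (9 * (real (Suc l) * \<rho> l)))
      + 6 * (\<Sum>j<n. thr_cost n w \<rho> 1 (v j)) + 18 * (real n)\<^sup>2 * u"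
    using thr unfolding proxy_cost_alt by simp
  also have "(\<Sum>j<n. thr_cost n w \<rho> 1 (v j)) = (\<Sum>l<n. gap n w l * (\<Sum>j<n. max 0 (v j - \<rho> l)))"
    unfolding thr_cost_def by (subst sum.swap) (simp add: sum_distrib_left)
  also have "(\<Sum>l<n. gap n w l * (9 * (real (Suc l) * \<rho> l)))
      + 6 * (\<Sum>l<n. gap n w l * (\<Sum>j<n. max 0 (v j - \<rho> l)))
      = (\<Sum>l<n. gap n w l * (9 * (real (Suc l) * \<rho> l) + 6 * (\<Sum>j<n. max 0 (v j - \<rho> l))))"
    by (simp add: sum.distrib sum_distrib_left algebra_simps)
  also have "\<dots> \<le> (\<Sum>l<n. gap n w l * (135/8 * (\<Sum>y\<le>l. ?s y) + 9 * real n * (M / real n ^ 6)))"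
    using good_guess_top[OF v _ _ good] M0
    by (intro sum_mono mult_left_mono gap_nonneg[OF inst]) auto
  also have "\<dots> = 135/8 * ordered_cost n w v + (\<Sum>l<n. gap n w l) * (9 * real n * (M / real n ^ 6))"
    unfolding ordered_cost_def abel_sum[where w=w]
    by (simp add: distrib_left sum.distrib sum_distrib_left sum_distrib_right sum_divide_distrib algebra_simps)
  also have "(\<Sum>l<n. gap n w l) = w 0" using sum_gap n by simp
  finally have 1: "proxy_cost n w (\<lambda>l. 9 * \<rho> l) v' \<le>
    135/8 * ordered_cost n w v + w 0 * (9 * real n * (M / real n ^ 6)) + 18 * (real n)\<^sup>2 * u" by simp
  have "w 0 * (9 * real n * (M / real n ^ 6)) = V * (9 / real n ^ 5)"
    using n by (simp add: V_def field_simps eval_nat_numeral)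
  also have "\<dots> \<le> V * (9 / 2 ^ 5)"
    using n V0 by (intro mult_left_mono divide_left_mono power_mono) auto
  finally have 2: "w 0 * (9 * real n * (M / real n ^ 6)) \<le> V * (9 / 32)" by simp
  have "18 * (real n)\<^sup>2 * u = V * (18 / real n ^ 6)"
    using n by (simp add: V_def u field_simps eval_nat_numeral)
  also have "\<dots> \<le> V * (18 / 2 ^ 6)"
    using n V0 by (intro mult_left_mono divide_left_mono power_mono) auto
  finally have 3: "18 * (real n)\<^sup>2 * u \<le> V * (18 / 64)" by simp
  show ?thesis using 1 2 3 V1 V0 by linarith
qed

lemma thr_cost_le:
  assumes inst: "okm_instance n k c w" and \<rho>: "\<And>l. l < n \<Longrightarrow> 0 \<le> \<rho> l" and d: "0 \<le> d" "0 \<le> t"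
  shows "thr_cost n w \<rho> t d \<le> w 0 * d"
proof -
  have "thr_cost n w \<rho> t d \<le> (\<Sum>l<n. gap n w l * d)"
    unfolding thr_cost_def using \<rho> d
    by (intro sum_mono mult_left_mono gap_nonneg[OF inst]) auto
  also have "\<dots> = w 0 * d"
    using sum_gap[of n w] inst by (simp add: sum_distrib_right[symmetric] okm_instance_def)
  finally show ?thesis .
qed

lemma exists_nearest:
  assumes "W \<noteq> {}" "finite W"
  shows "\<exists>g. nearest n c W g"
proof -
  have "\<exists>i\<in>W. \<forall>i'\<in>W. c i j \<le> c i' j" for j
    using arg_min_if_finite[OF assms(2,1), of "\<lambda>i. c i j"] by (meson not_le)
  then show ?thesis unfolding nearest_def by metis
qed

text \<open>Monotonicity of the number of centers in the multiplier is not claimed. The least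
  multiplier with at most k centers is taken, so that its predecessor, one step \<open>u\<close>
  below, has more than k; these two solutions are rounded.\<close>

lemma exists_good_set:
  assumes inst: "okm_instance n k c w" and feas: "okm_feasible n k F \<sigma>"
    and \<rho>: "\<And>l. l < n \<Longrightarrow> 0 \<le> \<rho> l" and w0: "0 < w 0" and n: "2 \<le> n"
    and M: "M = sorted_desc n (\<lambda>j. c (\<sigma> j) j) ! 0" "0 < M" and u: "u = w 0 * M / real n ^ 8"
    and good: "\<And>l. l < n \<Longrightarrow>
      good_guess (M / real n ^ 6) (\<lambda>y. sorted_desc n (\<lambda>j. c (\<sigma> j) j) ! y) \<rho> l"
    and S: "\<And>s. s < n ^ 11 \<Longrightarrow> selection n (edge_cost n c w \<rho>) (real s * u) u
      (dual n (edge_cost n c w \<rho>) (real s * u) u (n ^ 11)) (S s)"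
  shows "\<exists>s. 0 < s \<and> s < n ^ 11 \<and> S (s - 1) \<noteq> {} \<and> (good_set n k c w \<rho> (18 * okm_cost n c w \<sigma>) (S s) \<or>
    (\<forall>\<pi>. nearest n c (S (s - 1)) \<pi> \<longrightarrow>
      (\<exists>r<n. good_set n k c w \<rho> (18 * okm_cost n c w \<sigma>) (window k (S s) (S (s - 1)) \<pi> r))))"
proof -
  let ?H = "thr_cost n w \<rho>" and ?cost = "18 * okm_cost n c w \<sigma>"
  interpret Metric_space "{..<n}" c using inst by (simp add: okm_instance_def)
  let ?h = "edge_cost n c w \<rho>"
  let ?o = "\<lambda>j. c (\<sigma> j) j"
  define OPT where "OPT = (\<Sum>j<n. ?h (\<sigma> j) j)"
  define V where "V = w 0 * M"
  have F: "F \<subseteq> {..<n}" "card F = k" "\<And>j. j < n \<Longrightarrow> \<sigma> j \<in> F"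
    using feas by (auto simp: okm_feasible_def)
  have u0: "0 < u" using u w0 M n by simp
  have V0: "0 < V" using w0 M by (simp add: V_def)
  have h0: "0 \<le> ?h i j" for i j using thr_cost_nonneg[OF inst] by simp
  have hd: "?h j j = 0" if "j < n" for j
    using thr_cost_le[OF inst \<rho>, where d=0 and t=1] thr_cost_nonneg[OF inst, of \<rho> 1 0] that zero by fastforce
  have subset: "S s \<subseteq> {..<n}" if "s < n ^ 11" for s using S[OF that] by (auto simp: selection_def)
  have T: "real s * u \<le> real (n ^ 11) * u" if "s < n ^ 11" for s
    using that u0 by (intro mult_right_mono) auto
  have ne: "S s \<noteq> {}" if "s < n ^ 11" for s
    by (rule selection_nonempty[OF _ _ h0 hd T[OF that] _ S[OF that]]) (use u0 n in auto)
  have lag: "(\<Sum>j<n. ?H 3 (c (g j) j)) + 3 * (real s * u) * card (S s)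
      \<le> 3 * (OPT + real s * u * k) + 6 * (real n)\<^sup>2 * u"
    if s: "s < n ^ 11" and g: "nearest n c (S s) g" for s g
    unfolding OPT_def F(2)[symmetric]
  proof (rule lagrangian_bound[OF _ _ h0 hd T[OF s] S[OF s] _ _ F(1,3)])
    fix i j assume ij: "i \<in> S s" "j < n"
    have "c (g j) j \<le> c i j" using g ij by (auto simp: nearest_def)
    then have le: "?H 3 (c (g j) j) \<le> ?H 3 (c i j)"
      by (rule thr_cost_mono[OF inst])
    also have "\<dots> \<le> ?h i j" using thr_cost_antimono[OF inst \<rho>] by simp
    finally show "?H 3 (c (g j) j) \<le> ?h i j" .
    fix i' j' assume ij': "i' < n" "j' < n"
    have i: "i < n" using ij subset[OF s] by auto
    have "c i j \<le> c i j' + c j' j" using i ij ij' triangle by auto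
    also have "c j' j \<le> c j' i' + c i' j" using ij ij' triangle by auto
    finally have "c i j \<le> c i j' + (c i' j' + c i' j)" using commute[of j' i'] by simp
    then have "?H 3 (c i j) \<le> ?H (1 + (1 + 1)) (c i j' + (c i' j' + c i' j))"
      using thr_cost_mono[OF inst] by simp
    also have "\<dots> \<le> ?h i j' + ?H (1 + 1) (c i' j' + c i' j)" by (rule thr_cost_add[OF inst])
    also have "\<dots> \<le> ?h i j' + (?h i' j' + ?h i' j)" by (intro add_left_mono thr_cost_add[OF inst])
    finally show "?H 3 (c (g j) j) \<le> ?h i j' + ?h i' j' + ?h i' j" using le by simp
  qed (use u0 in auto)
  have oM: "?o j \<le> M" if "j < n" for j
  proof -
    have "?o j \<in> set (sorted_desc n ?o)" using that by (auto simp: set_sorted_desc)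
    then obtain y where "y < n" "?o j = sorted_desc n ?o ! y" by (auto simp: in_set_conv_nth)
    then show ?thesis unfolding M(1) using sorted_desc_antimono[of 0 y n ?o] by simp
  qed
  have "?h (\<sigma> j) j \<le> V" if "j < n" for j
  proof -
    have "?h (\<sigma> j) j \<le> w 0 * ?o j" by (rule thr_cost_le[OF inst \<rho>]) auto
    also have "\<dots> \<le> V" using oM[OF that] w0 by (simp add: V_def)
    finally show ?thesis .
  qed
  then have "OPT \<le> (\<Sum>j<n. V)" unfolding OPT_def by (intro sum_mono) auto
  then have OPT: "OPT \<le> real n * V" by simp
  have uV: "u = V / real n ^ 8" by (simp add: u V_def)
  \<comment> \<open>With k + 1 centers the Lagrangian bound would force the multiplier below OPT + 2
    n^2 u. Adding one more step gives n^3 V \<le> (n + 1) V, which is false for n \<ge> 2; this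
    fixes the exponent 11 = 8 + 3.\<close>
  have small: "card (S (n ^ 11 - 1)) \<le> k"
  proof (rule ccontr)
    let ?s = "n ^ 11 - 1"
    assume "\<not> card (S ?s) \<le> k"
    then have card: "real k + 1 \<le> real (card (S ?s))" by linarith
    have s: "?s < n ^ 11" using n by simp
    obtain g where g: "nearest n c (S ?s) g"
      using exists_nearest[OF ne[OF s] finite_subset[OF subset[OF s]]] by blast
    have "0 \<le> (\<Sum>j<n. ?H 3 (c (g j) j))"
      using thr_cost_nonneg[OF inst] by (intro sum_nonneg) auto
    then have "3 * (real ?s * u) * card (S ?s) \<le> 3 * (OPT + real ?s * u * k) + 6 * (real n)\<^sup>2 * u"
      using lag[OF s g] by linarith
    moreover have "3 * (real ?s * u) * (real k + 1) \<le> 3 * (real ?s * u) * card (S ?s)"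
      using card u0 by (intro mult_left_mono) auto
    ultimately have "real ?s * u \<le> OPT + 2 * (real n)\<^sup>2 * u" by (simp add: algebra_simps)
    then have "real (n ^ 11) * u \<le> OPT + (2 * (real n)\<^sup>2 + 1) * u"
      using n by (simp add: of_nat_diff algebra_simps)
    also have "\<dots> \<le> real n * V + (2 * (real n)\<^sup>2 + 1) * u" using OPT by simp
    also have "real (n ^ 11) * u = real n ^ 3 * V"
      using n by (simp add: uV field_simps flip: power_add)
    also have "(2 * (real n)\<^sup>2 + 1) * u \<le> real n ^ 8 * u"
    proof (intro mult_right_mono)
      have "1 \<le> (real n)\<^sup>2" using n by (intro one_le_power) auto
      then have "2 * (real n)\<^sup>2 + 1 \<le> 4 * (real n)\<^sup>2" by linarith
      also have "\<dots> \<le> real n ^ 6 * (real n)\<^sup>2"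
        using n power_mono[of 2 "real n" 6] by (intro mult_right_mono) auto
      finally show "2 * (real n)\<^sup>2 + 1 \<le> real n ^ 8" by (simp flip: power_add)
    qed (use u0 in simp)
    also have "real n ^ 8 * u = V" using n by (simp add: uV)
    finally have "real n ^ 3 * V \<le> (real n + 1) * V" by (simp add: algebra_simps)
    then have "real n ^ 3 \<le> real n + 1" using V0 by simp
    moreover have "real n * 4 \<le> real n * (real n)\<^sup>2"
      using n power_mono[of 2 "real n" 2] by (intro mult_left_mono) auto
    moreover have "real n * (real n)\<^sup>2 = real n ^ 3" by (simp add: power3_eq_cube power2_eq_square)
    moreover have "2 \<le> real n" using n by simp
    ultimately show False by linarith
  qed
  have "S 0 = {..<n}"
    using S[of 0] selection_zero[where h="?h" and u=u, OF _ h0 hd] u0 n by simp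
  then have zero: "k < card (S 0)" using inst by (simp add: okm_instance_def)
  define s where "s = (LEAST s. card (S s) \<le> k)"
  have s1: "card (S s) \<le> k" unfolding s_def using small by (rule LeastI)
  have s2: "s \<le> n ^ 11 - 1" unfolding s_def using small by (rule Least_le)
  have s3: "0 < s" using s1 zero by (metis gr0I not_less)
  have s4: "k < card (S (s - 1))" using not_less_Least[of "s - 1" "\<lambda>s. card (S s) \<le> k"] s3 s_def by auto
  have sl: "s < n ^ 11" "s - 1 < n ^ 11" using s2 s3 by auto
  obtain g1 g2 where g: "nearest n c (S s) g1" "nearest n c (S (s - 1)) g2"
    using exists_nearest ne[OF sl(1)] ne[OF sl(2)] finite_subset[OF subset[OF sl(1)]]
      finite_subset[OF subset[OF sl(2)]] by (metis finite_lessThan)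
  define C1 where "C1 = (\<Sum>j<n. ?H 3 (c (g1 j) j))"
  define C2 where "C2 = (\<Sum>j<n. ?H 3 (c (g2 j) j))"
  \<comment> \<open>6 n^2 u comes from the primal-dual bounds. The Lagrange terms 3 (lam + u) a b
    and 3 lam a b cancel up to 3 a b u, which accounts for the other 3 n^2 u.\<close>
  define B where "B = 3 * OPT + 9 * (real n)\<^sup>2 * u"
  define lam where "lam = real (s - 1) * u"
  have lam': "real s * u = lam + u" using s3 by (simp add: lam_def of_nat_diff algebra_simps)
  define a where "a = real (card (S (s - 1))) - k"
  define b where "b = real k - card (S s)"
  have ab: "0 < a" "0 \<le> b" using s1 s4 by (auto simp: a_def b_def)
  have lag1: "C1 \<le> 3 * OPT + 3 * (lam + u) * b + 6 * (real n)\<^sup>2 * u"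
    using lag[OF sl(1) g(1)] unfolding lam' C1_def b_def by (simp add: algebra_simps)
  have lag2: "C2 \<le> 3 * OPT - 3 * lam * a + 6 * (real n)\<^sup>2 * u"
    using lag[OF sl(2) g(2)] unfolding lam_def[symmetric] C2_def a_def by (simp add: algebra_simps)
  have "a * C1 + b * C2 \<le> a * (3 * OPT + 3 * (lam + u) * b + 6 * (real n)\<^sup>2 * u)
      + b * (3 * OPT - 3 * lam * a + 6 * (real n)\<^sup>2 * u)"
    using lag1 lag2 ab by (intro add_mono mult_left_mono) auto
  also have "\<dots> = (a + b) * (3 * OPT + 6 * (real n)\<^sup>2 * u) + 3 * (a * b) * u" by (simp add: algebra_simps)
  also have "3 * (a * b) * u \<le> 3 * ((a + b) * (real n)\<^sup>2) * u"
  proof -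
    have "b \<le> real n" using inst by (simp add: b_def okm_instance_def)
    also have "real n \<le> (real n)\<^sup>2" using n by (simp add: power2_eq_square)
    finally have "a * b \<le> (a + b) * (real n)\<^sup>2" using ab by (intro mult_mono) auto
    then show ?thesis using u0 by (intro mult_right_mono mult_left_mono) auto
  qed
  finally have "a * C1 + b * C2 \<le> (a + b) * B" by (simp add: B_def algebra_simps)
  then have aB: "a * C1 + b * C2 \<le> (real (card (S (s - 1))) - card (S s)) * B"
    by (simp add: a_def b_def)
  have final: "proxy_cost n w (\<lambda>l. 9 * \<rho> l) v' \<le> ?cost"
    if "(\<Sum>j<n. ?H 9 (v' j)) \<le> 2 * B" for v'
    unfolding okm_cost_def
    by (rule proxy_from_thr[OF inst _ n good M(1) u]) (use that in \<open>auto simp: B_def OPT_def algebra_simps\<close>)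
  have "good_set n k c w \<rho> (?cost) (S s)" if C: "C1 \<le> 2 * B"
    unfolding good_set_def
  proof (intro conjI allI impI)
    fix g assume g': "nearest n c (S s) g"
    have "(\<Sum>j<n. ?H 9 (c (g j) j)) \<le> C1"
      unfolding C1_def
    proof (rule sum_mono)
      fix j assume "j \<in> {..<n}"
      then have "c (g j) j \<le> c (g1 j) j" using g g' by (auto simp: nearest_def)
      then have "?H 9 (c (g j) j) \<le> ?H 9 (c (g1 j) j)"
        by (rule thr_cost_mono[OF inst])
      also have "\<dots> \<le> ?H 3 (c (g1 j) j)" using thr_cost_antimono[OF inst \<rho>] by simp
      finally show "?H 9 (c (g j) j) \<le> ?H 3 (c (g1 j) j)" .
    qed
    then show "proxy_cost n w (\<lambda>l. 9 * \<rho> l) (\<lambda>j. c (g j) j) \<le> ?cost"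
      using C by (intro final) simp
  qed (use s1 ne[OF sl(1)] in auto)
  moreover have "\<exists>r<n. good_set n k c w \<rho> (?cost) (window k (S s) (S (s - 1)) \<pi> r)"
    if C: "\<not> C1 \<le> 2 * B" and \<pi>: "nearest n c (S (s - 1)) \<pi>" for \<pi>
  proof -
    have g12: "\<And>j. j < n \<Longrightarrow> g1 j \<in> S s" "\<And>j. j < n \<Longrightarrow> g2 j \<in> S (s - 1)"
      using g by (auto simp: nearest_def)
    let ?W = "window k (S s) (S (s - 1)) \<pi>"
    obtain r where r: "r < n" "?W r \<noteq> {}" "card (?W r) \<le> k"
      "\<And>g. nearest n c (?W r) g \<Longrightarrow> (\<Sum>j<n. ?H 9 (c (g j) j)) \<le> 2 * B"
      using bipoint_rounding[OF inst \<rho> subset[OF sl(1)] subset[OF sl(2)] ne[OF sl(1)] s1 s4 g12 \<pi> C1_def C2_def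
          aB[unfolded a_def b_def]]
        C by blast
    then have "good_set n k c w \<rho> (?cost) (?W r)"
      using final by (simp add: good_set_def)
    then show ?thesis using r(1) by blast
  qed
  ultimately show ?thesis using s3 sl ne[OF sl(2)] by blast
qed

section \<open>Guessing the thresholds\<close>

text \<open>
  The code \<open>m\<close> is read bit by bit: a one lowers the current level \<open>r\<close>, a zero starts the next
  block and assigns level \<open>r\<close> to it.
\<close>

definition next_block :: "nat \<Rightarrow> nat \<Rightarrow> nat" where
  "next_block n p = (\<Sum>y<n. of_bool (2 * (y + 1) \<le> 3 * (p + 1)))"

text \<open>A level is written to the whole suffix from the new block on, and later blocks overwrite
  their part of it.\<close>

definition decode_step :: "nat \<Rightarrow> nat \<times> nat \<times> real \<times> vec \<Rightarrow> nat \<times> nat \<times> real \<times> vec" where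
  "decode_step n = (\<lambda>(m, p, r, \<rho>).
     if odd m then (m div 2, p, 4/5 * r, \<rho>)
     else (m div 2, next_block n p, r, \<lambda>y. if y < n \<and> next_block n p \<le> y then r else \<rho> y))"

definition decode :: "nat \<Rightarrow> nat \<Rightarrow> real \<Rightarrow> nat \<Rightarrow> nat \<times> nat \<times> real \<times> vec" where
  "decode n m M N = (decode_step n ^^ N) (m, 0, M, \<lambda>_. M)"

text \<open>The definition counts indices because the machine can count but cannot divide.\<close>

lemma next_block_eq: "next_block n p = min n (3 * (p + 1) div 2)"
proof -
  have "{y. y < n \<and> 2 * (y + 1) \<le> 3 * (p + 1)} = {..<min n (3 * (p + 1) div 2)}" by auto
  moreover have "next_block n p = card {y. y < n \<and> 2 * (y + 1) \<le> 3 * (p + 1)}"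
    by (simp add: next_block_def Collect_conj_eq lessThan_def)
  ultimately show ?thesis by simp
qed

text \<open>Past the last block only zeros remain, and they change no threshold; a fixed number of
  steps may thus exceed the length of the code.\<close>

lemma decode_stable:
  "n \<le> p \<Longrightarrow> \<exists>r'. (decode_step n ^^ N) (0, p, r, \<rho>) = (0, if N = 0 then p else n, r, \<rho>)"
  by (induction N) (auto simp: decode_step_def next_block_eq)

text \<open>The encoder. \<open>t\<close> counts the lowerings so far, at most \<open>T\<close>, and
  \<open>q\<close> bounds the blocks still ahead; each bit uses up one of them. A one is emitted as
  long as the first entry of the next block is below the next level. When this stops, the level is
  within a factor 5/4 of that entry, or \<open>t = T\<close> and the level is at most
  \<kappa>.\<close>

lemma decode_exists_aux:
  assumes anti: "\<And>i j. i \<le> j \<Longrightarrow> j < n \<Longrightarrow> s j \<le> s i"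
    and cut: "M * (4/5) ^ T \<le> \<kappa>" "0 \<le> \<kappa>" and s0: "\<And>y. y < n \<Longrightarrow> 0 \<le> s y"
    and pt: "p \<le> n" "t \<le> T" "\<And>y. next_block n p \<le> y \<Longrightarrow> y < n \<Longrightarrow> s y \<le> M * (4/5) ^ t"
    and q: "real n + 1 \<le> (real p + 1) * (3/2) ^ q"
  shows "\<exists>m N p' r' \<rho>'. N \<le> T - t + q \<and> m < 2 ^ N \<and> n \<le> p' \<and>
    (decode_step n ^^ N) (m, p, M * (4/5) ^ t, \<rho>) = (0, p', r', \<rho>') \<and>
    (\<forall>y. y < next_block n p \<longrightarrow> \<rho>' y = \<rho> y) \<and>
    (\<forall>y<n. next_block n p \<le> y \<longrightarrow> good_guess \<kappa> s \<rho>' y)"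
  using pt q
proof (induction "T - t + q" arbitrary: p t q \<rho> rule: less_induct)
  case less
  let ?r = "M * (4/5) ^ t" and ?nb = "next_block n p"
  show ?case
  proof (cases "n \<le> p")
    case True
    then have "n \<le> ?nb" by (auto simp: next_block_eq)
    then show ?thesis using True
      by (intro exI[of _ 0] exI[of _ p] exI[of _ ?r] exI[of _ \<rho>]) auto
  next
    case False
    then have q0: "0 < q" using less.prems(4) by (intro gr0I) auto
    show ?thesis
    proof (cases "t < T \<and> ?nb < n \<and> s ?nb \<le> M * (4/5) ^ Suc t")
      case True
      have sy: "s y \<le> M * (4/5) ^ Suc t" if "?nb \<le> y" "y < n" for y
        using anti[OF that] True by linarith
      have lt: "T - Suc t + q < T - t + q" "Suc t \<le> T" using True by auto
      obtain m N p' r' \<rho>' where IH: "N \<le> T - Suc t + q" "m < 2 ^ N" "n \<le> p'"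
        "(decode_step n ^^ N) (m, p, M * (4/5) ^ Suc t, \<rho>) = (0, p', r', \<rho>')"
        "\<forall>y. y < ?nb \<longrightarrow> \<rho>' y = \<rho> y" "\<forall>y<n. ?nb \<le> y \<longrightarrow> good_guess \<kappa> s \<rho>' y"
        using less.hyps[of "Suc t" q p \<rho>, OF lt(1) less.prems(1) lt(2) sy less.prems(4)] by blast
      \<comment> \<open>The lowest bit is read first, so a bit is prepended by doubling.\<close>
      have "(decode_step n ^^ Suc N) (2 * m + 1, p, ?r, \<rho>) = (0, p', r', \<rho>')"
        using IH(4) by (simp add: funpow_swap1 decode_step_def mult.commute mult.left_commute)
      then show ?thesis using IH True
        by (intro exI[of _ "2 * m + 1"] exI[of _ "Suc N"] exI[of _ p'] exI[of _ r'] exI[of _ \<rho>']) auto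
    next
      case stop: False
      define \<rho>1 where "\<rho>1 = (\<lambda>y. if y < n \<and> ?nb \<le> y then ?r else \<rho> y)"
      have nb: "?nb \<le> next_block n ?nb" "?nb \<le> n" by (auto simp: next_block_eq)
      \<comment> \<open>Measuring positions by p + 1 absorbs the rounding down: 3 (p + 1) \<le> 2
        (nb + 1) for the next block start nb.\<close>
      have grow: "real n + 1 \<le> (real ?nb + 1) * (3/2) ^ (q - 1)"
      proof (cases "?nb = n")
        case True
        have "1 * (real n + 1) \<le> (3/2) ^ (q - 1) * (real n + 1)" by (intro mult_right_mono) auto
        then show ?thesis using True by (simp add: mult.commute)
      next
        case False
        then have "?nb = 3 * (p + 1) div 2" by (auto simp: next_block_eq min_def split: if_splits)
        moreover have "x \<le> 2 * (x div 2 + 1)" for x :: nat by presburger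
        ultimately have "3 * (p + 1) \<le> 2 * (?nb + 1)" by metis
        then have "real (3 * (p + 1)) \<le> real (2 * (?nb + 1))" by (rule of_nat_mono)
        then have "(real p + 1) * (3/2) * (3/2) ^ (q - 1) \<le> (real ?nb + 1) * (3/2) ^ (q - 1)"
          by (intro mult_right_mono) auto
        moreover have "(real p + 1) * (3/2) ^ q = (real p + 1) * (3/2) * (3/2) ^ (q - 1)"
          using q0 by (cases q) auto
        ultimately show ?thesis using less.prems(4) by linarith
      qed
      have sy: "s y \<le> ?r" if "next_block n ?nb \<le> y" "y < n" for y
        using less.prems(3) that nb by simp
      have lt: "T - t + (q - 1) < T - t + q" using q0 by simp
      obtain m N p' r' \<rho>' where IH: "N \<le> T - t + (q - 1)" "m < 2 ^ N" "n \<le> p'"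
        "(decode_step n ^^ N) (m, ?nb, ?r, \<rho>1) = (0, p', r', \<rho>')"
        "\<forall>y. y < next_block n ?nb \<longrightarrow> \<rho>' y = \<rho>1 y"
        "\<forall>y<n. next_block n ?nb \<le> y \<longrightarrow> good_guess \<kappa> s \<rho>' y"
        using less.hyps[of t "q - 1" ?nb \<rho>1, OF lt nb(2) less.prems(2) sy grow] by blast
      have "(decode_step n ^^ Suc N) (2 * m, p, ?r, \<rho>) = (0, p', r', \<rho>')"
        using IH(4) by (simp add: funpow_swap1 decode_step_def \<rho>1_def)
      moreover have "\<forall>y. y < ?nb \<longrightarrow> \<rho>' y = \<rho> y" using IH(5) nb by (simp add: \<rho>1_def)
      moreover have "good_guess \<kappa> s \<rho>' y" if y: "y < n" "?nb \<le> y" for y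
      proof (cases "next_block n ?nb \<le> y")
        case True
        then show ?thesis using IH y by blast
      next
        case False
        then have \<rho>': "\<rho>' y = ?r" using IH(5) y by (simp add: \<rho>1_def)
        have "2 * (y + 1) \<le> 3 * (?nb + 1)" using False by (auto simp: next_block_eq min_def split: if_splits)
        moreover have "s ?nb \<le> ?r" using less.prems(3)[of ?nb] y by simp
        moreover have "?r \<le> 5/4 * s ?nb + \<kappa>"
        proof (cases "t < T")
          case True
          then have "\<not> s ?nb \<le> M * (4/5) ^ Suc t" using stop y by auto
          then show ?thesis using cut(2) by simp
        next
          case False
          then have "t = T" using less.prems(2) by simp
          then show ?thesis using cut s0[of ?nb] y by simp
        qed
        ultimately show ?thesis using \<rho>' y unfolding good_guess_def by metis
      qed
      ultimately show ?thesis using IH(1,2,3) q0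
        by (intro exI[of _ "2 * m"] exI[of _ "Suc N"] exI[of _ p'] exI[of _ r'] exI[of _ \<rho>']) auto
    qed
  qed
qed

lemma decode_nonneg: "0 \<le> M \<Longrightarrow> decode n m M N = (m', p', r', \<rho>') \<Longrightarrow> 0 \<le> r' \<and> (\<forall>y. 0 \<le> \<rho>' y)"
  by (induction N arbitrary: m' p' r' \<rho>')
    (auto simp: decode_def decode_step_def split: prod.splits if_splits)

text \<open>With L least such that n + 1 \<le> 2^L, so 2^L \<le> 2 n: as (4/5)^4 \<le> 1/2, 24 L
  lowerings reach M / n^6, and as (3/2)^2 \<ge> 2, 2 L blocks cover all positions. A code of 26 L
  bits is below (2 n)^26 \<le> n^52, and it is read in 26 L \<le> 26 n \<le> n^6 steps.\<close>

lemma decode_exists: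
  assumes n: "2 \<le> n" and anti: "\<And>i j. i \<le> j \<Longrightarrow> j < n \<Longrightarrow> s j \<le> s i"
    and s0: "\<And>y. y < n \<Longrightarrow> 0 \<le> s y" and M: "M = s 0"
  shows "\<exists>m < n ^ 52. \<exists>m' p' r' \<rho>. decode n m M (n ^ 6) = (m', p', r', \<rho>) \<and>
    (\<forall>y<n. good_guess (M / real n ^ 6) s \<rho> y)"
proof -
  have M0: "0 \<le> M" using s0[of 0] n M by simp
  have "n + 1 \<le> 2 ^ n" by (induction n) auto
  define L where "L = (LEAST L. n + 1 \<le> 2 ^ L)"
  have L1: "n + 1 \<le> 2 ^ L" unfolding L_def using \<open>n + 1 \<le> 2 ^ n\<close> by (rule LeastI)
  have Ln: "L \<le> n" unfolding L_def using \<open>n + 1 \<le> 2 ^ n\<close> by (rule Least_le)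
  have "L \<noteq> 0" using L1 n by (intro notI) simp
  then have "\<not> n + 1 \<le> 2 ^ (L - 1)"
    using not_less_Least[of "L - 1" "\<lambda>L. n + 1 \<le> 2 ^ L"] by (simp add: L_def)
  then have "2 * 2 ^ (L - 1) \<le> 2 * n" by simp
  then have L2: "2 ^ L \<le> 2 * n" using \<open>L \<noteq> 0\<close> by (simp add: power_eq_if)
  have pw: "real n + 1 \<le> 2 ^ L" using of_nat_mono[OF L1, where 'a=real] by simp
  then have pw': "real n \<le> 2 ^ L" by linarith
  have "M * (4/5) ^ (24 * L) = M * (((4/5) ^ 4) ^ L) ^ 6"
    by (simp add: power_mult[symmetric] mult.commute)
  also have "\<dots> \<le> M * ((1/2) ^ L) ^ 6"
    using M0 by (intro mult_left_mono power_mono) (auto simp: power_divide)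
  also have "\<dots> = M / (2 ^ L) ^ 6" by (simp add: power_divide)
  also have "\<dots> \<le> M / real n ^ 6"
    using M0 n pw' by (intro divide_left_mono power_mono) auto
  finally have cut: "M * (4/5) ^ (24 * L) \<le> M / real n ^ 6" .
  have "real n + 1 \<le> 2 ^ L" by (rule pw)
  also have "(2::real) ^ L \<le> ((3/2) ^ 2) ^ L" by (intro power_mono) (auto simp: power_divide)
  finally have q: "real n + 1 \<le> (real 0 + 1) * (3/2) ^ (2 * L)" by (simp add: power_mult)
  have "s y \<le> M * (4/5) ^ 0" if "y < n" for y using anti[of 0 y] that M by simp
  then obtain m N p' r' \<rho> where dec: "N \<le> 24 * L - 0 + 2 * L" "m < 2 ^ N" "n \<le> p'"
    "(decode_step n ^^ N) (m, 0, M * (4/5) ^ 0, \<lambda>_. M) = (0, p', r', \<rho>)"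
    "\<forall>y. y < next_block n 0 \<longrightarrow> \<rho> y = M"
    "\<forall>y<n. next_block n 0 \<le> y \<longrightarrow> good_guess (M / real n ^ 6) s \<rho> y"
    using decode_exists_aux[where n=n and s=s and p=0 and t=0 and \<rho>="\<lambda>_. M", OF anti cut _ s0 _ _ _ q] M0 by auto
  have nb: "next_block n 0 = 1" using n by (simp add: next_block_eq)
  have "26 * n \<le> n ^ 5 * n" using n power_mono[of 2 n 5] by (intro mult_right_mono) auto
  then have "26 * n \<le> n ^ 6" by (simp add: eval_nat_numeral)
  then have N: "N \<le> n ^ 6" using dec(1) Ln by linarith
  have "m < 2 ^ N" by (rule dec)
  also have "(2::nat) ^ N \<le> 2 ^ (26 * L)" using dec(1) by (intro power_increasing) auto
  also have "\<dots> = (2 ^ L) ^ 26" by (simp add: power_mult[symmetric] mult.commute)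
  also have "\<dots> \<le> (2 * n) ^ 26" using L2 by (rule power_mono) simp
  also have "\<dots> \<le> (n\<^sup>2) ^ 26" using n by (intro power_mono) (auto simp: power2_eq_square)
  also have "\<dots> = n ^ 52" by (simp add: power_mult[symmetric])
  finally have m: "m < n ^ 52" .
  have "decode n m M (n ^ 6) = (decode_step n ^^ (n ^ 6 - N)) (0, p', r', \<rho>)"
  proof -
    have "(decode_step n ^^ (n ^ 6 - N + N)) x = (decode_step n ^^ (n ^ 6 - N)) ((decode_step n ^^ N) x)" for x
      by (simp add: funpow_add)
    then show ?thesis using N dec(4) by (simp add: decode_def)
  qed
  also have "\<dots> = (0, if n ^ 6 - N = 0 then p' else n, r', \<rho>)"
    using decode_stable[OF dec(3)] by simp
  finally have "decode n m M (n ^ 6) = (0, if n ^ 6 - N = 0 then p' else n, r', \<rho>)" .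
  moreover have "good_guess (M / real n ^ 6) s \<rho> y" if "y < n" for y
  proof (cases "y = 0")
    \<comment> \<open>The first entry is a block of its own and keeps the initial level M.\<close>
    case True
    have "0 \<le> M / real n ^ 6" using M0 by simp
    then have "M \<le> 5/4 * M + M / real n ^ 6" using M0 by linarith
    then show ?thesis using dec(5) nb M True by (auto simp: good_guess_def)
  qed (use dec(6) nb that in auto)
  ultimately show ?thesis using m by blast
qed

section \<open>Reasoning about bounded loops\<close>

datatype location = NReg nat | RReg nat | NArr nat | RArr nat

fun agree :: "location \<Rightarrow> state \<Rightarrow> state \<Rightarrow> bool" where
  "agree (NReg x) s s' \<longleftrightarrow> nreg s' x = nreg s x"
| "agree (RReg x) s s' \<longleftrightarrow> rreg s' x = rreg s x"
| "agree (NArr a) s s' \<longleftrightarrow> narr s' a = narr s a"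
| "agree (RArr a) s s' \<longleftrightarrow> rarr s' a = rarr s a"

text \<open>A syntactic check, so simplification decides most frame conditions about the
  program.\<close>

primrec keeps :: "stm \<Rightarrow> location \<Rightarrow> bool" where
  "keeps (NSet x e) l \<longleftrightarrow> l \<noteq> NReg x"
| "keeps (RSet x e) l \<longleftrightarrow> l \<noteq> RReg x"
| "keeps (NPut a e g) l \<longleftrightarrow> l \<noteq> NArr a"
| "keeps (RPut a e g) l \<longleftrightarrow> l \<noteq> RArr a"
| "keeps (p ;; q) l \<longleftrightarrow> keeps p l \<and> keeps q l"
| "keeps (Branch b p q) l \<longleftrightarrow> keeps p l \<and> keeps q l"
| "keeps (For x p) l \<longleftrightarrow> l \<noteq> NReg x \<and> keeps p l"
| "keeps (Loop p) l \<longleftrightarrow> keeps p l"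

abbreviation "keeps_n p x \<equiv> keeps p (NReg x)"
abbreviation "keeps_r p x \<equiv> keeps p (RReg x)"
abbreviation "keeps_na p a \<equiv> keeps p (NArr a)"
abbreviation "keeps_ra p a \<equiv> keeps p (RArr a)"

lemma fold_invariant:
  assumes "P s" "\<And>m s. P s \<Longrightarrow> P (f m s)"
  shows "P (fold f xs s)"
  using assms(1) by (induction xs arbitrary: s) (auto intro: assms(2))

lemma funpow_invariant:
  assumes "P s" "\<And>s. P s \<Longrightarrow> P (f s)"
  shows "P ((f ^^ m) s)"
  using assms by (induction m) auto

lemma agree_trans: "agree l s s' \<Longrightarrow> agree l s' s'' \<Longrightarrow> agree l s s''"
  by (cases l) auto

lemma keeps_agree: "keeps p l \<Longrightarrow> agree l s (sem p s)"
proof (induction p arbitrary: s)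
  case (Sq p q)
  then show ?case by (auto intro: agree_trans)
next
  case (For x p)
  have "agree l s' (sem p (setn x m s'))" for m s'
    using For by (cases l) (auto intro: agree_trans[of l s' "setn x m s'"])
  then show ?case
    by (simp, intro fold_invariant[where P="agree l s"]) (cases l, auto intro: agree_trans)
next
  case (Loop p)
  then show ?case
    by (simp, intro funpow_invariant[where P="agree l s"]) (cases l, auto intro: agree_trans)
qed (cases l; auto)+

lemma
  shows keeps_n [simp]: "keeps_n p x \<Longrightarrow> nreg (sem p s) x = nreg s x"
    and keeps_r [simp]: "keeps_r p x \<Longrightarrow> rreg (sem p s) x = rreg s x"
    and keeps_na [simp]: "keeps_na p x \<Longrightarrow> narr (sem p s) x = narr s x"
    and keeps_ra [simp]: "keeps_ra p x \<Longrightarrow> rarr (sem p s) x = rarr s x"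
  using keeps_agree[of p "NReg x" s] keeps_agree[of p "RReg x" s]
    keeps_agree[of p "NArr x" s] keeps_agree[of p "RArr x" s] by simp_all

primrec rep :: "nat \<Rightarrow> stm \<Rightarrow> stm" where
  "rep 0 p = p"
| "rep (Suc m) p = Loop (rep m p)"

lemma rep_simps [simp]:
  "keeps (rep m p) l = keeps p l" "swf (rep m p) = swf p"
  by (induction m) auto

lemma sem_rep:
  assumes "keeps_n p 0"
  shows "sem (rep m p) s = (sem p ^^ (nreg s 0 ^ m)) s"
proof (induction m arbitrary: s)
  case (Suc m)
  have "(sem (rep m p) ^^ i) s = (sem p ^^ (nreg s 0 ^ m * i)) s" for i
  proof (induction i)
    case (Suc i)
    have "nreg ((sem p ^^ j) s) 0 = nreg s 0" for j
      using assms by (intro funpow_invariant[where P="\<lambda>s'. nreg s' 0 = nreg s 0"]) auto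
    then show ?case using Suc.IH by (simp add: Suc.IH \<open>\<And>s. sem (rep m p) s = _ s\<close> funpow_add)
  qed simp
  then show ?case by (simp add: mult.commute)
qed simp

lemma rep_rule:
  assumes "keeps_n p 0" "nreg s 0 = n" "P 0 s"
    and "\<And>i s. i < n ^ m \<Longrightarrow> nreg s 0 = n \<Longrightarrow> P i s \<Longrightarrow> P (Suc i) (sem p s)"
  shows "P (n ^ m) (sem (rep m p) s)"
proof -
  have "i \<le> n ^ m \<Longrightarrow> P i ((sem p ^^ i) s) \<and> nreg ((sem p ^^ i) s) 0 = n" for i
    by (induction i) (use assms in auto)
  then show ?thesis using sem_rep[OF assms(1)] assms(2) by auto
qed

lemma For_rule:
  assumes "nreg s 0 = n" "P 0 s"
    and "\<And>m s. m < n \<Longrightarrow> P m s \<Longrightarrow> P (Suc m) (sem p (setn x m s))"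
  shows "P n (sem (For x p) s)"
proof -
  have "m \<le> n \<Longrightarrow> P m (fold (\<lambda>m s. sem p (setn x m s)) [0..<m] s)" for m
    by (induction m) (use assms in auto)
  then show ?thesis using assms(1) by simp
qed

definition same :: "nat set \<Rightarrow> nat set \<Rightarrow> nat set \<Rightarrow> nat set \<Rightarrow> state \<Rightarrow> state \<Rightarrow> bool" where
  "same N R A B s s' \<longleftrightarrow> (\<forall>x. x \<notin> N \<longrightarrow> nreg s' x = nreg s x) \<and> (\<forall>x. x \<notin> R \<longrightarrow> rreg s' x = rreg s x)
     \<and> (\<forall>x. x \<notin> A \<longrightarrow> narr s' x = narr s x) \<and> (\<forall>x. x \<notin> B \<longrightarrow> rarr s' x = rarr s x)"

text \<open>For loops that amount to a simultaneous assignment: \<open>e\<close> must have the same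
  value however much of array \<open>a\<close> has been overwritten, hence the quantification over
  all states that agree up to \<open>x\<close> and \<open>a\<close>.\<close>

lemma For_RPut:
  assumes "x \<noteq> 0" "\<And>s' m. m < nreg s 0 \<Longrightarrow> same {x} {} {} {a} s s' \<Longrightarrow> nreg s' x = m \<Longrightarrow> rval e s' = f m"
  shows "rarr (sem (For x (RPut a (NVar x) e)) s) a i = (if i < nreg s 0 then f i else rarr s a i)"
proof -
  have "same {x} {} {} {a} s (sem (For x (RPut a (NVar x) e)) s) \<and>
    (\<forall>i. rarr (sem (For x (RPut a (NVar x) e)) s) a i = (if i < nreg s 0 then f i else rarr s a i))"
  proof (rule For_rule[OF refl])
    fix m s' assume m: "m < nreg s 0"
      and s': "same {x} {} {} {a} s s' \<and> (\<forall>i. rarr s' a i = (if i < m then f i else rarr s a i))"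
    have "same {x} {} {} {a} s (setn x m s')" using s' by (auto simp: same_def)
    then have "rval e (setn x m s') = f m" using assms(2)[OF m] by simp
    then show "same {x} {} {} {a} s (sem (RPut a (NVar x) e) (setn x m s')) \<and>
      (\<forall>i. rarr (sem (RPut a (NVar x) e) (setn x m s')) a i = (if i < Suc m then f i else rarr s a i))"
      using s' by (auto simp: same_def less_Suc_eq)
  qed (auto simp: same_def)
  then show ?thesis by blast
qed

lemma For_NPut:
  assumes "x \<noteq> 0" "\<And>s' m. m < nreg s 0 \<Longrightarrow> same {x} {} {a} {} s s' \<Longrightarrow> nreg s' x = m \<Longrightarrow> nval e s' = f m"
  shows "narr (sem (For x (NPut a (NVar x) e)) s) a i = (if i < nreg s 0 then f i else narr s a i)"
proof -
  have "same {x} {} {a} {} s (sem (For x (NPut a (NVar x) e)) s) \<and>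
    (\<forall>i. narr (sem (For x (NPut a (NVar x) e)) s) a i = (if i < nreg s 0 then f i else narr s a i))"
  proof (rule For_rule[OF refl])
    fix m s' assume m: "m < nreg s 0"
      and s': "same {x} {} {a} {} s s' \<and> (\<forall>i. narr s' a i = (if i < m then f i else narr s a i))"
    have "same {x} {} {a} {} s (setn x m s')" using s' by (auto simp: same_def)
    then have "nval e (setn x m s') = f m" using assms(2)[OF m] by simp
    then show "same {x} {} {a} {} s (sem (NPut a (NVar x) e) (setn x m s')) \<and>
      (\<forall>i. narr (sem (NPut a (NVar x) e) (setn x m s')) a i = (if i < Suc m then f i else narr s a i))"
      using s' by (auto simp: same_def less_Suc_eq)
  qed (auto simp: same_def)
  then show ?thesis by blast
qed

text \<open>Truth is positivity. \<open>or_e\<close> is addition and may exceed 1, whereas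
  \<open>not_e\<close> and \<open>and_e\<close> return 0 or 1 and can be counted by
  \<open>NSum\<close>.\<close>

definition not_e :: "nexp \<Rightarrow> nexp" where "not_e b = NLt b (NNum 1)"
definition or_e :: "nexp \<Rightarrow> nexp \<Rightarrow> nexp" where "or_e b b' = NBin NAdd b b'"
definition and_e :: "nexp \<Rightarrow> nexp \<Rightarrow> nexp" where "and_e b b' = not_e (or_e (not_e b) (not_e b'))"
definition pos_e :: "rexp \<Rightarrow> rexp" where "pos_e e = RIf (RLt (RNum 0) e) e (RNum 0)"
definition skip :: stm where "skip = NSet 9 (NVar 9)"

lemma not_e_val [simp]: "nval (not_e b) s = of_bool (\<not> 0 < nval b s)"
  by (simp add: not_e_def)

lemma or_e_val [simp]: "0 < nval (or_e b b') s \<longleftrightarrow> 0 < nval b s \<or> 0 < nval b' s"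
  by (simp add: or_e_def)

lemma and_e_val [simp]: "nval (and_e b b') s = of_bool (0 < nval b s \<and> 0 < nval b' s)"
  by (auto simp: and_e_def or_e_def)

text \<open>A sum doubles as a bounded existential quantifier. This is its default reading from here
  on; the numerical one is invoked explicitly.\<close>

lemma NSum_pos: "0 < nval (NSum x b) s \<longleftrightarrow> (\<exists>m<nreg s 0. 0 < nval b (setn x m s))"
  by (auto simp: sum_eq_0_iff simp flip: neq0_conv)

declare nval.simps(5) [simp del] and NSum_pos [simp]

lemma pos_e_val [simp]: "rval (pos_e e) s = max 0 (rval e s)"
  by (auto simp: pos_e_def)

lemma skip_sem [simp]: "sem skip s = s"
  by (simp add: skip_def fun_upd_idem)

lemma skip_keeps [simp]: "keeps skip l \<longleftrightarrow> l \<noteq> NReg 9"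
  by (simp add: skip_def)

lemma macro_wf [simp]:
  "nwf (not_e b) = nwf b" "nwf (or_e b b') \<longleftrightarrow> nwf b \<and> nwf b'" "nwf (and_e b b') \<longleftrightarrow> nwf b \<and> nwf b'"
  "rwf (pos_e e) = rwf e" "swf skip"
  by (auto simp: not_e_def or_e_def and_e_def pos_e_def skip_def)

section \<open>The program\<close>

text \<open>
  Natural-number registers: 2, 3 the pair whose distance is the guess for the largest cost, 4 the
  code of the thresholds, 5 the unread part of the code, 6 its half, 7 the current block, 8 the
  offset of the window, 9 the number of centers written, from 10 on loop and sum variables.
  Real registers: 0 the largest cost, 1 the current level, 2 the step \<open>u\<close>, 3 the opening cost,
  4 an upper bound on the cost of the output.
  Real arrays: 2 thresholds, 3 duals, 4 raised duals.  Natural-number arrays: 2 the selected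
  facilities, 3 those for the previous opening cost, 4 the candidate set of centers, 5 the nearest
  candidate center, 6 the nearest previously selected facility.
\<close>

definition dist_e :: "nexp \<Rightarrow> nexp \<Rightarrow> rexp" where
  "dist_e i j = RGet 0 (NBin NAdd (NSum 15 i) j)"

text \<open>Array 1 is zero from index n on, which supplies the last case of
  \<open>gap\<close>.\<close>

definition gap_e :: rexp where
  "gap_e = RBin RSub (RGet 1 (NVar 13)) (RGet 1 (NBin NAdd (NVar 13) (NNum 1)))"

definition edge_e :: "nat \<Rightarrow> nat \<Rightarrow> rexp" where
  "edge_e x y = RSum 13 (RBin RMul gap_e (pos_e (RBin RSub (dist_e (NVar x) (NVar y)) (RGet 2 (NVar 13)))))"

definition opened_e :: "nat \<Rightarrow> nexp" where
  "opened_e x = not_e (RLt (RSum 12 (pos_e (RBin RSub (RGet 3 (NVar 12)) (edge_e x 12)))) (RVar 3))"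

definition frozen_e :: nexp where
  "frozen_e = NSum 11 (and_e (opened_e 11) (not_e (RLt (RGet 3 (NVar 10)) (edge_e 11 10))))"

definition conflict_e :: nexp where
  "conflict_e = NSum 14
     (and_e (RLt (edge_e 10 14) (RBin RSub (RGet 3 (NVar 14)) (RVar 2)))
          (RLt (edge_e 11 14) (RBin RSub (RGet 3 (NVar 14)) (RVar 2))))"

text \<open>The second array is there because every raise is decided by the old duals.\<close>

definition raise_p :: stm where
  "raise_p = For 10 (RPut 4 (NVar 10)
      (RIf frozen_e (RGet 3 (NVar 10)) (RBin RAdd (RGet 3 (NVar 10)) (RVar 2)))) ;;
    For 10 (RPut 3 (NVar 10) (RGet 4 (NVar 10)))"

text \<open>Greedy by index. Only entries below the current one are consulted, as the others are
  left over from the previous round.\<close>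

definition select_p :: stm where
  "select_p = For 10 (NPut 2 (NVar 10) (and_e (opened_e 10)
     (not_e (NSum 11 (and_e (NLt (NVar 11) (NVar 10)) (and_e (NGet 2 (NVar 11)) conflict_e))))))"

definition primal_dual_p :: stm where
  "primal_dual_p = For 10 (RPut 3 (NVar 10) (RNum 0)) ;; rep 11 raise_p ;; select_p"

definition nearest_p :: "nat \<Rightarrow> nat \<Rightarrow> stm" where
  "nearest_p a b = For 10 (For 11 (Branch
     (and_e (NGet a (NVar 11)) (not_e (NSum 12
       (and_e (NGet a (NVar 12)) (RLt (dist_e (NVar 12) (NVar 10)) (dist_e (NVar 11) (NVar 10)))))))
     (NPut b (NVar 10) (NVar 11)) skip))"

definition count_e :: "nat \<Rightarrow> nexp" where
  "count_e a = NSum 10 (NLt (NNum 0) (NGet a (NVar 10)))"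

text \<open>Without a conversion to reals, the factor \<open>real (Suc l)\<close> is produced by
  adding the threshold once for every index up to l.\<close>

definition proxy_e :: rexp where
  "proxy_e = RSum 13 (RBin RMul gap_e (RBin RAdd
     (RSum 12 (RIf (NLt (NVar 13) (NVar 12)) (RNum 0) (RBin RMul (RNum 9) (RGet 2 (NVar 13)))))
     (RSum 12 (pos_e (RBin RSub (dist_e (NGet 5 (NVar 12)) (NVar 12))
       (RBin RMul (RNum 9) (RGet 2 (NVar 13))))))))"

definition emit_p :: stm where
  "emit_p = NPut 0 (NVar 9) (NVar 10) ;; NSet 9 (NBin NAdd (NVar 9) (NNum 1))"

text \<open>The output needs exactly k centers, so a smaller candidate set is padded with arbitrary
  other points.\<close>

definition centers_p :: stm where
  "centers_p = NSet 9 (NNum 0) ;; For 10 (Branch (NGet 4 (NVar 10)) emit_p skip) ;;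
    For 10 (Branch (and_e (not_e (NGet 4 (NVar 10))) (NLt (NVar 9) (NVar 1))) emit_p skip)"

definition consider_p :: stm where
  "consider_p = Branch (and_e (count_e 4) (not_e (NLt (NVar 1) (count_e 4))))
     (nearest_p 4 5 ;;
      Branch (RLt proxy_e (RVar 4))
        (RSet 4 proxy_e ;; centers_p ;; For 10 (NPut 1 (NVar 10) (NGet 5 (NVar 10)))) skip)
     skip"

definition unmatched_e :: "nat \<Rightarrow> nexp" where
  "unmatched_e y = and_e (NGet 3 (NVar y)) (not_e (NSum 14
     (and_e (NGet 2 (NVar 14)) (and_e (not_e (NLt (NGet 6 (NVar 14)) (NVar y)))
       (not_e (NLt (NVar y) (NGet 6 (NVar 14))))))))"

definition window_e :: nexp where
  "window_e =
    (let N = NSum 11 (unmatched_e 11); q = NBin NSub (NSum 11 (NLt (NNum 0) (NGet 3 (NVar 11)))) (NVar 1);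
         v = NBin NAdd (NSum 11 (and_e (NLt (NVar 11) (NVar 10)) (unmatched_e 11))) (NVar 8)
     in and_e (NGet 3 (NVar 10)) (not_e (and_e (unmatched_e 10)
          (or_e (and_e (NLt v N) (NLt v q)) (and_e (not_e (NLt v N)) (NLt (NBin NSub v N) q))))))"

definition window_p :: stm where
  "window_p = For 8 (For 10 (NPut 4 (NVar 10) window_e) ;; consider_p)"

text \<open>In the first round array 3 may still hold a selection from the previous guess. This is
  harmless, since \<open>consider_p\<close> checks and values every candidate.\<close>

definition round_p :: stm where
  "round_p = primal_dual_p ;; For 10 (NPut 4 (NVar 10) (NGet 2 (NVar 10))) ;; consider_p ;;
     nearest_p 3 6 ;; window_p ;; For 10 (NPut 3 (NVar 10) (NGet 2 (NVar 10))) ;;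
     RSet 3 (RBin RAdd (RVar 3) (RVar 2))"

text \<open>Halving by counting; \<open>n ^ 52\<close> rounds suffice because codes do not exceed
  \<open>n ^ 52\<close>.\<close>

definition half_p :: stm where
  "half_p = NSet 6 (NNum 0) ;; rep 52 (Branch
     (not_e (NLt (NVar 5) (NBin NAdd (NBin NAdd (NVar 6) (NVar 6)) (NNum 2))))
     (NSet 6 (NBin NAdd (NVar 6) (NNum 1))) skip)"

definition next_block_e :: nexp where
  "next_block_e = NSum 11 (not_e (NLt
     (NBin NAdd (NVar 7) (NBin NAdd (NVar 7) (NBin NAdd (NVar 7) (NNum 3))))
     (NBin NAdd (NVar 11) (NBin NAdd (NVar 11) (NNum 2)))))"

definition decode_p :: stm where
  "decode_p = half_p ;; Branch (NLt (NBin NAdd (NVar 6) (NVar 6)) (NVar 5))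
     (RSet 1 (RBin RMul (RNum (4/5)) (RVar 1)))
     (NSet 7 next_block_e ;;
      For 10 (RPut 2 (NVar 10) (RIf (NLt (NVar 10) (NVar 7)) (RGet 2 (NVar 10)) (RVar 1)))) ;;
     NSet 5 (NVar 6)"

definition code_p :: stm where
  "code_p = NSet 5 (NVar 4) ;; NSet 7 (NNum 0) ;; RSet 1 (RVar 0) ;;
     For 10 (RPut 2 (NVar 10) (RVar 0)) ;; rep 6 decode_p ;;
     RSet 3 (RNum 0) ;; rep 11 round_p"

definition size_e :: rexp where "size_e = RSum 10 (RNum 1)"

definition power8_e :: "rexp \<Rightarrow> rexp" where
  "power8_e e = (let e2 = RBin RMul e e; e4 = RBin RMul e2 e2 in RBin RMul e4 e4)"

definition pair_p :: stm where
  "pair_p = RSet 0 (dist_e (NVar 2) (NVar 3)) ;;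
     RSet 2 (RBin RDiv (RBin RMul (RGet 1 (NNum 0)) (RVar 0)) (power8_e size_e)) ;;
     NSet 4 (NNum 0) ;; rep 52 (code_p ;; NSet 4 (NBin NAdd (NVar 4) (NNum 1)))"

text \<open>The initial output has the centers 0 to k - 1 and sends every client to 0; its bound is
  the proxy value for zero thresholds.\<close>

definition okm_p :: stm where
  "okm_p = For 10 (NPut 0 (NVar 10) (NVar 10)) ;;
     RSet 4 (RBin RMul (RGet 1 (NNum 0)) (RSum 10 (dist_e (NNum 0) (NVar 10)))) ;;
     For 2 (For 3 pair_p)"

lemma wf_exp [simp]:
  "rwf (dist_e i j) \<longleftrightarrow> nwf i \<and> nwf j" "rwf gap_e" "x < 40 \<Longrightarrow> y < 40 \<Longrightarrow> rwf (edge_e x y)"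
  "x < 40 \<Longrightarrow> nwf (opened_e x)" "nwf frozen_e" "nwf conflict_e" "nwf (count_e a)" "rwf proxy_e"
  "x < 40 \<Longrightarrow> nwf (unmatched_e x)" "nwf window_e" "nwf next_block_e" "rwf size_e"
  by (auto simp: dist_e_def gap_e_def edge_e_def opened_e_def frozen_e_def conflict_e_def count_e_def
      proxy_e_def unmatched_e_def window_e_def next_block_e_def size_e_def Let_def)

lemma swf_okm_p: "swf okm_p"
  by (simp add: okm_p_def pair_p_def code_p_def decode_p_def half_p_def round_p_def window_p_def
      consider_p_def centers_p_def emit_p_def nearest_p_def primal_dual_p_def select_p_def raise_p_def
      power8_e_def Let_def)

section \<open>Frame conditions of the subprograms\<close>

lemma keeps_centers [simp]:
  "keeps_n centers_p x \<longleftrightarrow> x \<notin> {9, 10}" "keeps_r centers_p x"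
  "keeps_na centers_p x \<longleftrightarrow> x \<noteq> 0" "keeps_ra centers_p x"
  by (auto simp: centers_p_def emit_p_def)

lemma keeps_nearest [simp]:
  "keeps_n (nearest_p a b) x \<longleftrightarrow> x \<notin> {9, 10, 11}" "keeps_r (nearest_p a b) x"
  "keeps_na (nearest_p a b) x \<longleftrightarrow> x \<noteq> b" "keeps_ra (nearest_p a b) x"
  by (auto simp: nearest_p_def)

lemma keeps_consider [simp]:
  "keeps_n consider_p x \<longleftrightarrow> x \<notin> {9, 10, 11}" "keeps_r consider_p x \<longleftrightarrow> x \<noteq> 4"
  "keeps_na consider_p x \<longleftrightarrow> x \<notin> {0, 1, 5}" "keeps_ra consider_p x"
  by (auto simp: consider_p_def)

lemma keeps_window [simp]:
  "keeps_n window_p x \<longleftrightarrow> x \<notin> {8, 9, 10, 11}" "keeps_r window_p x \<longleftrightarrow> x \<noteq> 4"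
  "keeps_na window_p x \<longleftrightarrow> x \<notin> {0, 1, 4, 5}" "keeps_ra window_p x"
  by (auto simp: window_p_def)

lemma keeps_raise [simp]:
  "keeps_n raise_p x \<longleftrightarrow> x \<noteq> 10" "keeps_r raise_p x"
  "keeps_na raise_p x" "keeps_ra raise_p x \<longleftrightarrow> x \<notin> {3, 4}"
  by (auto simp: raise_p_def)

lemma keeps_primal_dual [simp]:
  "keeps_n primal_dual_p x \<longleftrightarrow> x \<noteq> 10" "keeps_r primal_dual_p x"
  "keeps_na primal_dual_p x \<longleftrightarrow> x \<noteq> 2" "keeps_ra primal_dual_p x \<longleftrightarrow> x \<notin> {3, 4}"
  by (auto simp: primal_dual_p_def select_p_def)

lemma keeps_round [simp]:
  "keeps_n round_p x \<longleftrightarrow> x \<notin> {8, 9, 10, 11}" "keeps_r round_p x \<longleftrightarrow> x \<notin> {3, 4}"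
  "keeps_na round_p x \<longleftrightarrow> x \<notin> {0, 1, 2, 3, 4, 5, 6}" "keeps_ra round_p x \<longleftrightarrow> x \<notin> {3, 4}"
  by (auto simp: round_p_def)

lemma keeps_half [simp]:
  "keeps_n half_p x \<longleftrightarrow> x \<notin> {6, 9}" "keeps_r half_p x" "keeps_na half_p x" "keeps_ra half_p x"
  by (auto simp: half_p_def)

lemma keeps_decode [simp]:
  "keeps_n decode_p x \<longleftrightarrow> x \<notin> {5, 6, 7, 9, 10}" "keeps_r decode_p x \<longleftrightarrow> x \<noteq> 1"
  "keeps_na decode_p x" "keeps_ra decode_p x \<longleftrightarrow> x \<noteq> 2"
  by (auto simp: decode_p_def)

lemma keeps_code [simp]:
  "keeps_n code_p x \<longleftrightarrow> x \<notin> {5, 6, 7, 8, 9, 10, 11}" "keeps_r code_p x \<longleftrightarrow> x \<notin> {1, 3, 4}"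
  "keeps_na code_p x \<longleftrightarrow> x \<notin> {0, 1, 2, 3, 4, 5, 6}" "keeps_ra code_p x \<longleftrightarrow> x \<notin> {2, 3, 4}"
  by (auto simp: code_p_def)

lemma keeps_pair [simp]: "keeps_n pair_p x \<longleftrightarrow> x \<notin> {4, 5, 6, 7, 8, 9, 10, 11}"
  by (auto simp: pair_p_def)

section \<open>Correctness of the program\<close>

definition members :: "nat \<Rightarrow> nat \<Rightarrow> state \<Rightarrow> nat set" where
  "members n a s = {i. i < n \<and> 0 < narr s a i}"

lemma opened_cong: "(\<And>j. j < n \<Longrightarrow> \<alpha> j = \<beta> j) \<Longrightarrow> opened n h lam \<alpha> = opened n h lam \<beta>"
  by (auto simp: opened_def fun_eq_iff)

lemma frozen_cong:
  "(\<And>j. j < n \<Longrightarrow> \<alpha> j = \<beta> j) \<Longrightarrow> j < n \<Longrightarrow> frozen n h lam \<alpha> j = frozen n h lam \<beta> j"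
  using opened_cong[of n \<alpha> \<beta> h lam] by (auto simp: frozen_def)

lemma conflict_cong: "(\<And>j. j < n \<Longrightarrow> \<alpha> j = \<beta> j) \<Longrightarrow> conflict n h u \<alpha> = conflict n h u \<beta>"
  by (auto simp: conflict_def fun_eq_iff)

locale okm =
  fixes n k :: nat and c :: "nat \<Rightarrow> nat \<Rightarrow> real" and w :: "nat \<Rightarrow> real"
  assumes inst: "okm_instance n k c w" and k0: "0 < k"
begin

lemma kn: "k < n" using inst by (simp add: okm_instance_def)

lemma c_nonneg: "0 \<le> c i j"
  using inst Metric_space.nonneg by (auto simp: okm_instance_def)

definition inp :: "state \<Rightarrow> bool" where
  "inp s \<longleftrightarrow> nreg s 0 = n \<and> nreg s 1 = k \<and>
     rarr s 0 = (\<lambda>m. if m < n * n then c (m div n) (m mod n) else 0) \<and>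
     rarr s 1 = (\<lambda>m. if m < n then w m else 0)"

lemma inp_nreg [simp]:
  "f 0 = nreg s 0 \<Longrightarrow> f (Suc 0) = nreg s (Suc 0) \<Longrightarrow> inp (s\<lparr>nreg := f\<rparr>) = inp s"
  by (simp add: inp_def)

lemma inp_narr [simp]: "inp (s\<lparr>narr := f\<rparr>) = inp s"
  by (simp add: inp_def)

lemma inp_sem [simp]:
  "inp s \<Longrightarrow> keeps_n p 0 \<Longrightarrow> keeps_n p 1 \<Longrightarrow> keeps_ra p 0 \<Longrightarrow> keeps_ra p 1 \<Longrightarrow> inp (sem p s)"
  by (simp add: inp_def)

lemma inp_same:
  "inp s \<Longrightarrow> same N R A B s s' \<Longrightarrow> {0, 1} \<inter> N = {} \<Longrightarrow> {0, 1} \<inter> B = {} \<Longrightarrow> inp s'"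
  by (simp add: inp_def same_def)

text \<open>Naturals cannot be multiplied, so the row offset n * a is the sum of n copies of a over
  register 15.\<close>

lemma dist_val:
  assumes "inp s" "\<And>m. nval i (setn 15 m s) = a" "nval j s = b" "a < n" "b < n"
  shows "rval (dist_e i j) s = c a b"
proof -
  have "n * a + b < n * Suc a" using assms(5) by simp
  also have "\<dots> \<le> n * n" using assms(4) by (intro mult_le_mono) auto
  finally show ?thesis using assms by (simp add: dist_e_def inp_def nval.simps(5))
qed

lemma gap_val: "inp s \<Longrightarrow> nreg s 13 < n \<Longrightarrow> rval gap_e s = gap n w (nreg s 13)"
  by (simp add: gap_e_def gap_def inp_def)

lemma inp_w: "inp s \<Longrightarrow> l < n \<Longrightarrow> rarr s (Suc 0) l = w l"
  by (simp add: inp_def)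

lemma inp_n [simp]: "inp s \<Longrightarrow> nreg s 0 = n" and inp_k [simp]: "inp s \<Longrightarrow> nreg s (Suc 0) = k"
  by (auto simp: inp_def)

abbreviation edge :: "state \<Rightarrow> nat \<Rightarrow> nat \<Rightarrow> real" where
  "edge s \<equiv> edge_cost n c w (rarr s 2)"

lemma edge_val:
  assumes "inp s" "nreg s x < n" "nreg s y < n" "x \<notin> {13, 15}" "y \<notin> {13, 15}"
  shows "rval (edge_e x y) s = edge s (nreg s x) (nreg s y)"
proof -
  have "rval (dist_e (NVar x) (NVar y)) (setn 13 m s) = c (nreg s x) (nreg s y)" for m
    by (rule dist_val) (use assms in auto)
  then show ?thesis using assms
    by (auto simp: edge_e_def thr_cost_def gap_val intro!: sum.cong)
qed

lemma opened_val:
  assumes "inp s" "nreg s x < n" "x \<notin> {12, 13, 15}"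
  shows "0 < nval (opened_e x) s \<longleftrightarrow> opened n (edge s) (rreg s 3) (rarr s 3) (nreg s x)"
proof -
  have "rval (edge_e x 12) (setn 12 m s) = edge s (nreg s x) m" if "m < n" for m
    using edge_val[of "setn 12 m s" x 12] assms that by simp
  then show ?thesis using assms by (simp add: opened_e_def opened_def not_less)
qed

lemma frozen_val:
  assumes "inp s" "nreg s 10 < n"
  shows "0 < nval frozen_e s \<longleftrightarrow> frozen n (edge s) (rreg s 3) (rarr s 3) (nreg s 10)"
proof -
  have "rval (edge_e 11 10) (setn 11 m s) = edge s m (nreg s 10)" if "m < n" for m
    using edge_val[of "setn 11 m s" 11 10] assms that by simp
  moreover have "0 < nval (opened_e 11) (setn 11 m s) \<longleftrightarrow> opened n (edge s) (rreg s 3) (rarr s 3) m"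
    if "m < n" for m
    using opened_val[of "setn 11 m s" 11] assms that by simp
  ultimately show ?thesis using assms by (auto simp: frozen_e_def frozen_def  not_less)
qed

lemma conflict_val:
  assumes "inp s" "nreg s 10 < n" "nreg s 11 < n"
  shows "0 < nval conflict_e s \<longleftrightarrow> conflict n (edge s) (rreg s 2) (rarr s 3) (nreg s 10) (nreg s 11)"
proof -
  have "rval (edge_e x 14) (setn 14 m s) = edge s (nreg s x) m" if "m < n" "x \<in> {10, 11}" for m x
    using edge_val[of "setn 14 m s" x 14] assms that by auto
  then show ?thesis using assms by (auto simp: conflict_e_def conflict_def)
qed

lemma raise_p_val:
  assumes "inp s" "j < n"
  shows "rarr (sem raise_p s) 3 j = raise n (edge s) (rreg s 3) (rreg s 2) (rarr s 3) j"
proof -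
  let ?e = "RIf frozen_e (RGet 3 (NVar 10)) (RBin RAdd (RGet 3 (NVar 10)) (RVar 2))" and ?q = "For 10 (RPut 3 (NVar 10) (RGet 4 (NVar 10)))"
  let ?r = "raise n (edge s) (rreg s 3) (rreg s 2) (rarr s 3)"
  let ?p = "For 10 (RPut 4 (NVar 10) ?e)"
  have 1: "rarr (sem ?p s) 4 i = (if i < nreg s 0 then ?r i else rarr s 4 i)" for i
  proof (rule For_RPut)
    fix s' m assume h: "m < nreg s 0" "same {10} {} {} {4} s s'" "nreg s' 10 = m"
    have "inp s'" using inp_same[OF assms(1) h(2)] by simp
    then show "rval ?e s'
        = ?r m"
      using h assms frozen_val[of s'] by (simp add: same_def raise_def)
  qed simp
  let ?s1 = "sem ?p s"
  have "rarr (sem (?q) ?s1) 3 j =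
    (if j < nreg ?s1 0 then rarr ?s1 4 j else rarr ?s1 3 j)"
    by (rule For_RPut) (auto simp: same_def)
  moreover have "nreg ?s1 0 = n" using assms by (subst keeps_n) auto
  ultimately have "rarr (sem (?q) ?s1) 3 j = rarr ?s1 4 j"
    using assms by simp
  then show ?thesis using 1 assms unfolding raise_p_def sem.simps(5) by (simp del: sem.simps(7))
qed

text \<open>Of two conflicting facilities the later one is rejected, as \<open>conflict\<close> is
  symmetric, and every rejected opened facility conflicts with an earlier selected one.\<close>

lemma select_p_spec:
  assumes s: "inp s"
  shows "selection n (edge s) (rreg s 3) (rreg s 2) (rarr s 3) (members n 2 (sem select_p s))"
proof -
  let ?e = "and_e (opened_e 10)
       (not_e (NSum 11 (and_e (NLt (NVar 11) (NVar 10)) (and_e (NGet 2 (NVar 11)) conflict_e))))"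
  let ?op = "opened n (edge s) (rreg s 3) (rarr s 3)" and ?cf = "conflict n (edge s) (rreg s 2) (rarr s 3)"
  define P where "P = (\<lambda>m s'. same {10} {} {2} {} s s' \<and>
    (\<forall>x<m. 0 < narr s' 2 x \<longleftrightarrow> ?op x \<and> \<not> (\<exists>y<x. 0 < narr s' 2 y \<and> ?cf x y)))"
  have "P n (sem select_p s)"
    unfolding select_p_def
  proof (rule For_rule)
    fix m s' assume m: "m < n" and P: "P m s'"
    let ?s = "setn 10 m s'"
    have sm: "same {10} {} {2} {} s ?s" using P by (auto simp: P_def same_def)
    have i: "inp ?s" using inp_same[OF s sm] by simp
    have eq: "rarr s' = rarr s" "rreg s' = rreg s" using P by (auto simp: P_def same_def)
    have "0 < nval (opened_e 10) ?s \<longleftrightarrow> ?op m"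
      using opened_val[OF i] m eq by simp
    moreover have "0 < nval conflict_e (setn 11 y ?s) \<longleftrightarrow> ?cf m y" if "y < n" for y
      using conflict_val[of "setn 11 y ?s"] i that m eq by simp
    moreover from this have "nval conflict_e (setn 11 y ?s) = 0 \<longleftrightarrow> \<not> ?cf m y" if "y < n" for y
      using that by (metis neq0_conv)
    ultimately have v: "0 < nval ?e ?s
        \<longleftrightarrow> ?op m \<and> \<not> (\<exists>y<m. 0 < narr s' 2 y \<and> ?cf m y)"
      using i m by auto
    show "P (Suc m) (sem (NPut 2 (NVar 10) ?e) ?s)"
      using P v unfolding P_def by (auto simp: same_def less_Suc_eq simp del: and_e_val)
  qed (use s in \<open>auto simp: P_def same_def\<close>)
  then have sel: "0 < narr (sem select_p s) 2 x \<longleftrightarrow>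
      ?op x \<and> \<not> (\<exists>y<x. 0 < narr (sem select_p s) 2 y \<and> ?cf x y)" if "x < n" for x
    using that by (auto simp: P_def)
  have sym: "?cf x y = ?cf y x" for x y by (auto simp: conflict_def)
  show ?thesis unfolding selection_def members_def
  proof (intro conjI ballI allI impI)
    fix i i' assume "i \<in> {i. i < n \<and> 0 < narr (sem select_p s) 2 i}"
      "i' \<in> {i. i < n \<and> 0 < narr (sem select_p s) 2 i}" "i \<noteq> i'"
    then show "\<not> ?cf i i'" using sel[of i] sel[of i'] sym
      by (metis (mono_tags, lifting) linorder_neqE_nat mem_Collect_eq)
  next
    fix i assume "i < n" "?op i"
    then show "i \<in> {i. i < n \<and> 0 < narr (sem select_p s) 2 i} \<or>
        (\<exists>i'\<in>{i. i < n \<and> 0 < narr (sem select_p s) 2 i}. ?cf i i')"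
      using sel[of i] by (auto intro: less_trans)
  qed (use sel in auto)
qed

lemma primal_dual_p_spec:
  assumes s: "inp s"
  shows "selection n (edge s) (rreg s 3) (rreg s 2) (dual n (edge s) (rreg s 3) (rreg s 2) (n ^ 11))
    (members n 2 (sem primal_dual_p s))"
proof -
  let ?p0 = "For 10 (RPut 3 (NVar 10) (RNum 0))"
  let ?s0 = "sem ?p0 s"
  let ?s1 = "sem (rep 11 raise_p) ?s0"
  have s0: "inp ?s0" using s by (intro inp_sem) auto
  have z: "rarr ?s0 3 j = 0" if "j < n" for j
    using For_RPut[where x=10 and a=3 and e="RNum 0" and s=s and f="\<lambda>_. 0" and i=j] that s by simp
  define P where "P = (\<lambda>t s'. inp s' \<and> rreg s' = rreg s \<and> rarr s' 2 = rarr s 2 \<and>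
    (\<forall>j<n. rarr s' 3 j = dual n (edge s) (rreg s 3) (rreg s 2) t j))"
  have "P (n ^ 11) ?s1"
  proof (rule rep_rule)
    have "rreg ?s0 = rreg s" by (intro ext keeps_r) auto
    moreover have "rarr ?s0 2 = rarr s 2" by (intro keeps_ra) auto
    ultimately show "P 0 ?s0" using s0 z by (simp add: P_def dual_def)
    show "nreg ?s0 0 = n" using s0 by simp
    fix t s' assume P: "P t s'"
    have r: "rreg (sem raise_p s') = rreg s" using P by (auto simp: P_def fun_eq_iff)
    have "rarr (sem raise_p s') 3 j = dual n (edge s) (rreg s 3) (rreg s 2) (Suc t) j" if "j < n" for j
    proof -
      have "frozen n (edge s) (rreg s 3) (rarr s' 3) j =
          frozen n (edge s) (rreg s 3) (dual n (edge s) (rreg s 3) (rreg s 2) t) j"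
        using P that by (intro frozen_cong) (auto simp: P_def)
      then show ?thesis using raise_p_val[of s' j] P that by (simp add: P_def dual_def raise_def)
    qed
    then show "P (Suc t) (sem raise_p s')" using P r by (simp add: P_def)
  qed simp
  then have P: "inp ?s1" "rreg ?s1 = rreg s" "rarr ?s1 2 = rarr s 2"
    "\<And>j. j < n \<Longrightarrow> rarr ?s1 3 j = dual n (edge s) (rreg s 3) (rreg s 2) (n ^ 11) j"
    by (auto simp: P_def)
  show ?thesis
    using select_p_spec[OF P(1)] opened_cong[OF P(4)] conflict_cong[OF P(4)] P(2,3)
    by (simp add: selection_def primal_dual_p_def del: sem.simps(7))
qed

text \<open>No running minimum is kept: an index is written exactly if no member is strictly closer,
  so the last minimiser survives.\<close>

lemma nearest_p_spec:
  assumes s: "inp s" and W: "members n a s \<noteq> {}" and ab: "a \<noteq> b"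
  shows "nearest n c (members n a s) (narr (sem (nearest_p a b) s) b)"
proof -
  define W where "W = members n a s"
  define Q where "Q = (\<lambda>j i. i \<in> W \<and> (\<forall>i'\<in>W. c i j \<le> c i' j))"
  define P where "P = (\<lambda>m s'. same {10, 11} {} {b} {} s s' \<and> (\<forall>j<m. Q j (narr s' b j)))"
  have "finite W" by (simp add: W_def members_def)
  then have ex: "\<exists>i. Q j i" if "j < n" for j
    using exists_nearest[of W n c] W that by (force simp: Q_def nearest_def W_def)
  have Wn: "i \<in> W \<Longrightarrow> i < n" for i by (simp add: W_def members_def)
  let ?b = "and_e (NGet a (NVar 11)) (not_e (NSum 12
       (and_e (NGet a (NVar 12)) (RLt (dist_e (NVar 12) (NVar 10)) (dist_e (NVar 11) (NVar 10))))))"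
  let ?body = "Branch ?b (NPut b (NVar 10) (NVar 11)) skip"
  have "P n (sem (nearest_p a b) s)"
    unfolding nearest_p_def
  proof (rule For_rule)
    fix m s1 assume m: "m < n" and P1: "P m s1"
    define P' where "P' = (\<lambda>m' s'. P m s' \<and> nreg s' 10 = m \<and> ((\<exists>i<m'. Q m i) \<longrightarrow> Q m (narr s' b m)))"
    have "P' n (sem (For 11 ?body) (setn 10 m s1))"
    proof (rule For_rule)
      fix m' s2 assume m': "m' < n" and P': "P' m' s2"
      let ?s = "setn 11 m' s2"
      have sm: "same {10, 11} {} {b} {} s ?s" using P' by (auto simp: P'_def P_def same_def)
      have i: "inp ?s" using inp_same[OF s sm] by simp
      have na: "narr s2 a = narr s a" using sm ab by (simp add: same_def)
      have d: "rval (dist_e (NVar 11) (NVar 10)) (setn 12 y ?s) = c m' m" for y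
        by (rule dist_val) (use i m m' P' in \<open>auto simp: P'_def\<close>)
      have d': "rval (dist_e (NVar 12) (NVar 10)) (setn 12 y ?s) = c y m" if "y < n" for y
        by (rule dist_val) (use i m m' P' that in \<open>auto simp: P'_def\<close>)
      have v: "0 < nval ?b ?s \<longleftrightarrow> Q m m'"
        using i m' na d d' by (auto simp: Q_def W_def members_def)
      show "P' (Suc m') (sem ?body ?s)"
      proof (cases "Q m m'")
        case True
        then show ?thesis using P' v unfolding P'_def P_def by (auto simp: same_def simp del: and_e_val)
      next
        case False
        then show ?thesis using P' v unfolding P'_def P_def
          by (auto simp: same_def less_Suc_eq simp del: and_e_val)
      qed
    qed (use P1 s in \<open>auto simp: P'_def P_def same_def\<close>)
    then show "P (Suc m) (sem (For 11 ?body) (setn 10 m s1))"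
      using ex[OF m] unfolding P'_def P_def by (metis Wn less_Suc_eq Q_def)
  qed (use s in \<open>auto simp: P_def same_def\<close>)
  then show ?thesis by (auto simp: P_def nearest_def Q_def W_def)
qed

end

lemma sum_of_bool_card: "(\<Sum>m<(n::nat). of_bool (P m) :: nat) = card {m. m < n \<and> P m}"
  by (simp add: Collect_conj_eq lessThan_def)

lemma okm_cost_cong: "(\<And>j. j < n \<Longrightarrow> \<sigma> j = \<sigma>' j) \<Longrightarrow> okm_cost n c w \<sigma> = okm_cost n c w \<sigma>'"
  unfolding okm_cost_def ordered_cost_def sorted_desc_def
  by (metis (mono_tags, lifting) atLeastLessThan_iff list.map_cong0 set_upt)

lemma bij_betw_fun_upd:
  assumes "bij_betw f {..<q} D" "x \<notin> D"
  shows "bij_betw (f(q := x)) {..<Suc q} (insert x D)"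
proof -
  have "bij_betw (f(q := x)) {..<q} D"
    using assms(1) by (rule bij_betw_cong[THEN iffD1, rotated]) auto
  then show ?thesis
    using assms(2) notIn_Un_bij_betw[of q "{..<q}" "f(q := x)" D] by (simp add: lessThan_Suc)
qed

context okm
begin

section \<open>Candidate sets and the output\<close>

lemma count_val: "inp s \<Longrightarrow> nval (count_e a) s = card (members n a s)"
  by (simp add: count_e_def nval.simps(5) sum_of_bool_card members_def flip: of_bool_def)

lemma proxy_val:
  assumes s: "inp s" and a: "\<And>j. j < n \<Longrightarrow> narr s 5 j < n"
  shows "rval proxy_e s = proxy_cost n w (\<lambda>l. 9 * rarr s 2 l) (\<lambda>j. c (narr s 5 j) j)"
proof -
  have d: "rval (dist_e (NGet 5 (NVar 12)) (NVar 12)) (s\<lparr>nreg := (nreg s)(13 := l, 12 := j)\<rparr>)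
      = c (narr s 5 j) j" if "j < n" for j l
    by (rule dist_val) (use s a that in auto)
  have r: "(\<Sum>j<n. if l < j then 0 else 9 * rarr s 2 l) = real (Suc l) * (9 * rarr s 2 l)" if "l < n" for l
  proof -
    have "(\<Sum>j<n. if l < j then 0 else 9 * rarr s 2 l) = (\<Sum>j\<in>{..l}. 9 * rarr s 2 l)"
      by (rule sum.mono_neutral_cong_right) (use that in auto)
    then show ?thesis by simp
  qed
  show ?thesis using s d r gap_val
    by (auto simp: proxy_e_def proxy_cost_def intro!: sum.cong cong: if_cong)
qed

lemma centers_p_spec:
  assumes s: "inp s" and W: "card (members n 4 s) \<le> k"
  shows "output_centers k (sem centers_p s) \<subseteq> {..<n}" "card (output_centers k (sem centers_p s)) = k"
    "members n 4 s \<subseteq> output_centers k (sem centers_p s)"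
proof -
  let ?W = "members n 4 s"
  let ?b = "Branch (and_e (not_e (NGet 4 (NVar 10))) (NLt (NVar 9) (NVar 1))) emit_p skip"
  have emit: "sem emit_p s' = s'\<lparr>narr := (narr s')(0 := (narr s' 0)(nreg s' 9 := nreg s' 10)),
      nreg := (nreg s')(9 := Suc (nreg s' 9))\<rparr>" for s'
    by (simp add: emit_p_def)
  have fW: "finite ?W" by (simp add: members_def)
  define P where "P = (\<lambda>m s'. inp s' \<and> narr s' 4 = narr s 4 \<and>
    bij_betw (narr s' 0) {..<nreg s' 9} {x \<in> ?W. x < m})"
  define P' where "P' = (\<lambda>m s'. inp s' \<and> narr s' 4 = narr s 4 \<and> nreg s' 9 \<le> k \<and>
    (\<exists>D. bij_betw (narr s' 0) {..<nreg s' 9} D \<and> ?W \<subseteq> D \<and> D \<subseteq> {..<n} \<and> D \<subseteq> ?W \<union> {..<m} \<and>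
      (nreg s' 9 = k \<or> {..<m} \<subseteq> D)))"
  let ?s0 = "sem (NSet 9 (NNum 0)) s"
  let ?p1 = "For 10 (Branch (NGet 4 (NVar 10)) emit_p skip)"
  let ?p2 = "For 10 ?b"
  have "P n (sem ?p1 ?s0)"
  proof (rule For_rule)
    show "nreg ?s0 0 = n" using s by simp
    show "P 0 ?s0" using s by (simp add: P_def bij_betw_def)
    fix m s' assume m: "m < n" and P: "P m s'"
    show "P (Suc m) (sem (Branch (NGet 4 (NVar 10)) emit_p skip) (setn 10 m s'))"
    proof (cases "m \<in> ?W")
      case True
      have "{x \<in> ?W. x < Suc m} = insert m {x \<in> ?W. x < m}" using True by auto
      then have "bij_betw ((narr s' 0)(nreg s' 9 := m)) {..<Suc (nreg s' 9)} {x \<in> ?W. x < Suc m}"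
        using P bij_betw_fun_upd[of "narr s' 0" "nreg s' 9" "{x \<in> ?W. x < m}" m] by (simp add: P_def)
      then show ?thesis using P True by (simp add: P_def emit members_def)
    next
      case False
      then have "{x \<in> ?W. x < Suc m} = {x \<in> ?W. x < m}" by (auto simp: less_Suc_eq)
      then show ?thesis using P False m by (simp add: P_def members_def)
    qed
  qed
  moreover have "{x \<in> ?W. x < n} = ?W" by (auto simp: members_def)
  ultimately have 1: "inp (sem ?p1 ?s0)" "narr (sem ?p1 ?s0) 4 = narr s 4"
    "bij_betw (narr (sem ?p1 ?s0) 0) {..<nreg (sem ?p1 ?s0) 9} ?W"
    by (auto simp: P_def simp del: sem.simps)
  have "P' n (sem ?p2 (sem ?p1 ?s0))"
  proof (rule For_rule)
    show "nreg (sem ?p1 ?s0) 0 = n" using 1(1) by (rule inp_n)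
    show "P' 0 (sem ?p1 ?s0)"
      using 1 W bij_betw_same_card[OF 1(3)] unfolding P'_def by (auto simp: members_def simp del: sem.simps)
    fix m s' assume m: "m < n" and P: "P' m s'"
    then obtain D where D: "bij_betw (narr s' 0) {..<nreg s' 9} D" "?W \<subseteq> D" "D \<subseteq> {..<n}"
      "D \<subseteq> ?W \<union> {..<m}" "nreg s' 9 = k \<or> {..<m} \<subseteq> D" unfolding P'_def by blast
    have P: "inp s'" "narr s' 4 = narr s 4" "nreg s' 9 \<le> k" using P by (auto simp: P'_def)
    show "P' (Suc m) (sem ?b (setn 10 m s'))"
    proof (cases "m \<notin> ?W \<and> nreg s' 9 < k")
      case True
      have "m \<notin> D" using D(4) True by auto
      then have b: "bij_betw ((narr s' 0)(nreg s' 9 := m)) {..<Suc (nreg s' 9)} (insert m D)"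
        by (rule bij_betw_fun_upd[OF D(1)])
      have "{..<m} \<subseteq> D" using D(5) True by auto
      then have sub: "?W \<subseteq> insert m D" "insert m D \<subseteq> {..<n}" "insert m D \<subseteq> ?W \<union> {..<Suc m}"
        "{..<Suc m} \<subseteq> insert m D"
        using D m by (auto simp: less_Suc_eq)
      have "\<not> 0 < narr s' 4 m" using P(2) True m by (simp add: members_def)
      then have e: "sem ?b (setn 10 m s')
          = sem emit_p (setn 10 m s')"
        using P(1) True by simp
      show ?thesis unfolding P'_def e
      proof (intro conjI exI[of _ "insert m D"] disjI2)
        show "inp (sem emit_p (setn 10 m s'))" using P(1) by (simp add: emit)
        show "narr (sem emit_p (setn 10 m s')) 4 = narr s 4" using P(2) by (simp add: emit)
        show "nreg (sem emit_p (setn 10 m s')) 9 \<le> k" using True by (simp add: emit)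
        show "bij_betw (narr (sem emit_p (setn 10 m s')) 0) {..<nreg (sem emit_p (setn 10 m s')) 9} (insert m D)"
          using b by (simp add: emit)
      qed (fact sub)+
    next
      case False
      then have "sem ?b (setn 10 m s') = setn 10 m s'"
        using P m by (auto simp: members_def)
      moreover have "?W \<subseteq> D \<and> D \<subseteq> {..<n} \<and> D \<subseteq> ?W \<union> {..<Suc m} \<and> (nreg s' 9 = k \<or> {..<Suc m} \<subseteq> D)"
        using D False P by (auto simp: less_Suc_eq)
      ultimately show ?thesis using P D(1) by (simp add: P'_def) blast
    qed
  qed
  moreover have "sem ?p2 (sem ?p1 ?s0) = sem centers_p s" by (simp only: centers_p_def sem.simps(5))
  ultimately obtain D where D: "bij_betw (narr (sem centers_p s) 0) {..<nreg (sem centers_p s) 9} D"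
    "?W \<subseteq> D" "D \<subseteq> {..<n}" "nreg (sem centers_p s) 9 = k \<or> {..<n} \<subseteq> D" "nreg (sem centers_p s) 9 \<le> k"
    unfolding P'_def by auto
  \<comment> \<open>If the padding ended early, all n > k points would have been written.\<close>
  have "nreg (sem centers_p s) 9 = k"
  proof (rule ccontr)
    assume ne: "nreg (sem centers_p s) 9 \<noteq> k"
    then have "{..<n} \<subseteq> D" using D(4) by simp
    then have "n \<le> card D" using D(3) by (metis card_lessThan card_mono finite_lessThan finite_subset)
    also have "card D \<le> k" using bij_betw_same_card[OF D(1)] D(5) by simp
    finally show False using kn by simp
  qed
  then have "output_centers k (sem centers_p s) = D" "card D = k"
    using D(1) bij_betw_same_card[OF D(1)] by (auto simp: output_centers_def bij_betw_def)
  then show "output_centers k (sem centers_p s) \<subseteq> {..<n}" "card (output_centers k (sem centers_p s)) = k"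
    "?W \<subseteq> output_centers k (sem centers_p s)"
    using D by auto
qed

text \<open>Real register 4 is a certified bound on the current output, whatever the guesses. Only
  the proof that it becomes small refers to good guesses.\<close>

definition Inv :: "state \<Rightarrow> bool" where
  "Inv s \<longleftrightarrow> inp s \<and> okm_feasible n k (output_centers k s) (output_assignment s) \<and>
     okm_cost n c w (output_assignment s) \<le> rreg s 4"

lemma Inv_inp: "Inv s \<Longrightarrow> inp s" by (simp add: Inv_def)

lemma Inv_nreg [simp]:
  "f 0 = nreg s 0 \<Longrightarrow> f (Suc 0) = nreg s (Suc 0) \<Longrightarrow> Inv (s\<lparr>nreg := f\<rparr>) = Inv s"
  by (simp add: Inv_def output_centers_def output_assignment_def)

lemma Inv_sem:
  assumes "Inv s" "keeps_n p 0" "keeps_n p 1" "keeps_ra p 0" "keeps_ra p 1" "keeps_na p 0" "keeps_na p 1"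
    "keeps_r p 4"
  shows "Inv (sem p s)"
  using assms inp_sem[OF _ assms(2-5)] by (simp add: Inv_def output_centers_def output_assignment_def)

lemma consider_p_spec:
  assumes s: "Inv s"
  shows "Inv (sem consider_p s)" "rreg (sem consider_p s) 4 \<le> rreg s 4"
    "good_set n k c w (rarr s 2) B (members n 4 s) \<Longrightarrow> rreg (sem consider_p s) 4 \<le> B"
proof -
  let ?W = "members n 4 s"
  let ?s1 = "sem (nearest_p 4 5) s"
  let ?guard = "and_e (count_e 4) (not_e (NLt (NVar 1) (count_e 4)))"
  let ?U = "proxy_cost n w (\<lambda>l. 9 * rarr s 2 l) (\<lambda>j. c (narr ?s1 5 j) j)"
  have i: "inp s" using s by (rule Inv_inp)
  have fW: "finite ?W" by (simp add: members_def)
  have guard: "0 < nval ?guard s \<longleftrightarrow> ?W \<noteq> {} \<and> card ?W \<le> k"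
    using i count_val[OF i] fW by (auto simp: card_gt_0_iff simp del: neq0_conv)
  have "Inv (sem consider_p s) \<and> rreg (sem consider_p s) 4 \<le> rreg s 4 \<and>
    (good_set n k c w (rarr s 2) B ?W \<longrightarrow> rreg (sem consider_p s) 4 \<le> B)"
  proof (cases "?W \<noteq> {} \<and> card ?W \<le> k")
    case False
    then have "\<not> 0 < nval ?guard s" using guard by blast
    then have "sem consider_p s = s" by (simp only: consider_p_def sem.simps(6) if_False skip_sem)
    then show ?thesis using s False by (auto simp: good_set_def)
  next
    case True
    have near: "nearest n c ?W (narr ?s1 5)" using nearest_p_spec[OF i] True by simp
    have i1: "inp ?s1" using i by simp
    have I1: "Inv ?s1" using s by (intro Inv_sem) auto
    have "narr ?s1 5 j < n" if "j < n" for j using near that by (auto simp: nearest_def members_def)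
    then have U: "rval proxy_e ?s1 = ?U" using proxy_val[OF i1] by simp
    have good: "good_set n k c w (rarr s 2) B ?W \<Longrightarrow> ?U \<le> B" using near by (simp add: good_set_def)
    let ?upd = "RSet 4 proxy_e ;; centers_p ;; For 10 (NPut 1 (NVar 10) (NGet 5 (NVar 10)))"
    have sem: "sem consider_p s = (if ?U < rreg s 4 then sem ?upd ?s1 else ?s1)"
    proof -
      have e1: "sem consider_p s = sem (Branch (RLt proxy_e (RVar 4)) ?upd skip) ?s1"
        by (subst consider_p_def, subst sem.simps(6))
          (simp only: guard True if_True simp_thms sem.simps(5)[of "nearest_p 4 5"])
      have e2: "0 < nval (RLt proxy_e (RVar 4)) ?s1 \<longleftrightarrow> ?U < rreg s 4" using U by simp
      show ?thesis by (subst e1, subst sem.simps(6)) (simp only: e2 skip_sem)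
    qed
    show ?thesis
    proof (cases "?U < rreg s 4")
      case False
      then show ?thesis using sem I1 good by auto
    next
      case lt: True
      let ?s2 = "sem (RSet 4 proxy_e) ?s1"
      let ?s3 = "sem centers_p ?s2"
      let ?s4 = "sem (For 10 (NPut 1 (NVar 10) (NGet 5 (NVar 10)))) ?s3"
      have i2: "inp ?s2" by (rule inp_sem[OF i1]) auto
      have i3: "inp ?s3" by (rule inp_sem[OF i2]) auto
      have i4: "inp ?s4" by (rule inp_sem[OF i3]) auto
      have m2: "members n 4 ?s2 = ?W" by (simp add: members_def)
      note cen = centers_p_spec[OF i2, unfolded m2, OF conjunct2[OF True]]
      have s4: "sem consider_p s = ?s4" using sem lt by (simp only: if_True sem.simps(5))
      have a: "narr ?s4 1 j = narr ?s1 5 j" if "j < n" for j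
      proof -
        have "narr ?s4 1 j = (if j < nreg ?s3 0 then narr ?s3 5 j else narr ?s3 1 j)"
          by (rule For_NPut) (auto simp: same_def simp del: sem.simps)
        also have "\<dots> = narr ?s3 5 j" using i3 that by (simp del: sem.simps)
        also have "narr ?s3 5 = narr ?s2 5" by (intro keeps_na) auto
        finally show ?thesis by simp
      qed
      have "narr ?s4 0 = narr ?s3 0" by (intro keeps_na) auto
      then have c4: "output_centers k ?s4 = output_centers k ?s3" by (simp only: output_centers_def)
      have "rreg ?s4 4 = rreg ?s3 4" by (intro keeps_r) auto
      also have "\<dots> = rreg ?s2 4" by (intro keeps_r) auto
      also have "\<dots> = ?U" using U by simp
      finally have b4: "rreg ?s4 4 = ?U" .
      have "okm_cost n c w (output_assignment ?s4) = okm_cost n c w (narr ?s1 5)"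
        using a by (intro okm_cost_cong) (simp add: output_assignment_def del: sem.simps)
      also have "\<dots> \<le> ?U" unfolding okm_cost_def by (rule ordered_cost_le_proxy[OF inst])
      finally have cost: "okm_cost n c w (output_assignment ?s4) \<le> ?U" .
      have "output_assignment ?s4 j \<in> output_centers k ?s4" if "j < n" for j
        using near that cen(3) a[OF that] unfolding c4 output_assignment_def nearest_def by auto
      then have "okm_feasible n k (output_centers k ?s4) (output_assignment ?s4)"
        using cen(1,2) unfolding okm_feasible_def c4 by blast
      then have "Inv ?s4" using i4 cost b4 unfolding Inv_def by simp
      then show ?thesis using b4 lt good unfolding s4 by simp
    qed
  qed
  then show "Inv (sem consider_p s)" "rreg (sem consider_p s) 4 \<le> rreg s 4"
    "good_set n k c w (rarr s 2) B (members n 4 s) \<Longrightarrow> rreg (sem consider_p s) 4 \<le> B" by blast+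
qed

lemma unmatched_val:
  assumes "inp s" "nreg s y < n" "y \<noteq> 14"
  shows "nval (unmatched_e y) s = of_bool (nreg s y \<in> members n 3 s - narr s 6 ` members n 2 s)"
proof -
  have e: "\<not> a < b \<and> \<not> b < a \<longleftrightarrow> a = b" for a b :: nat by auto
  have "0 < nval (unmatched_e y) s \<longleftrightarrow> 0 < narr s 3 (nreg s y) \<and>
      \<not> (\<exists>m<n. 0 < narr s 2 m \<and> \<not> narr s 6 m < nreg s y \<and> \<not> nreg s y < narr s 6 m)"
    using assms by (simp add: unmatched_e_def)
  then have "0 < nval (unmatched_e y) s \<longleftrightarrow> nreg s y \<in> members n 3 s - narr s 6 ` members n 2 s"
    unfolding e using assms by (auto simp: members_def image_iff)
  moreover have "nval (unmatched_e y) s = of_bool (0 < nval (unmatched_e y) s)"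
    by (simp only: unmatched_e_def and_e_val)  simp
  ultimately show ?thesis by simp
qed

lemma window_val:
  assumes s: "inp s" and x: "nreg s 10 < n"
  shows "nval window_e s =
    of_bool (nreg s 10 \<in> window k (members n 2 s) (members n 3 s) (narr s 6) (nreg s 8))"
proof -
  let ?X = "members n 3 s - narr s 6 ` members n 2 s"
  have u: "nval (unmatched_e 11) (setn 11 m s) = of_bool (m \<in> ?X)" if "m < n" for m
    using unmatched_val[of "setn 11 m s" 11] s that by (simp add: members_def)
  have N: "nval (NSum 11 (unmatched_e 11)) s = card ?X"
  proof -
    have "nval (NSum 11 (unmatched_e 11)) s = (\<Sum>m<n. of_bool (m \<in> ?X))"
      using s u by (simp add: nval.simps(5))
    also have "\<dots> = card {m. m < n \<and> m \<in> ?X}" by (rule sum_of_bool_card)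
    also have "{m. m < n \<and> m \<in> ?X} = ?X" by (auto simp: members_def)
    finally show ?thesis .
  qed
  have R: "nval (NSum 11 (and_e (NLt (NVar 11) (NVar 10)) (unmatched_e 11))) s = rank ?X (nreg s 10)"
  proof -
    have "nval (NSum 11 (and_e (NLt (NVar 11) (NVar 10)) (unmatched_e 11))) s =
        (\<Sum>m<n. of_bool (m < nreg s 10 \<and> m \<in> ?X))"
      using s u by (simp add: nval.simps(5))
    also have "\<dots> = card {m. m < n \<and> m < nreg s 10 \<and> m \<in> ?X}" by (rule sum_of_bool_card)
    also have "{m. m < n \<and> m < nreg s 10 \<and> m \<in> ?X} = {m \<in> ?X. m < nreg s 10}"
      by (auto simp: members_def)
    finally show ?thesis by (simp add: rank_def)
  qed
  have Q: "nval (NSum 11 (NLt (NNum 0) (NGet 3 (NVar 11)))) s = card (members n 3 s)"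
    using s by (simp add: nval.simps(5) sum_of_bool_card members_def)
  have x10: "nval (unmatched_e 10) s = of_bool (nreg s 10 \<in> ?X)"
    using unmatched_val[of s 10] s x by simp
  have F2: "nreg s 10 \<in> members n 3 s \<longleftrightarrow> 0 < narr s 3 (nreg s 10)" using x by (simp add: members_def)
  show ?thesis using s unfolding window_e_def window_def Let_def
    by (simp add: N R Q x10 F2 shift_def)
qed

lemma window_p_spec:
  assumes s: "Inv s"
  shows "Inv (sem window_p s)" "rreg (sem window_p s) 4 \<le> rreg s 4"
    "r < n \<Longrightarrow> good_set n k c w (rarr s 2) B (window k (members n 2 s) (members n 3 s) (narr s 6) r) \<Longrightarrow>
      rreg (sem window_p s) 4 \<le> B"
proof -
  let ?W = "window k (members n 2 s) (members n 3 s) (narr s 6)"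
  define P where "P = (\<lambda>m s'. Inv s' \<and> rreg s' 4 \<le> rreg s 4 \<and> (\<forall>a\<in>{2, 3, 6}. narr s' a = narr s a) \<and>
    rarr s' 2 = rarr s 2 \<and> (\<forall>r<m. good_set n k c w (rarr s 2) B (?W r) \<longrightarrow> rreg s' 4 \<le> B))"
  have "P n (sem window_p s)"
    unfolding window_p_def
  proof (rule For_rule)
    fix m s' assume m: "m < n" and P: "P m s'"
    let ?s0 = "setn 8 m s'"
    let ?p = "For 10 (NPut 4 (NVar 10) window_e)"
    let ?s1 = "sem ?p ?s0"
    let ?s2 = "sem consider_p ?s1"
    have I0: "Inv ?s0" using P by (simp add: P_def)
    have I1: "Inv ?s1" using I0 by (rule Inv_sem) auto
    have "narr ?s1 4 i = (if i < nreg ?s0 0 then of_bool (i \<in> ?W m) else narr ?s0 4 i)" for i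
    proof (rule For_NPut)
      fix s'' m' assume h: "m' < nreg ?s0 0" "same {10} {} {4} {} ?s0 s''" "nreg s'' 10 = m'"
      have i: "inp s''" using inp_same[OF Inv_inp[OF I0] h(2)] by simp
      have "m' < n" using h(1) Inv_inp[OF I0] by simp
      moreover have "members n 2 s'' = members n 2 s" "members n 3 s'' = members n 3 s"
        "narr s'' 6 = narr s 6" "nreg s'' 8 = m"
        using h(2) P by (auto simp: same_def members_def P_def)
      ultimately show "nval window_e s'' = of_bool (m' \<in> ?W m)" using window_val[OF i] h(3) by simp
    qed simp
    then have n4: "0 < narr ?s1 4 i \<longleftrightarrow> i \<in> ?W m" if "i < n" for i
      using that Inv_inp[OF I0] by (simp del: sem.simps)
    have "?W m \<subseteq> {..<n}" by (auto simp: window_def Let_def members_def)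
    then have mem: "members n 4 ?s1 = ?W m"
      using n4 unfolding members_def by blast
    have r1: "rreg ?s1 4 = rreg s' 4" by (subst keeps_r) auto
    have a1: "rarr ?s1 2 = rarr s 2" using P by (subst keeps_ra) (auto simp: P_def)
    have fr: "narr ?s2 a = narr s a" if "a \<in> {2, 3, 6}" for a
    proof -
      have "narr ?s2 a = narr ?s1 a" using that by (intro keeps_na) auto
      also have "\<dots> = narr ?s0 a" using that by (intro keeps_na) auto
      finally show ?thesis using P that by (auto simp: P_def)
    qed
    have a2: "rarr ?s2 2 = rarr s 2" using a1 by (subst keeps_ra) auto
    note con = consider_p_spec[OF I1, unfolded mem r1 a1]
    have "P (Suc m) ?s2"
      unfolding P_def
    proof (intro conjI ballI allI impI)
      show "rreg ?s2 4 \<le> rreg s 4" using con(2) P unfolding P_def by linarith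
      fix r assume r: "r < Suc m" "good_set n k c w (rarr s 2) B (?W r)"
      show "rreg ?s2 4 \<le> B"
      proof (cases "r = m")
        case True
        then show ?thesis using con(3) r by simp
      next
        case False
        then have "r < m" using r(1) by simp
        then have "rreg s' 4 \<le> B" using P r(2) by (simp add: P_def)
        then show ?thesis using con(2) by linarith
      qed
    qed (use con(1) fr a2 in auto)
    then show "P (Suc m) (sem (?p ;; consider_p) ?s0)" by (simp only: sem.simps(5))
  qed (use s in \<open>auto simp: P_def Inv_def\<close>)
  then show "Inv (sem window_p s)" "rreg (sem window_p s) 4 \<le> rreg s 4"
    "r < n \<Longrightarrow> good_set n k c w (rarr s 2) B (?W r) \<Longrightarrow> rreg (sem window_p s) 4 \<le> B"
    by (auto simp: P_def)
qed

lemma copy_members: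
  assumes "inp s" "a \<noteq> b"
  shows "members n b (sem (For 10 (NPut b (NVar 10) (NGet a (NVar 10)))) s) = members n a s"
proof -
  have "narr (sem (For 10 (NPut b (NVar 10) (NGet a (NVar 10)))) s) b i =
      (if i < nreg s 0 then narr s a i else narr s b i)" for i
    using assms by (intro For_NPut) (auto simp: same_def)
  then show ?thesis using assms by (auto simp: members_def simp del: sem.simps)
qed

lemma members_keeps: "keeps_na p a \<Longrightarrow> members n a (sem p s) = members n a s"
  by (simp add: members_def)

lemma round_p_spec:
  assumes s: "Inv s"
  shows "Inv (sem round_p s)" "rreg (sem round_p s) 4 \<le> rreg s 4"
    "rreg (sem round_p s) 3 = rreg s 3 + rreg s 2"
    "members n 3 (sem round_p s) = members n 2 (sem round_p s)"
    "selection n (edge s) (rreg s 3) (rreg s 2) (dual n (edge s) (rreg s 3) (rreg s 2) (n ^ 11))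
      (members n 2 (sem round_p s))"
    "good_set n k c w (rarr s 2) B (members n 2 (sem round_p s)) \<Longrightarrow> rreg (sem round_p s) 4 \<le> B"
    "members n 3 s \<noteq> {} \<Longrightarrow> \<forall>\<pi>. nearest n c (members n 3 s) \<pi> \<longrightarrow>
      (\<exists>r<n. good_set n k c w (rarr s 2) B (window k (members n 2 (sem round_p s)) (members n 3 s) \<pi> r)) \<Longrightarrow>
      rreg (sem round_p s) 4 \<le> B"
proof -
  let ?c4 = "For 10 (NPut 4 (NVar 10) (NGet 2 (NVar 10)))"
  let ?c3 = "For 10 (NPut 3 (NVar 10) (NGet 2 (NVar 10)))"
  let ?l = "RSet 3 (RBin RAdd (RVar 3) (RVar 2))"
  define s1 where "s1 = sem primal_dual_p s"
  define s2 where "s2 = sem ?c4 s1"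
  define s3 where "s3 = sem consider_p s2"
  define s4 where "s4 = sem (nearest_p 3 6) s3"
  define s5 where "s5 = sem window_p s4"
  define s6 where "s6 = sem ?c3 s5"
  have r: "sem round_p s = sem ?l s6"
    by (simp only: round_p_def sem.simps(5) s1_def s2_def s3_def s4_def s5_def s6_def)
  have I1: "Inv s1" unfolding s1_def using s by (rule Inv_sem) auto
  have I2: "Inv s2" unfolding s2_def using I1 by (rule Inv_sem) auto
  have I3: "Inv s3" unfolding s3_def using I2 by (rule consider_p_spec(1))
  have I4: "Inv s4" unfolding s4_def using I3 by (rule Inv_sem) auto
  have I5: "Inv s5" unfolding s5_def using I4 by (rule window_p_spec(1))
  have I6: "Inv s6" unfolding s6_def using I5 by (rule Inv_sem) auto
  show "Inv (sem round_p s)" unfolding r using I6 by (rule Inv_sem) auto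
  have b: "rreg s2 4 = rreg s 4" "rreg s4 4 = rreg s3 4" "rreg (sem round_p s) 4 = rreg s5 4"
    unfolding r s1_def s2_def s4_def s6_def by (subst keeps_r; simp del: sem.simps)+
  have b3: "rreg s3 4 \<le> rreg s 4" using consider_p_spec(2)[OF I2] b by (simp add: s3_def)
  have b5: "rreg s5 4 \<le> rreg s3 4" using window_p_spec(2)[OF I4] b by (simp add: s5_def)
  show "rreg (sem round_p s) 4 \<le> rreg s 4" using b3 b5 b by linarith
  have "rreg s6 3 = rreg s 3" "rreg s6 2 = rreg s 2"
    unfolding s1_def s2_def s3_def s4_def s5_def s6_def by (subst keeps_r; simp del: sem.simps)+
  then show "rreg (sem round_p s) 3 = rreg s 3 + rreg s 2" unfolding r by simp
  define S where "S = members n 2 s1"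
  have m2: "members n 2 s2 = S" "members n 2 s3 = S" "members n 2 s4 = S" "members n 2 s5 = S"
    "members n 2 s6 = S" "members n 2 (sem round_p s) = S"
    unfolding r s2_def s3_def s4_def s5_def s6_def S_def
    by (subst members_keeps; simp add: members_keeps del: sem.simps)+
  have m4: "members n 4 s2 = S" unfolding s2_def S_def using copy_members[OF Inv_inp[OF I1]] by simp
  have m3: "members n 3 s4 = members n 3 s" "members n 3 s3 = members n 3 s"
    unfolding s1_def s2_def s3_def s4_def by (subst members_keeps; simp add: members_keeps del: sem.simps)+
  have "members n 3 s6 = S" unfolding s6_def m2(4)[symmetric] using copy_members[OF Inv_inp[OF I5]] by simp
  then show "members n 3 (sem round_p s) = members n 2 (sem round_p s)"
    unfolding m2 unfolding r by (simp add: members_def)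
  show "selection n (edge s) (rreg s 3) (rreg s 2) (dual n (edge s) (rreg s 3) (rreg s 2) (n ^ 11))
      (members n 2 (sem round_p s))"
    unfolding m2 S_def s1_def by (rule primal_dual_p_spec[OF Inv_inp[OF s]])
  have rho: "rarr s2 2 = rarr s 2" "rarr s4 2 = rarr s 2"
    unfolding s1_def s2_def s3_def s4_def by (subst keeps_ra; simp del: sem.simps)+
  show "rreg (sem round_p s) 4 \<le> B" if "good_set n k c w (rarr s 2) B (members n 2 (sem round_p s))"
    using consider_p_spec(3)[OF I2, of B] that b b5 unfolding m2 m4 rho s3_def by linarith
  show "rreg (sem round_p s) 4 \<le> B"
    if ne: "members n 3 s \<noteq> {}" and *: "\<forall>\<pi>. nearest n c (members n 3 s) \<pi> \<longrightarrow>
      (\<exists>r<n. good_set n k c w (rarr s 2) B (window k (members n 2 (sem round_p s)) (members n 3 s) \<pi> r))"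
  proof -
    have "nearest n c (members n 3 s) (narr s4 6)"
      using nearest_p_spec[OF Inv_inp[OF I3], of 3 6] ne unfolding m3 s4_def by simp
    then obtain r where "r < n" "good_set n k c w (rarr s 2) B (window k S (members n 3 s) (narr s4 6) r)"
      using * unfolding m2 by blast
    then show ?thesis using window_p_spec(3)[OF I4, of r B] b unfolding m2 m3 rho s5_def by simp
  qed
qed

lemma n2: "2 \<le> n" using k0 kn by simp

text \<open>As the bound never rises, it suffices to exhibit one moment of the run at which it is
  small enough.\<close>

definition improves :: "stm \<Rightarrow> bool" where
  "improves p \<longleftrightarrow> (\<forall>s. Inv s \<longrightarrow> Inv (sem p s) \<and> rreg (sem p s) 4 \<le> rreg s 4)"

lemma improves_iter:
  assumes "improves p" "Inv s"
  shows "Inv ((sem p ^^ t) s)" "t \<le> t' \<Longrightarrow> rreg ((sem p ^^ t') s) 4 \<le> rreg ((sem p ^^ t) s) 4"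
proof -
  show I: "Inv ((sem p ^^ t) s)" for t
    using assms by (induction t) (auto simp: improves_def)
  show "t \<le> t' \<Longrightarrow> rreg ((sem p ^^ t') s) 4 \<le> rreg ((sem p ^^ t) s) 4"
  proof (induction t' rule: nat_induct)
    case (Suc t')
    then show ?case using assms(1) I[of t'] by (force simp: improves_def le_Suc_eq)
  qed simp
qed

lemma improves_keeps:
  assumes "keeps_n p 0" "keeps_n p 1" "keeps_ra p 0" "keeps_ra p 1" "keeps_na p 0" "keeps_na p 1"
    "keeps_r p 4"
  shows "improves p"
  using assms Inv_sem[OF _ assms] by (auto simp: improves_def)

lemma improves_seq: "improves p \<Longrightarrow> improves q \<Longrightarrow> improves (p ;; q)"
  by (force simp: improves_def)

lemma improves_rep:
  assumes "improves p" "keeps_n p 0"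
  shows "improves (rep m p)"
  unfolding improves_def sem_rep[OF assms(2)]
  using improves_iter(1)[OF assms(1)] improves_iter(2)[OF assms(1), of _ 0] by auto

lemma improves_For:
  assumes "improves p" "x \<notin> {0, 1}"
  shows "improves (For x p)"
  unfolding improves_def
proof (intro allI impI)
  fix s assume s: "Inv s"
  show "Inv (sem (For x p) s) \<and> rreg (sem (For x p) s) 4 \<le> rreg s 4"
  proof (rule For_rule[where P="\<lambda>m s'. Inv s' \<and> rreg s' 4 \<le> rreg s 4", OF refl])
    fix m s' assume "Inv s' \<and> rreg s' 4 \<le> rreg s 4"
    moreover then have "Inv (setn x m s')" using assms(2) by auto
    ultimately show "Inv (sem p (setn x m s')) \<and> rreg (sem p (setn x m s')) 4 \<le> rreg s 4"
      using assms(1) unfolding improves_def by force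
  qed (use s in simp)
qed

lemma improves_round: "improves round_p"
  using round_p_spec(1,2) by (simp add: improves_def)

lemma rounds_spec:
  assumes s: "Inv s" and lam: "rreg s 3 = 0" and feas: "okm_feasible n k F \<sigma>"
    and \<rho>: "\<And>l. l < n \<Longrightarrow> 0 \<le> rarr s 2 l" and w0: "0 < w 0"
    and M: "M = sorted_desc n (\<lambda>j. c (\<sigma> j) j) ! 0" "0 < M" and u: "rreg s 2 = w 0 * M / real n ^ 8"
    and good: "\<And>l. l < n \<Longrightarrow>
      good_guess (M / real n ^ 6) (\<lambda>y. sorted_desc n (\<lambda>j. c (\<sigma> j) j) ! y) (rarr s 2) l"
  shows "rreg (sem (rep 11 round_p) s) 4 \<le> 18 * okm_cost n c w \<sigma>"
proof -
  let ?B = "18 * okm_cost n c w \<sigma>"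
  define st where "st = (\<lambda>t. (sem round_p ^^ t) s)"
  \<comment> \<open>Round t works with multiplier t * u, and its selection is visible in the state
    after it; hence the shift by one.\<close>
  define S where "S = (\<lambda>t. members n 2 (st (Suc t)))"
  have st_Suc: "st (Suc t) = sem round_p (st t)" for t by (simp add: st_def)
  have I: "Inv (st t)" for t unfolding st_def by (rule improves_iter(1)[OF improves_round s])
  have anti: "t \<le> t' \<Longrightarrow> rreg (st t') 4 \<le> rreg (st t) 4" for t t'
    unfolding st_def by (rule improves_iter(2)[OF improves_round s])
  have rho: "rarr (st t) 2 = rarr s 2" for t by (induction t) (auto simp: st_def)
  have u': "rreg (st t) 2 = rreg s 2" for t by (induction t) (auto simp: st_def)
  have l: "rreg (st t) 3 = real t * rreg s 2" for t
  proof (induction t)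
    case (Suc t)
    then show ?case unfolding st_Suc round_p_spec(3)[OF I] u' by (simp add: algebra_simps)
  qed (simp add: st_def lam)
  have m3: "members n 3 (st (Suc t)) = S t" for t
    unfolding S_def st_Suc by (rule round_p_spec(4)[OF I])
  have sel: "selection n (edge_cost n c w (rarr s 2)) (real t * rreg s 2) (rreg s 2)
      (dual n (edge_cost n c w (rarr s 2)) (real t * rreg s 2) (rreg s 2) (n ^ 11)) (S t)" for t
    using round_p_spec(5)[OF I[of t]] unfolding rho u' l S_def st_Suc .
  have St: "S t = members n 2 (sem round_p (st t))" for t by (simp add: S_def st_Suc)
  obtain t where t: "0 < t" "t < n ^ 11" "S (t - 1) \<noteq> {}"
    "good_set n k c w (rarr s 2) ?B (S t) \<or> (\<forall>\<pi>. nearest n c (S (t - 1)) \<pi> \<longrightarrow>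
      (\<exists>r<n. good_set n k c w (rarr s 2) ?B (window k (S t) (S (t - 1)) \<pi> r)))"
    using exists_good_set[OF inst feas \<rho> w0 n2 M u good sel] by blast
  have prev: "members n 3 (st t) = S (t - 1)" using m3[of "t - 1"] t(1) by simp
  have "rreg (st (Suc t)) 4 \<le> ?B"
    using t(4)
  proof
    assume "good_set n k c w (rarr s 2) ?B (S t)"
    then show ?thesis using round_p_spec(6)[OF I[of t], of ?B] unfolding S_def rho st_Suc by blast
  next
    assume "\<forall>\<pi>. nearest n c (S (t - 1)) \<pi> \<longrightarrow>
      (\<exists>r<n. good_set n k c w (rarr s 2) ?B (window k (S t) (S (t - 1)) \<pi> r))"
    then show ?thesis using round_p_spec(7)[OF I[of t], of ?B] t(3)
      unfolding prev rho St[symmetric] st_Suc by blast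
  qed
  moreover have "rreg (st (n ^ 11)) 4 \<le> rreg (st (Suc t)) 4" using t(2) by (intro anti) simp
  moreover have "sem (rep 11 round_p) s = st (n ^ 11)"
    using sem_rep[of round_p 11 s] Inv_inp[OF s] by (simp add: st_def)
  ultimately show ?thesis by simp
qed

section \<open>Reading the code of the thresholds\<close>

lemma half_p_spec:
  assumes s: "inp s" and m: "nreg s 5 \<le> n ^ 52"
  shows "nreg (sem half_p s) 6 = nreg s 5 div 2"
proof -
  let ?b = "Branch (not_e (NLt (NVar 5) (NBin NAdd (NBin NAdd (NVar 6) (NVar 6)) (NNum 2))))
     (NSet 6 (NBin NAdd (NVar 6) (NNum 1))) skip"
  let ?s0 = "sem (NSet 6 (NNum 0)) s"
  define P :: "nat \<Rightarrow> state \<Rightarrow> bool" where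
    "P = (\<lambda>i s'. nreg s' 5 = nreg s 5 \<and> nreg s' 6 = min i (nreg s 5 div 2))"
  have "P (n ^ 52) (sem (rep 52 ?b) ?s0)"
  proof (rule rep_rule)
    fix i s' assume P: "P i s'"
    have "2 * h + 2 \<le> m \<longleftrightarrow> h < m div 2" for h m :: nat by auto
    from this[of "nreg s' 6" "nreg s 5"] show "P (Suc i) (sem ?b s')" using P
      by (auto simp: P_def mult_2 min_def)
  qed (use s in \<open>auto simp: P_def\<close>)
  then show ?thesis using m by (simp add: P_def half_p_def)
qed

definition dec_state :: "state \<Rightarrow> nat \<times> nat \<times> real \<times> (nat \<Rightarrow> real) \<Rightarrow> bool" where
  "dec_state s = (\<lambda>(m, p, r, \<rho>). nreg s 5 = m \<and> nreg s 7 = p \<and> rreg s 1 = r \<and> (\<forall>y<n. rarr s 2 y = \<rho> y))"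

lemma next_block_val: "inp s \<Longrightarrow> nval next_block_e s = next_block n (nreg s 7)"
proof -
  let ?e = "not_e (NLt (NBin NAdd (NVar 7) (NBin NAdd (NVar 7) (NBin NAdd (NVar 7) (NNum 3))))
     (NBin NAdd (NVar 11) (NBin NAdd (NVar 11) (NNum 2))))"
  have "nval ?e (setn 11 m s) = of_bool (2 * (m + 1) \<le> 3 * (nreg s 7 + 1))" for m
    by (simp only: not_e_val, rule arg_cong[of _ _ of_bool]) auto
  then show "inp s \<Longrightarrow> nval next_block_e s = next_block n (nreg s 7)"
    unfolding next_block_e_def next_block_def nval.simps(5) by (simp only: inp_n)
qed

lemma decode_p_spec:
  assumes s: "inp s" and m: "nreg s 5 \<le> n ^ 52" and d: "dec_state s x"
  shows "dec_state (sem decode_p s) (decode_step n x)"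
proof -
  obtain m p r \<rho> where x: "x = (m, p, r, \<rho>)" by (metis prod_cases4)
  have d: "nreg s 5 = m" "nreg s 7 = p" "rreg s 1 = r" "\<And>y. y < n \<Longrightarrow> rarr s 2 y = \<rho> y"
    using d by (auto simp: dec_state_def x)
  let ?s1 = "sem half_p s"
  have i1: "inp ?s1" using s by (intro inp_sem) auto
  have h: "nreg ?s1 6 = m div 2" "nreg ?s1 5 = m" "nreg ?s1 7 = p" "rreg ?s1 1 = r" "rarr ?s1 2 = rarr s 2"
    using half_p_spec[OF s m] d by auto
  let ?b = "NLt (NBin NAdd (NVar 6) (NVar 6)) (NVar 5)"
  let ?p1 = "RSet 1 (RBin RMul (RNum (4/5)) (RVar 1))"
  let ?f = "For 10 (RPut 2 (NVar 10) (RIf (NLt (NVar 10) (NVar 7)) (RGet 2 (NVar 10)) (RVar 1)))"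
  let ?p2 = "NSet 7 next_block_e ;; ?f"
  have sem: "sem decode_p s = sem (NSet 5 (NVar 6)) (sem (Branch ?b ?p1 ?p2) ?s1)"
    by (simp only: decode_p_def sem.simps(5))
  have b: "0 < nval ?b ?s1 \<longleftrightarrow> odd m" using h by simp presburger
  show ?thesis
  proof (cases "odd m")
    case True
    then have "sem (Branch ?b ?p1 ?p2) ?s1 = sem ?p1 ?s1" using b by (simp only: sem.simps(6) if_True simp_thms)
    then show ?thesis using True h d
      by (simp add: sem dec_state_def x decode_step_def of_rat_divide)
  next
    case False
    let ?s2 = "sem (NSet 7 next_block_e) ?s1"
    have e: "sem (Branch ?b ?p1 ?p2) ?s1 = sem ?f ?s2"
      using False b by (simp only: sem.simps(6) if_False simp_thms sem.simps(5)[of "NSet 7 next_block_e"])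
    have i2: "inp ?s2" by (rule inp_sem[OF i1]) auto
    have n7: "nreg ?s2 7 = next_block n p" using next_block_val[OF i1] h by simp
    have r2: "rreg ?s2 1 = r" "rarr ?s2 2 = rarr s 2" using h by auto
    define Q :: "nat \<Rightarrow> state \<Rightarrow> bool" where
      "Q = (\<lambda>m s'. nreg s' 7 = next_block n p \<and> rreg s' 1 = r \<and>
        (\<forall>i. rarr s' 2 i = (if i < m \<and> next_block n p \<le> i then r else rarr s 2 i)))"
    have f: "Q n (sem ?f ?s2)"
    proof (rule For_rule)
      show "nreg ?s2 0 = n" using i2 by (rule inp_n)
      show "Q 0 ?s2" using n7 r2 by (simp add: Q_def del: sem.simps)
      fix m s' assume "m < n" "Q m s'"
      then show "Q (Suc m) (sem (RPut 2 (NVar 10) (RIf (NLt (NVar 10) (NVar 7)) (RGet 2 (NVar 10)) (RVar 1)))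
          (setn 10 m s'))"
        by (auto simp: Q_def less_Suc_eq)
    qed
    have "nreg (sem ?f ?s2) 6 = m div 2" using h(1) by (subst keeps_n) simp_all
    then show ?thesis using False f d unfolding sem e
      by (auto simp: Q_def dec_state_def x decode_step_def simp del: sem.simps(7))
  qed
qed

lemma decode_step_fst: "fst (decode_step n x) \<le> fst x"
  by (cases x) (auto simp: decode_step_def)

lemma code_p_spec:
  assumes s: "Inv s" and M0: "0 \<le> rreg s 0" and m: "nreg s 4 \<le> n ^ 52"
    and dec: "decode n (nreg s 4) (rreg s 0) (n ^ 6) = (m', p', r', \<rho>)"
    and feas: "okm_feasible n k F \<sigma>" and w0: "0 < w 0"
    and M: "rreg s 0 = sorted_desc n (\<lambda>j. c (\<sigma> j) j) ! 0" "0 < rreg s 0"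
    and u: "rreg s 2 = w 0 * rreg s 0 / real n ^ 8"
    and good: "\<And>l. l < n \<Longrightarrow>
      good_guess (rreg s 0 / real n ^ 6) (\<lambda>y. sorted_desc n (\<lambda>j. c (\<sigma> j) j) ! y) \<rho> l"
  shows "rreg (sem code_p s) 4 \<le> 18 * okm_cost n c w \<sigma>"
proof -
  let ?a = "NSet 5 (NVar 4) ;; NSet 7 (NNum 0) ;; RSet 1 (RVar 0)"
  let ?f = "For 10 (RPut 2 (NVar 10) (RVar 0))"
  define s1 where "s1 = sem ?a s"
  define s2 where "s2 = sem ?f s1"
  define s3 where "s3 = sem (rep 6 decode_p) s2"
  define s4 where "s4 = sem (RSet 3 (RNum 0)) s3"
  have code: "sem code_p s = sem (rep 11 round_p) s4"
    by (simp only: code_p_def sem.simps(5) s1_def s2_def s3_def s4_def)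
  have I1: "Inv s1" unfolding s1_def using s by (rule Inv_sem) auto
  have I2: "Inv s2" unfolding s2_def using I1 by (rule Inv_sem) auto
  have I3: "Inv s3" unfolding s3_def using I2 by (rule Inv_sem) auto
  have I4: "Inv s4" unfolding s4_def using I3 by (rule Inv_sem) auto
  have f: "rarr s2 2 y = (if y < nreg s1 0 then rreg s1 0 else rarr s1 2 y)" for y
    unfolding s2_def by (rule For_RPut) (auto simp: same_def)
  have "nreg s2 5 = nreg s1 5" "nreg s2 7 = nreg s1 7" "rreg s2 1 = rreg s1 1"
    unfolding s2_def by (subst keeps_n keeps_r; simp)+
  then have "dec_state s2 (nreg s 4, 0, rreg s 0, \<lambda>_. rreg s 0)"
    using f inp_n[OF Inv_inp[OF I1]] by (simp add: dec_state_def) (simp add: s1_def)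
  then have d0: "dec_state s2 (decode n (nreg s 4) (rreg s 0) 0)" by (simp add: decode_def)
  \<comment> \<open>The unread part has to stay within \<open>n ^ 52\<close> for halving to be
    exact; reading never increases it.\<close>
  define P where "P = (\<lambda>t s'. inp s' \<and> dec_state s' (decode n (nreg s 4) (rreg s 0) t) \<and> nreg s' 5 \<le> n ^ 52)"
  have "P (n ^ 6) s3"
    unfolding s3_def
  proof (rule rep_rule)
    show "P 0 s2" using d0 Inv_inp[OF I2] m by (auto simp: P_def decode_def dec_state_def)
    fix t s' assume P: "P t s'"
    let ?x = "decode n (nreg s 4) (rreg s 0) t"
    have d: "dec_state (sem decode_p s') (decode_step n ?x)"
      using P decode_p_spec by (simp add: P_def)
    have "nreg s' 5 = fst ?x" "nreg (sem decode_p s') 5 = fst (decode_step n ?x)"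
      using P d by (auto simp: P_def dec_state_def split: prod.splits)
    then have "nreg (sem decode_p s') 5 \<le> n ^ 52" using decode_step_fst[of ?x] P by (simp add: P_def)
    then show "P (Suc t) (sem decode_p s')" using P d by (simp add: P_def decode_def)
  qed (use Inv_inp[OF I2] in auto)
  then have rho: "\<And>y. y < n \<Longrightarrow> rarr s3 2 y = \<rho> y" by (auto simp: P_def dec dec_state_def)
  have rho4: "rarr s4 2 y = \<rho> y" if "y < n" for y using rho[OF that] by (simp add: s4_def)
  have "rreg s4 2 = rreg s 2" unfolding s4_def s3_def s2_def s1_def
    by (subst keeps_r; simp del: sem.simps)+
  then show ?thesis unfolding code
    using I4 feas w0 M u good rho4 decode_nonneg[OF M0 dec]
    by (intro rounds_spec[where M="rreg s 0"]) (auto simp: good_guess_def s4_def)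
qed

lemma improves_code: "improves code_p"
  unfolding code_p_def
  by (intro improves_seq improves_rep improves_round) (auto intro!: improves_keeps)

lemma pair_p_spec:
  assumes s: "Inv s" and ab: "nreg s 2 = a" "nreg s 3 = b" "a < n" "b < n"
    and feas: "okm_feasible n k F \<sigma>" and w0: "0 < w 0"
    and M: "c a b = sorted_desc n (\<lambda>j. c (\<sigma> j) j) ! 0" "0 < c a b"
  shows "rreg (sem pair_p s) 4 \<le> 18 * okm_cost n c w \<sigma>"
proof -
  let ?B = "18 * okm_cost n c w \<sigma>"
  let ?s1 = "sem (RSet 0 (dist_e (NVar 2) (NVar 3))) s"
  let ?u = "RBin RDiv (RBin RMul (RGet 1 (NNum 0)) (RVar 0)) (power8_e size_e)"
  let ?s2 = "sem (RSet 2 ?u) ?s1"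
  let ?s3 = "sem (NSet 4 (NNum 0)) ?s2"
  let ?p = "code_p ;; NSet 4 (NBin NAdd (NVar 4) (NNum 1))"
  have pair: "sem pair_p s = sem (rep 52 ?p) ?s3" by (simp only: pair_p_def sem.simps(5))
  have I1: "Inv ?s1" using s by (rule Inv_sem) auto
  have I2: "Inv ?s2" using I1 by (rule Inv_sem) auto
  have I3: "Inv ?s3" using I2 by (rule Inv_sem) auto
  have r0: "rreg ?s1 0 = c a b"
    using dist_val[OF Inv_inp[OF s], of "NVar 2" a "NVar 3" b] ab by simp
  have "rval (RGet 1 (NNum 0)) ?s1 = w 0" using inp_w[OF Inv_inp[OF I1], of 0] n2 by simp
  moreover have "rval size_e ?s1 = real n" using inp_n[OF Inv_inp[OF I1]] by (simp add: size_e_def)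
  ultimately have u: "rreg ?s2 2 = w 0 * c a b / real n ^ 8"
    using r0 by (simp add: power8_e_def Let_def eval_nat_numeral mult.assoc)
  have r3: "rreg ?s3 0 = c a b" "rreg ?s3 2 = w 0 * c a b / real n ^ 8" "nreg ?s3 4 = 0"
    using r0 u by simp_all
  let ?sd = "\<lambda>y. sorted_desc n (\<lambda>j. c (\<sigma> j) j) ! y"
  have "\<exists>m < n ^ 52. \<exists>m' p' r' \<rho>. decode n m (c a b) (n ^ 6) = (m', p', r', \<rho>) \<and>
      (\<forall>y<n. good_guess (c a b / real n ^ 6) ?sd \<rho> y)"
    using sorted_desc_antimono sorted_desc_nonneg c_nonneg M(1) by (intro decode_exists[OF n2]) auto
  then obtain m0 m' p' r' \<rho> where code: "m0 < n ^ 52" "decode n m0 (c a b) (n ^ 6) = (m', p', r', \<rho>)"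
    "\<forall>y<n. good_guess (c a b / real n ^ 6) ?sd \<rho> y" by blast
  define P where "P = (\<lambda>i s'. Inv s' \<and> nreg s' 4 = i \<and> rreg s' 0 = c a b \<and> rreg s' 2 = w 0 * c a b / real n ^ 8
    \<and> (m0 < i \<longrightarrow> rreg s' 4 \<le> ?B))"
  have "P (n ^ 52) (sem (rep 52 ?p) ?s3)"
  proof (rule rep_rule)
    show "nreg ?s3 0 = n" using Inv_inp[OF I3] by (rule inp_n)
    show "P 0 ?s3" using I3 r3 by (simp add: P_def del: sem.simps)
    fix i s' assume i: "i < n ^ 52" and P: "P i s'"
    have I: "Inv (sem code_p s')" "rreg (sem code_p s') 4 \<le> rreg s' 4"
      using improves_code P by (auto simp: improves_def P_def)
    have "rreg (sem code_p s') 4 \<le> ?B" if "m0 < Suc i"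
    proof (cases "m0 = i")
      case True
      then show ?thesis using P i code feas w0 M c_nonneg
        by (intro code_p_spec[where m'=m' and p'=p' and r'=r' and \<rho>=\<rho>]) (auto simp: P_def)
    next
      case False
      then show ?thesis using that P I by (auto simp: P_def)
    qed
    then show "P (Suc i) (sem ?p s')" using P I by (simp add: P_def)
  qed simp
  then show ?thesis using code(1) unfolding pair P_def by blast
qed

lemma improves_pair: "improves pair_p"
  unfolding pair_p_def
  by (intro improves_seq improves_rep improves_code) (auto intro!: improves_keeps)

text \<open>The comparison is with an arbitrary feasible solution, so no optimal one has to be
  singled out. The right pair is a client of largest cost in that solution together with its
  center.\<close>

lemma okm_p_spec:
  defines "s \<equiv> sem okm_p (okm_input n k c w)"
  assumes feas: "okm_feasible n k F \<sigma>"
  shows "okm_feasible n k (output_centers k s) (output_assignment s)"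
    "okm_cost n c w (output_assignment s) \<le> 18 * okm_cost n c w \<sigma>"
proof -
  let ?B = "18 * okm_cost n c w \<sigma>"
  let ?s0 = "okm_input n k c w"
  let ?f = "For 10 (NPut 0 (NVar 10) (NVar 10))"
  let ?b = "RSet 4 (RBin RMul (RGet 1 (NNum 0)) (RSum 10 (dist_e (NNum 0) (NVar 10))))"
  define s1 where "s1 = sem ?f ?s0"
  define s2 where "s2 = sem ?b s1"
  have s: "s = sem (For 2 (For 3 pair_p)) s2"
    by (simp only: s_def okm_p_def sem.simps(5) s1_def s2_def)
  have i0: "inp ?s0" by (simp add: okm_input_def inp_def fun_eq_iff)
  have i1: "inp s1" unfolding s1_def using i0 by (rule inp_sem) auto
  have i2: "inp s2" unfolding s2_def using i1 by (rule inp_sem) auto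
  have "narr s1 0 j = (if j < nreg ?s0 0 then j else narr ?s0 0 j)" for j
    unfolding s1_def by (rule For_NPut) auto
  then have c0: "output_centers k s2 = {..<k}"
    using inp_n[OF i0] kn by (auto simp: output_centers_def s2_def image_iff)
  have "narr s1 1 = narr ?s0 1" unfolding s1_def by (rule keeps_na) simp
  then have a0: "output_assignment s2 = (\<lambda>_. 0)"
    by (simp add: output_assignment_def s2_def okm_input_def)
  have d0: "rval (dist_e (NNum 0) (NVar 10)) (setn 10 j s1) = c 0 j" if "j < n" for j
    by (rule dist_val) (use i1 that n2 in auto)
  have best: "rreg s2 4 = w 0 * (\<Sum>j<n. c 0 j)"
    using i1 d0 inp_w[OF i1, of 0] n2 by (simp add: s2_def)
  have "okm_cost n c w (\<lambda>_. 0) \<le> proxy_cost n w (\<lambda>l. 0) (\<lambda>j. c 0 j)"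
    unfolding okm_cost_def by (rule ordered_cost_le_proxy[OF inst])
  also have "\<dots> = (\<Sum>l<n. gap n w l) * (\<Sum>j<n. c 0 j)"
    by (simp add: proxy_cost_def c_nonneg sum_distrib_right)
  also have "(\<Sum>l<n. gap n w l) = w 0" using sum_gap n2 by simp
  finally have I2: "Inv s2" using i2 c0 a0 best kn k0 by (auto simp: Inv_def okm_feasible_def)
  have I: "Inv s" unfolding s using I2 improves_For[OF improves_For[OF improves_pair, of 3], of 2]
    by (simp add: improves_def del: sem.simps)
  then show "okm_feasible n k (output_centers k s) (output_assignment s)" by (simp add: Inv_def)
  interpret Metric_space "{..<n}" c using inst by (simp add: okm_instance_def)
  have w_nonneg: "0 \<le> w j" "w j \<le> w 0" if "j < n" for j using inst that by (auto simp: okm_instance_def)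
  show "okm_cost n c w (output_assignment s) \<le> ?B"
  proof (cases "w 0 = 0")
    \<comment> \<open>All weights vanish here and so do all costs; the step \<open>u\<close> would
      be zero.\<close>
    case True
    then have "w j = 0" if "j < n" for j using w_nonneg[OF that] by simp
    then show ?thesis by (simp add: okm_cost_def ordered_cost_def)
  next
    case False
    then have w0: "0 < w 0" using w_nonneg[of 0] n2 by simp
    let ?o = "\<lambda>j. c (\<sigma> j) j"
    have F: "F \<subseteq> {..<n}" "card F = k" "\<And>j. j < n \<Longrightarrow> \<sigma> j \<in> F" using feas by (auto simp: okm_feasible_def)
    \<comment> \<open>Since k < n some client is not a center; it has positive cost, and so M >
      0.\<close>
    have "\<not> {..<n} \<subseteq> F" using F kn by (metis card_lessThan card_mono finite_lessThan finite_subset not_le)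
    then obtain j where j: "j < n" "j \<notin> F" by auto
    then have "0 < ?o j" using F zero[of "\<sigma> j" j] nonneg[of "\<sigma> j" j] by (metis less_eq_real_def lessThan_iff subsetD)
    have "?o j \<in> set (sorted_desc n ?o)" using j by (auto simp: set_sorted_desc)
    then obtain y where y: "y < n" "?o j = sorted_desc n ?o ! y" by (auto simp: in_set_conv_nth)
    then have M: "0 < sorted_desc n ?o ! 0" using sorted_desc_antimono[of 0 y n ?o] \<open>0 < ?o j\<close> by simp
    have "sorted_desc n ?o ! 0 \<in> ?o ` {..<n}"
      using n2 set_sorted_desc[of n ?o] by (metis length_sorted_desc nth_mem order_less_le_trans pos2)
    then obtain b where b: "b < n" "sorted_desc n ?o ! 0 = c (\<sigma> b) b" by auto
    have a: "\<sigma> b < n" using F b by auto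
    define P where "P = (\<lambda>m s'. Inv s' \<and> (\<sigma> b < m \<longrightarrow> rreg s' 4 \<le> ?B))"
    have "P n (sem (For 2 (For 3 pair_p)) s2)"
    proof (rule For_rule)
      fix m s' assume m: "m < n" and P: "P m s'"
      let ?s = "setn 2 m s'"
      have I0: "Inv ?s" using P by (simp add: P_def)
      have "improves (For 3 pair_p)" by (intro improves_For improves_pair) simp
      then have imp: "Inv (sem (For 3 pair_p) ?s) \<and> rreg (sem (For 3 pair_p) ?s) 4 \<le> rreg ?s 4"
        using I0 unfolding improves_def by blast
      have "rreg (sem (For 3 pair_p) ?s) 4 \<le> ?B" if "m = \<sigma> b"
      proof -
        define Q where "Q = (\<lambda>i s'. Inv s' \<and> nreg s' 2 = m \<and> (b < i \<longrightarrow> rreg s' 4 \<le> ?B))"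
        have "Q n (sem (For 3 pair_p) ?s)"
        proof (rule For_rule)
          fix i s'' assume i: "i < n" and Q: "Q i s''"
          let ?t = "setn 3 i s''"
          have It: "Inv ?t" using Q by (simp add: Q_def)
          have imp': "Inv (sem pair_p ?t) \<and> rreg (sem pair_p ?t) 4 \<le> rreg ?t 4"
            using improves_pair It unfolding improves_def by blast
          have "rreg (sem pair_p ?t) 4 \<le> ?B" if "i = b"
            by (rule pair_p_spec[OF It _ _ _ _ feas w0, where a="\<sigma> b" and b=b])
              (use Q \<open>m = \<sigma> b\<close> that a b M in \<open>auto simp: Q_def\<close>)
          then show "Q (Suc i) (sem pair_p ?t)" using Q imp' by (auto simp: Q_def less_Suc_eq)
        qed (use I0 in \<open>auto simp: Q_def dest: Inv_inp\<close>)
        then show ?thesis using b by (simp add: Q_def del: sem.simps)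
      qed
      then show "P (Suc m) (sem (For 3 pair_p) ?s)"
        using P imp by (auto simp: P_def less_Suc_eq simp del: sem.simps)
    qed (use I2 in \<open>auto simp: P_def dest: Inv_inp\<close>)
    then have "rreg s 4 \<le> ?B" using a unfolding s P_def by blast
    then show ?thesis using I unfolding Inv_def by linarith
  qed
qed

end

section \<open>Ratio and running time\<close>

lemma poly_mono_nonneg:
  fixes p :: "real poly"
  assumes "\<And>i. 0 \<le> coeff p i" "0 \<le> x" "x \<le> y"
  shows "poly p x \<le> poly p y"
  unfolding poly_altdef using assms by (intro sum_mono mult_left_mono power_mono) auto

lemma okm_p_approx: "okm_approx_algorithm (scomp okm_p 0) (\<lambda>n. real (stime okm_p n)) 18"
  unfolding okm_approx_algorithm_def
proof (intro allI impI)
  fix n k c w assume inst: "okm_instance n k c w"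
  let ?s0 = "okm_input n k c w"
  obtain t s where ex: "exec (scomp okm_p 0) ?s0 t s" "t \<le> stime okm_p (nreg ?s0 0)"
    "narr s = narr (sem okm_p ?s0)"
    using compile_correct[OF swf_okm_p] by blast
  have "okm_feasible n k (output_centers k s) (output_assignment s) \<and>
      okm_cost n c w (output_assignment s) \<le> 18 * okm_opt n k c w"
    if feas: "\<exists>F \<sigma>. okm_feasible n k F \<sigma>"
  proof -
    obtain F \<sigma> where F: "okm_feasible n k F \<sigma>" using feas by blast
    have "0 < n" using inst by (auto simp: okm_instance_def)
    then have "F \<noteq> {}" "finite F" using F finite_subset by (auto simp: okm_feasible_def)
    then have "0 < k" using F by (auto simp: okm_feasible_def card_gt_0_iff)
    then interpret okm n k c w using inst by unfold_locales
    have out: "output_centers k s = output_centers k (sem okm_p ?s0)"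
      "output_assignment s = output_assignment (sem okm_p ?s0)"
      using ex(3) by (simp_all add: output_centers_def output_assignment_def)
    have "okm_cost n c w (output_assignment s) / 18 \<le> okm_opt n k c w"
      unfolding okm_opt_def
    proof (rule cInf_greatest)
      fix x assume "x \<in> {okm_cost n c w \<sigma> |F \<sigma>. okm_feasible n k F \<sigma>}"
      then show "okm_cost n c w (output_assignment s) / 18 \<le> x"
        using okm_p_spec(2) unfolding out by fastforce
    qed (use F in blast)
    then show ?thesis using okm_p_spec(1)[OF F] unfolding out by simp
  qed
  then show "\<exists>t s. exec (scomp okm_p 0) ?s0 t s \<and> real t \<le> real (stime okm_p n) \<and>
      ((\<exists>F \<sigma>. okm_feasible n k F \<sigma>) \<longrightarrow>
        okm_feasible n k (output_centers k s) (output_assignment s) \<and>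
        okm_cost n c w (output_assignment s) \<le> 18 * okm_opt n k c w)"
    using ex(1,2) by (auto simp: okm_input_def)
qed

theorem theorem4:
  shows "\<exists>(C::real) (p::real poly). \<forall>\<epsilon>::real. \<epsilon> > 0 \<longrightarrow>
           (\<exists>P. okm_approx_algorithm P (\<lambda>n. poly p (time_scale \<epsilon> n)) (18 + C * \<epsilon>))"
proof -
  obtain p :: "real poly" where p: "\<And>i. 0 \<le> coeff p i" "\<And>n. real (stime okm_p n) \<le> poly p (real n)"
    using poly_bounded_stime[of okm_p] unfolding poly_bounded_def by blast
  have time: "real (stime okm_p n) \<le> poly p (time_scale \<epsilon> n)" for n \<epsilon>
  proof -
    have "real (stime okm_p n) \<le> poly p (real n)" by (rule p)
    also have "\<dots> \<le> poly p (time_scale \<epsilon> n)"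
      by (rule poly_mono_nonneg[OF p(1)]) (auto simp: time_scale_def)
    finally show ?thesis .
  qed
  \<comment> \<open>The constant behind O(\<epsilon>) is 0: one program serves all \<epsilon>, and
    its time is polynomial already in n.\<close>
  have "okm_approx_algorithm (scomp okm_p 0) (\<lambda>n. poly p (time_scale \<epsilon> n)) (18 + 0 * \<epsilon>)" for \<epsilon>
    using okm_p_approx order_trans[OF _ time] unfolding okm_approx_algorithm_def mult_zero_left add_0_right
    by meson
  then show ?thesis by blast
qed

end
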